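(* Let $\mathfrak a^{(0)},\mathfrak a^{(1)}\in H^+_{\mathbb C^2}$ and let $A^+(\omega)=\big(\mathfrak a^{(0)}(\omega)\ \ \mathfrak a^{(1)}(\omega)\big)$ be the $(2\times2)$-matrix function with these columns. Then $A^+$ is an admissible $M^+$-inner matrix function (see context: either unitary a.e. and satisfying the coefficient conditions (I)--(V), or the degenerate one-dimensional case) if and only if it is of one of the following five types. Type 1. For some $u_0\in\mathbb C^2$ with $\|u_0\|=1$: $\ \mathfrak a^{(0)}(\omega)=u_0$, $\ \mathfrak a^{(1)}(\omega)=0$. Type 2. For some orthonormal basis $\{u_0,u_1\}$ of $\mathbb C^2$: $\ \mathfrak a^{(0)}(\omega)=\omega u_0$, $\ \mathfrak a^{(1)}(\omega)=u_1$. Type 3. For some orthonormal basis $\{u_0,u_1\}$ of $\mathbb C^2$, $0<\rho<1$ and $\theta\in\mathbb R$: $$\mathfrak a^{(0)}(\omega)=\rho u_0+\omega(1-\rho^2)^{1/2}u_1,\qquad \mathfrak a^{(1)}(\omega)=e^{i\theta}\big[(1-\rho^2)^{1/2}u_0-\omega\rho u_1\big].$$ Type 4. For some orthonormal basis $\{u_0,u_1\}$ of $\mathbb C^2$, $0<\rho<1$ and $\theta\in\mathbb R$: $$\mathfrak a^{(0)}(\omega)=\Big(\rho+(1-\rho^2)e^{i\theta}\sum_{k=1}^\infty\omega^k(-\rho e^{i\theta})^{k-1}\Big)u_0,\qquad \mathfrak a^{(1)}(\omega)=u_1.$$ Type 5. For some $\rho_0\in\mathbb C$ with $0<|\rho_0|<1$,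 unit vectors $u_0,u_1,v\in\mathbb C^2$ with $\langle v,u_0\rangle\ne0$, $\langle u_1,u_0\rangle\neq0$ and $$\frac{|\rho_0|^2}{1-|\rho_0|^2}\langle u_0,u_1\rangle\langle v,u_0\rangle+\langle v,u_1\rangle=0,$$ and $\rho_1,\tau_0\in\mathbb C$ with arbitrary arguments and moduli given by $$|\rho_1|^2=\frac{1-|\rho_0|^2}{1+\frac{|\rho_0|^2}{1-|\rho_0|^2}|\langle v,u_0\rangle|^2},\qquad |\tau_0|^2=\frac{1}{1+\frac{|\rho_0|^2}{1-|\rho_0|^2}|\langle u_1,u_0\rangle|^2},$$ setting $$r=-\frac{\overline{\rho_0}}{\overline{\rho_1}}\,\frac{\langle v,u_0\rangle}{1+\frac{|\rho_0|^2}{1-|\rho_0|^2}|\langle v,u_0\rangle|^2},\qquad \tau_1=\tau_0\,\frac{\rho_1\langle u_1,v\rangle}{\rho_0\langle u_0,v\rangle},$$ one has $$\mathfrak a^{(0)}(\omega)=\rho_0u_0+\rho_1v\sum_{k=1}^\infty\omega^kr^{k-1},\qquad \mathfrak a^{(1)}(\omega)=\tau_0u_1+\tau_1v\sum_{k=1}^\infty\omega^kr^{k-1}.$$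
   Context: Inner products are linear in the first argument. $\partial\mathbb D$ is the unit circle. $H^+_{\mathbb C^2}=H^+(\partial\mathbb D;\mathbb C^2)$ is the Hardy space of functions $\sum_{k\ge0}\omega^kh_k$, $h_k\in\mathbb C^2$, $\sum\|h_k\|^2<\infty$, a subspace of $L^2(\partial\mathbb D;\mathbb C^2)$ with normalized measure. Write $\mathfrak a^{(j)}(\omega)=\sum_{k\ge0}\omega^ka^{(j)}_k$, $j=0,1$. An $M^+$-inner function is a weakly measurable $A^+:\partial\mathbb D\to\mathcal L(\mathbb C^2)$ mapping constant functions into $H^+_{\mathbb C^2}$ and such that $A^+(\omega)$ is, for a.e. $\omega$, a partial isometry with the same initial space (independent of $\omega$). An $M^+$-inner $A^+=(\mathfrak a^{(0)}\ \mathfrak a^{(1)})$ is called admissible here if one of the following holds. (Two-dimensional case) $A^+(\omega)$ is unitary for a.e. $\omega$ (equivalently $\langle\mathfrak a^{(i)},\omega^m\mathfrak a^{(j)}\rangle_{L^2(\partial\mathbb D;\mathbb C^2)}=\delta_m\delta_{i-j}$ for $m\in\mathbb Z$, $i,j\in\{0,1\}$, where $\delta_n=1$ if $n=0$ and $0$ otherwise), $\|a^{(0)}_0\|<1$, and: (I) $\dfrac{|\langle a^{(0)}_p,a^{(0)}_0\rangle|^2}{1-\|a^{(0)}_0\|^2}=1-\sum_{k=0}^p\|a^{(0)}_k\|^2$ for $p>0$; (II) $\dfrac{|\langle a^{(1)}_p,a^{(0)}_0\rangle|^2}{1-\|a^{(0)}_0\|^2}=1-\sum_{k=0}^p\|a^{(1)}_k\|^2$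 for $p\ge0$; (III) $\dfrac{\langle a^{(0)}_{p'},a^{(0)}_0\rangle\langle a^{(0)}_0,a^{(0)}_p\rangle}{1-\|a^{(0)}_0\|^2}=-\sum_{r=0}^p\langle a^{(0)}_{p'-r},a^{(0)}_{p-r}\rangle$ for $0<p<p'$; (IV) $\dfrac{\langle a^{(1)}_{p'},a^{(0)}_0\rangle\langle a^{(0)}_0,a^{(1)}_p\rangle}{1-\|a^{(0)}_0\|^2}=-\sum_{r=0}^p\langle a^{(1)}_{p'-r},a^{(1)}_{p-r}\rangle$ for $0\le p<p'$; (V) $\dfrac{\langle a^{(1)}_{p'},a^{(0)}_0\rangle\langle a^{(0)}_0,a^{(0)}_p\rangle}{1-\|a^{(0)}_0\|^2}$ equals $-\sum_{r=0}^p\langle a^{(1)}_{p'-r},a^{(0)}_{p-r}\rangle$ if $0<p\le p'$, and $-\sum_{r=0}^{p'}\langle a^{(1)}_{p'-r},a^{(0)}_{p-r}\rangle$ if $0\le p'<p$. (One-dimensional case) the initial space of $A^+$ is one-dimensional, $\mathfrak a^{(1)}=0$, and there are $B_0\in\mathbb C\setminus\{0\}$ and $\psi_1,\psi_2\in L^2[0,1]$ such that $\{D^kT^j\psi_i:i=1,2,\ k,j\in\mathbb Z\}$ is a tight frame for $L^2(\mathbb R)$ with frame bound $|B_0|^2$ (i.e. $\sum_{i,k,j}|\langle f,D^kT^j\psi_i\rangle|^2=|B_0|^2\|f\|^2$ for all $f\in L^2(\mathbb R)$) and $\mathfrak h_0=B_0\mathfrak a^{(0)}$, $\mathfrak h_1=0$.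 Here $[Tf](x)=f(x-1)$, $[Df](x)=2^{1/2}f(2x)$, $\mathfrak h_0(\omega)=\sum_{k\ge0}\omega^k\Psi_{2^k}$, $\mathfrak h_1(\omega)=\sum_{k\ge0}\omega^k\Psi_{2^{k+1}+1}$, where $\Psi_i=(\langle\psi_1,L_i^{(0)}\rangle,\langle\psi_2,L_i^{(0)}\rangle)^{T}\in\mathbb C^2$, $L_0^{(0)}=\chi_{[0,1)}$, $L^{(0)}_{2^p+q}(x)=2^{p/2}\psi^H(2^px-q)$ for $p\ge0$, $0\le q<2^p$, and $\psi^H=\chi_{[0,1/2)}-\chi_{[1/2,1)}$. *)

theory Defs
  imports "HOL-Analysis.Analysis" "HOL-Library.Discrete_Functions"
begin

text \<open>The library's \<open>inner\<close> on \<^typ>\<open>complex^2\<close> is the real inner product;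
  this is the Hermitian one, linear in the first argument. The library norm on
  \<^typ>\<open>complex^2\<close> is the norm it induces.\<close>

definition cinner :: "complex^2 \<Rightarrow> complex^2 \<Rightarrow> complex"
  where "cinner x y = (\<Sum>i\<in>UNIV. x $ i * cnj (y $ i))"

lemma cinner_self: "cinner x x = of_real ((norm x)\<^sup>2)"
  by (simp add: cinner_def norm_vec_def L2_set_def sum_nonneg complex_norm_square[symmetric]
      del: complex_norm_square of_real_power)

definition orthonormal_basis :: "complex^2 \<Rightarrow> complex^2 \<Rightarrow> bool"
  where "orthonormal_basis u0 u1 \<longleftrightarrow>
    norm u0 = 1 \<and> norm u1 = 1 \<and> cinner u0 u1 = 0 \<and> vec.span {u0, u1} = UNIV"

definition cadjoint :: "complex^2^2 \<Rightarrow> complex^2^2"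
  where "cadjoint A = (\<chi> i j. cnj (A $ j $ i))"

definition unitary_mat :: "complex^2^2 \<Rightarrow> bool"
  where "unitary_mat A \<longleftrightarrow> cadjoint A ** A = mat 1 \<and> A ** cadjoint A = mat 1"

definition partial_isometry_with :: "(complex^2) set \<Rightarrow> complex^2^2 \<Rightarrow> bool"
  where "partial_isometry_with V A \<longleftrightarrow>
    vec.subspace V \<and>
    (\<forall>x\<in>V. norm (A *v x) = norm x) \<and>
    (\<forall>x. (\<forall>y\<in>V. cinner x y = 0) \<longrightarrow> A *v x = 0)"

definition of_columns :: "complex^2 \<Rightarrow> complex^2 \<Rightarrow> complex^2^2"
  where "of_columns x y = (\<chi> i j. if j = 1 then x $ i else y $ i)"


section \<open>The Hardy space on the circle\<close>

text \<open>Normalized arc length on the unit circle. Elements of \<open>L\<^sup>2\<close> are represented by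
  functions, so equalities between them are stated almost everywhere.\<close>

definition circle :: "complex measure"
  where "circle =
    distr (uniform_measure lborel {0..<2 * pi}) (restrict_space borel (sphere 0 1)) cis"

definition square_integrable :: "'a measure \<Rightarrow> ('a \<Rightarrow> 'b::{banach, second_countable_topology}) \<Rightarrow> bool"
  where "square_integrable M f \<longleftrightarrow> f \<in> borel_measurable M \<and> integrable M (\<lambda>x. (norm (f x))\<^sup>2)"

text \<open>\<open>f(\<omega>) = (\<Sum>k. \<omega>\<^sup>k h\<^sub>k)\<close> with square-summable coefficients, the series converging in
  \<open>L\<^sup>2\<close> of the circle.\<close>

definition hardy_expansion :: "(complex \<Rightarrow> complex^2) \<Rightarrow> (nat \<Rightarrow> complex^2) \<Rightarrow> bool"
  where "hardy_expansion f h \<longleftrightarrow>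
    square_integrable circle f \<and>
    summable (\<lambda>k. (norm (h k))\<^sup>2) \<and>
    (\<lambda>n. \<integral>\<omega>. (norm (f \<omega> - (\<Sum>k<n. \<omega> ^ k *s h k)))\<^sup>2 \<partial>circle) \<longlonglongrightarrow> 0"

definition hardy_space :: "(complex \<Rightarrow> complex^2) set"
  where "hardy_space = {f. \<exists>h. hardy_expansion f h}"

text \<open>The expansion is unique, see \<open>hardy_coeff_eqI\<close> below.\<close>

definition hardy_coeff :: "(complex \<Rightarrow> complex^2) \<Rightarrow> nat \<Rightarrow> complex^2"
  where "hardy_coeff f = (THE h. hardy_expansion f h)"

lemma emeasure_space_circle: "emeasure circle (space circle) = 1"
  and cis_measurable_circle: "cis \<in> uniform_measure lborel {0..<2 * pi} \<rightarrow>\<^sub>M restrict_space borel (sphere 0 1)"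
proof -
  show *: "cis \<in> uniform_measure lborel {0..<2 * pi} \<rightarrow>\<^sub>M restrict_space borel (sphere 0 1)"
    by (intro measurable_restrict_space2)
      (auto simp: measurable_cong_sets[OF sets_uniform_measure refl] intro!: borel_measurable_continuous_onI continuous_intros)
  let ?U = "uniform_measure lborel {0..<2 * pi}"
  have "cis -` space (restrict_space borel (sphere 0 1)) \<inter> space ?U = UNIV"
    by (auto simp: space_restrict_space)
  then have "emeasure circle (space (restrict_space borel (sphere 0 1))) = emeasure ?U UNIV"
    unfolding circle_def by (subst emeasure_distr[OF * sets.top]) simp
  also have "\<dots> = 1"
    using emeasure_uniform_measure[of "{0..<2 * pi}" lborel UNIV]
      emeasure_uniform_measure[of "{0..<2 * pi}" lborel "{0..<2 * pi}"]
      emeasure_uniform_measure_1[of lborel "{0..<2 * pi}"]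
    by simp
  finally show "emeasure circle (space circle) = 1"
    by (simp add: circle_def)
qed

lemma integral_circle:
  fixes g :: "complex \<Rightarrow> 'b::euclidean_space"
  assumes "continuous_on UNIV g"
  shows "(\<integral>\<omega>. g \<omega> \<partial>circle) = (1 / (2 * pi)) *\<^sub>R integral {0..2 * pi} (\<lambda>t. g (cis t))"
proof -
  have c: "continuous_on UNIV (\<lambda>t. g (cis t))"
    by (rule continuous_on_compose2[OF assms]) (auto intro!: continuous_intros)
  then have mc: "(\<lambda>t. g (cis t)) \<in> borel_measurable lborel"
    by (simp add: borel_measurable_continuous_onI)
  have "g \<in> borel_measurable borel"
    using assms by (rule borel_measurable_continuous_onI)
  then have m: "g \<in> borel_measurable (restrict_space borel (sphere 0 1))"
    by (rule measurable_restrict_space1)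
  have e: "indicator {0..<2 * pi} x / emeasure lborel {0..<2 * pi}
      = ennreal (indicator {0..<2 * pi} x / (2 * pi))" for x :: real
    by (auto simp: indicator_def divide_ennreal simp flip: ennreal_1)
  have "(\<integral>\<omega>. g \<omega> \<partial>circle) = (\<integral>t. g (cis t) \<partial>uniform_measure lborel {0..<2 * pi})"
    unfolding circle_def by (rule integral_distr[OF cis_measurable_circle m])
  also have "\<dots> = (\<integral>t. (indicator {0..<2 * pi} t / (2 * pi)) *\<^sub>R g (cis t) \<partial>lborel)"
    unfolding uniform_measure_def e by (rule integral_density[OF mc]) auto
  also have "\<dots> = (\<integral>t. (1 / (2 * pi)) *\<^sub>R (indicator {0..2 * pi} t *\<^sub>R g (cis t)) \<partial>lborel)"
  proof (rule integral_cong_AE)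
    show "AE t in lborel. (indicator {0..<2 * pi} t / (2 * pi)) *\<^sub>R g (cis t)
        = (1 / (2 * pi)) *\<^sub>R (indicator {0..2 * pi} t *\<^sub>R g (cis t))"
      using AE_lborel_singleton[of "2 * pi"] by eventually_elim (auto simp: indicator_def)
  qed (use mc in measurable)
  also have "\<dots> = (1 / (2 * pi)) *\<^sub>R set_lebesgue_integral lborel {0..2 * pi} (\<lambda>t. g (cis t))"
    unfolding set_lebesgue_integral_def by (rule integral_scaleR_right)
  also have "set_lebesgue_integral lborel {0..2 * pi} (\<lambda>t. g (cis t)) = integral {0..2 * pi} (\<lambda>t. g (cis t))"
    by (rule set_borel_integral_eq_integral)
      (auto simp: set_integrable_def intro!: borel_integrable_compact continuous_on_subset[OF c])
  finally show ?thesis .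
qed

lemma integral_circle_monomials:
  "(\<integral>\<omega>. \<omega> ^ j * cnj (\<omega> ^ k) \<partial>circle) = (if j = k then 1 else 0)"
proof -
  define n where "n = real j - real k"
  have "(\<integral>\<omega>. \<omega> ^ j * cnj (\<omega> ^ k) \<partial>circle)
      = (1 / (2 * pi)) *\<^sub>R integral {0..2 * pi} (\<lambda>t. cis t ^ j * cnj (cis t ^ k))"
    by (rule integral_circle) (intro continuous_intros)
  also have "(\<lambda>t. cis t ^ j * cnj (cis t ^ k)) = (\<lambda>t. cis (n * t))"
    by (auto simp: n_def Complex.DeMoivre cis_cnj cis_mult algebra_simps)
  also have "(1 / (2 * pi)) *\<^sub>R integral {0..2 * pi} (\<lambda>t. cis (n * t)) = (if j = k then 1 else 0)"
  proof (cases "j = k")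
    case True
    then show ?thesis by (simp add: n_def scaleR_conv_of_real)
  next
    case False
    then have n: "n \<noteq> 0" by (simp add: n_def)
    have "((\<lambda>t. cis (n * t) / (\<i> * n)) has_vector_derivative cis (n * t)) (at t within S)" for t S
    proof -
      have "((\<lambda>z. exp (\<i> * n * z) / (\<i> * n)) has_field_derivative exp (\<i> * n * of_real t))
          (at (of_real t))"
        using n by (auto intro!: derivative_eq_intros)
      from has_vector_derivative_real_field[OF this] show ?thesis
        by (simp add: cis_conv_exp mult.assoc)
    qed
    then have "((\<lambda>t. cis (n * t)) has_integral
        (cis (n * (2 * pi)) / (\<i> * n) - cis (n * 0) / (\<i> * n))) {0..2 * pi}"
      by (intro fundamental_theorem_of_calculus) auto
    moreover have "cis (n * (2 * pi)) = 1"
      using cis_multiple_2pi[of "of_int (int j - int k)"] by (simp add: n_def mult_ac)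
    ultimately have "integral {0..2 * pi} (\<lambda>t. cis (n * t)) = 0"
      by (simp add: integral_unique)
    with False show ?thesis by simp
  qed
  finally show ?thesis .
qed

lemma integrable_circle_continuous:
  fixes g :: "complex \<Rightarrow> 'b::euclidean_space"
  assumes "continuous_on UNIV g"
  shows "integrable circle g"
proof -
  interpret c: finite_measure circle
    by standard (simp add: emeasure_space_circle)
  obtain B where B: "norm (g \<omega>) \<le> B" if "\<omega> \<in> sphere 0 1" for \<omega>
    using compact_imp_bounded[OF compact_continuous_image[OF continuous_on_subset[OF assms] compact_sphere[of "0::complex" 1]]]
    by (force simp: bounded_iff)
  show ?thesis
  proof (rule c.integrable_const_bound)
    show "AE \<omega> in circle. norm (g \<omega>) \<le> B"
      by (rule AE_I2) (use B in \<open>auto simp: circle_def space_restrict_space\<close>)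
    have "g \<in> borel_measurable borel"
      using assms by (rule borel_measurable_continuous_onI)
    then show "g \<in> borel_measurable circle"
      unfolding circle_def measurable_distr_eq1 by (rule measurable_restrict_space1)
  qed
qed

lemma continuous_polynomial: "continuous_on S (\<lambda>\<omega>. \<Sum>k<n. \<omega> ^ k *s (h k :: complex^2))"
  unfolding vector_scalar_mult_def
  by (intro continuous_on_sum continuous_on_vec_lambda continuous_intros)

lemma integral_norm_polynomial:
  "(\<integral>\<omega>. (norm (\<Sum>k<n. \<omega> ^ k *s h k))\<^sup>2 \<partial>circle) = (\<Sum>k<n. (norm (h k :: complex^2))\<^sup>2)"
proof -
  have "complex_of_real ((norm (\<Sum>k<n. \<omega> ^ k *s h k))\<^sup>2)
      = (\<Sum>j<n. \<Sum>k<n. (\<omega> ^ j * cnj (\<omega> ^ k)) * cinner (h j) (h k))" for \<omega>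
    unfolding cinner_self[symmetric]
    by (simp add: cinner_def sum_product sum_2 sum.distrib algebra_simps)
  then have "complex_of_real (\<integral>\<omega>. (norm (\<Sum>k<n. \<omega> ^ k *s h k))\<^sup>2 \<partial>circle)
      = (\<integral>\<omega>. (\<Sum>j<n. \<Sum>k<n. (\<omega> ^ j * cnj (\<omega> ^ k)) * cinner (h j) (h k)) \<partial>circle)"
    by (simp flip: integral_complex_of_real)
  also have "\<dots> = (\<Sum>j<n. \<Sum>k<n. (\<integral>\<omega>. \<omega> ^ j * cnj (\<omega> ^ k) \<partial>circle) * cinner (h j) (h k))"
    by (subst Bochner_Integration.integral_sum
         | intro integrable_circle_continuous continuous_intros sum.cong refl
             integral_mult_left_zero)+
  also have "\<dots> = complex_of_real (\<Sum>k<n. (norm (h k))\<^sup>2)"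
    by (simp add: integral_circle_monomials cinner_self if_distrib[of "\<lambda>x. x * _"] cong: if_cong del: complex_cnj_power)
  finally show ?thesis
    using of_real_eq_iff by blast
qed

lemma norm_diff_square_le: "(norm (x - y))\<^sup>2 \<le> 2 * (norm (z - x))\<^sup>2 + 2 * (norm (z - y))\<^sup>2"
  for x y z :: "'a::real_normed_vector"
proof -
  have "norm (x - y) \<le> norm (z - x) + norm (z - y)"
    by (metis norm_minus_commute add.commute dist_norm dist_triangle2)
  then have "(norm (x - y))\<^sup>2 \<le> (norm (z - x) + norm (z - y))\<^sup>2"
    by (simp add: power_mono)
  also have "\<dots> \<le> 2 * (norm (z - x))\<^sup>2 + 2 * (norm (z - y))\<^sup>2"
    using sum_squares_bound[of "norm (z - x)" "norm (z - y)"] by (simp add: power2_sum)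
  finally show ?thesis .
qed

lemma hardy_expansion_unique:
  assumes "hardy_expansion f h" "hardy_expansion f h'"
  shows "h = h'"
proof
  fix k
  let ?S = "\<lambda>h n \<omega>. \<Sum>k<n. \<omega> ^ k *s (h k :: complex^2)"
  have int: "integrable circle (\<lambda>\<omega>. (norm (f \<omega> - ?S h n \<omega>))\<^sup>2)" for h n
  proof (rule Bochner_Integration.integrable_bound)
    show "integrable circle (\<lambda>\<omega>. 2 * (norm (f \<omega>))\<^sup>2 + 2 * (norm (?S h n \<omega>))\<^sup>2)"
      using assms(1) unfolding hardy_expansion_def square_integrable_def
      by (intro Bochner_Integration.integrable_add integrable_mult_right
          integrable_circle_continuous[of "\<lambda>\<omega>. (norm (?S h n \<omega>))\<^sup>2"]
          continuous_intros continuous_polynomial) simp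
    have "?S h n \<in> borel_measurable circle"
      by (intro borel_measurable_integrable integrable_circle_continuous continuous_polynomial)
    with assms(1) show "(\<lambda>\<omega>. (norm (f \<omega> - ?S h n \<omega>))\<^sup>2) \<in> borel_measurable circle"
      unfolding hardy_expansion_def square_integrable_def
      by (intro borel_measurable_power borel_measurable_norm borel_measurable_diff) auto
    show "AE \<omega> in circle. norm ((norm (f \<omega> - ?S h n \<omega>))\<^sup>2)
        \<le> norm (2 * (norm (f \<omega>))\<^sup>2 + 2 * (norm (?S h n \<omega>))\<^sup>2)"
      using norm_diff_square_le[of "f _" "?S h n _" 0] by (simp add: algebra_simps)
  qed
  have "(norm (h k - h' k))\<^sup>2 \<le> 2 * (\<integral>\<omega>. (norm (f \<omega> - ?S h n \<omega>))\<^sup>2 \<partial>circle)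
      + 2 * (\<integral>\<omega>. (norm (f \<omega> - ?S h' n \<omega>))\<^sup>2 \<partial>circle)" if "k < n" for n
  proof -
    have "(norm (h k - h' k))\<^sup>2 \<le> (\<Sum>k<n. (norm (h k - h' k))\<^sup>2)"
      using that by (intro member_le_sum) auto
    also have "\<dots> = (\<integral>\<omega>. (norm (?S (\<lambda>k. h k - h' k) n \<omega>))\<^sup>2 \<partial>circle)"
      by (rule integral_norm_polynomial[symmetric])
    also have "\<dots> = (\<integral>\<omega>. (norm (?S h n \<omega> - ?S h' n \<omega>))\<^sup>2 \<partial>circle)"
      by (simp add: sum_subtractf vec.scale_right_diff_distrib)
    also have "\<dots> \<le> (\<integral>\<omega>. 2 * (norm (f \<omega> - ?S h n \<omega>))\<^sup>2 + 2 * (norm (f \<omega> - ?S h' n \<omega>))\<^sup>2 \<partial>circle)"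
      by (intro integral_mono norm_diff_square_le integrable_circle_continuous
          continuous_intros continuous_polynomial Bochner_Integration.integrable_add
          integrable_mult_right int)
    also have "\<dots> = 2 * (\<integral>\<omega>. (norm (f \<omega> - ?S h n \<omega>))\<^sup>2 \<partial>circle)
        + 2 * (\<integral>\<omega>. (norm (f \<omega> - ?S h' n \<omega>))\<^sup>2 \<partial>circle)"
      using int by simp
    finally show ?thesis .
  qed
  then have ev: "\<forall>\<^sub>F n in sequentially. (norm (h k - h' k))\<^sup>2
      \<le> 2 * (\<integral>\<omega>. (norm (f \<omega> - ?S h n \<omega>))\<^sup>2 \<partial>circle)
      + 2 * (\<integral>\<omega>. (norm (f \<omega> - ?S h' n \<omega>))\<^sup>2 \<partial>circle)"
    by (intro eventually_sequentiallyI[of "Suc k"]) auto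
  have "(\<lambda>n. 2 * (\<integral>\<omega>. (norm (f \<omega> - ?S h n \<omega>))\<^sup>2 \<partial>circle)
      + 2 * (\<integral>\<omega>. (norm (f \<omega> - ?S h' n \<omega>))\<^sup>2 \<partial>circle)) \<longlonglongrightarrow> 2 * 0 + 2 * 0"
    using assms unfolding hardy_expansion_def by (intro tendsto_intros) auto
  from tendsto_lowerbound[OF this ev] show "h k = h' k" by simp
qed

lemma hardy_coeff_eqI: "hardy_expansion f h \<Longrightarrow> hardy_coeff f = h"
  unfolding hardy_coeff_def by (blast intro: hardy_expansion_unique)

section \<open>Inner functions\<close>

definition M_plus_inner :: "(complex \<Rightarrow> complex^2^2) \<Rightarrow> bool"
  where "M_plus_inner A \<longleftrightarrow>
    (\<forall>x y. (\<lambda>\<omega>. cinner (A \<omega> *v x) y) \<in> borel_measurable circle) \<and>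
    (\<forall>x. (\<lambda>\<omega>. A \<omega> *v x) \<in> hardy_space) \<and>
    (\<exists>V. AE \<omega> in circle. partial_isometry_with V (A \<omega>))"


section \<open>Wavelets and the Haar basis\<close>

definition translation :: "(real \<Rightarrow> complex) \<Rightarrow> real \<Rightarrow> complex"
  where "translation f = (\<lambda>x. f (x - 1))"

definition dilation :: "(real \<Rightarrow> complex) \<Rightarrow> real \<Rightarrow> complex"
  where "dilation f = (\<lambda>x. of_real (sqrt 2) * f (2 * x))"

text \<open>The integer powers of these bijections, in closed form; the lemmas following
  the definitions show that they are the powers.\<close>

definition translation_pow :: "int \<Rightarrow> (real \<Rightarrow> complex) \<Rightarrow> real \<Rightarrow> complex"
  where "translation_pow j f = (\<lambda>x. f (x - of_int j))"

definition dilation_pow :: "int \<Rightarrow> (real \<Rightarrow> complex) \<Rightarrow> real \<Rightarrow> complex"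
  where "dilation_pow k f = (\<lambda>x. of_real (2 powr (of_int k / 2)) * f (2 powi k * x))"

lemma translation_pow:
  "translation_pow 0 f = f" "translation_pow 1 f = translation f"
  "translation_pow (i + j) f = translation_pow i (translation_pow j f)"
  by (simp_all add: translation_pow_def translation_def algebra_simps)

lemma dilation_pow:
  "dilation_pow 0 f = f" "dilation_pow 1 f = dilation f"
  "dilation_pow (k + l) f = dilation_pow k (dilation_pow l f)"
  by (simp_all add: dilation_pow_def dilation_def powr_half_sqrt power_int_add powr_add
      add_divide_distrib mult_ac)

definition L2_inner :: "(real \<Rightarrow> complex) \<Rightarrow> (real \<Rightarrow> complex) \<Rightarrow> complex"
  where "L2_inner f g = (\<integral>x. f x * cnj (g x) \<partial>lborel)"

text \<open>\<open>L\<^sup>2[0,1]\<close> as a subspace of \<open>L\<^sup>2\<close> of the line (extension by zero).\<close>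

definition L2_unit_interval :: "(real \<Rightarrow> complex) set"
  where "L2_unit_interval = {f. square_integrable lborel f \<and> (\<forall>x. x \<notin> {0..1} \<longrightarrow> f x = 0)}"

text \<open>Here and below the two generators are indexed by the two-element type
  \<^typ>\<open>2\<close>, whose elements are \<open>1\<close> and \<open>2\<close>.\<close>

definition tight_wavelet_frame :: "(2 \<Rightarrow> real \<Rightarrow> complex) \<Rightarrow> real \<Rightarrow> bool"
  where "tight_wavelet_frame \<psi> B \<longleftrightarrow>
    (\<forall>f. square_integrable lborel f \<longrightarrow>
      ((\<lambda>(i, k, j). (cmod (L2_inner f (dilation_pow k (translation_pow j (\<psi> i)))))\<^sup>2)
        has_sum (B * (\<integral>x. (cmod (f x))\<^sup>2 \<partial>lborel))) UNIV)"

definition haar_wavelet :: "real \<Rightarrow> real"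
  where "haar_wavelet x = indicator {0..<1/2} x - indicator {1/2..<1} x"

definition haar :: "nat \<Rightarrow> real \<Rightarrow> complex"
  where "haar n x =
    (if n = 0 then indicator {0..<1} x
     else let p = floor_log n; q = n - 2 ^ p
          in of_real (2 powr (real p / 2) * haar_wavelet (2 ^ p * x - real q)))"

lemma haar_dyadic:
  assumes "q < 2 ^ p"
  shows "haar (2 ^ p + q) x = of_real (2 powr (real p / 2) * haar_wavelet (2 ^ p * x - real q))"
proof -
  have "floor_log (2 ^ p + q) = p"
    using assms by (intro floor_log_eqI) auto
  then show ?thesis by (simp add: haar_def)
qed

definition haar_coeff :: "(2 \<Rightarrow> real \<Rightarrow> complex) \<Rightarrow> nat \<Rightarrow> complex^2"
  where "haar_coeff \<psi> n = (\<chi> i. L2_inner (\<psi> i) (haar n))"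


section \<open>Admissible functions\<close>

definition coefficient_conditions :: "(nat \<Rightarrow> complex^2) \<Rightarrow> (nat \<Rightarrow> complex^2) \<Rightarrow> bool"
  where "coefficient_conditions a0 a1 \<longleftrightarrow>
    (let N = 1 - (norm (a0 0))\<^sup>2 in
      (\<forall>p>0. (cmod (cinner (a0 p) (a0 0)))\<^sup>2 / N = 1 - (\<Sum>k\<le>p. (norm (a0 k))\<^sup>2)) \<and>
      (\<forall>p. (cmod (cinner (a1 p) (a0 0)))\<^sup>2 / N = 1 - (\<Sum>k\<le>p. (norm (a1 k))\<^sup>2)) \<and>
      (\<forall>p p'. 0 < p \<and> p < p' \<longrightarrow>
        cinner (a0 p') (a0 0) * cinner (a0 0) (a0 p) / of_real N
          = - (\<Sum>r\<le>p. cinner (a0 (p' - r)) (a0 (p - r)))) \<and>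
      (\<forall>p p'. p < p' \<longrightarrow>
        cinner (a1 p') (a0 0) * cinner (a0 0) (a1 p) / of_real N
          = - (\<Sum>r\<le>p. cinner (a1 (p' - r)) (a1 (p - r)))) \<and>
      (\<forall>p p'. 0 < p \<and> p \<le> p' \<longrightarrow>
        cinner (a1 p') (a0 0) * cinner (a0 0) (a0 p) / of_real N
          = - (\<Sum>r\<le>p. cinner (a1 (p' - r)) (a0 (p - r)))) \<and>
      (\<forall>p p'. p' < p \<longrightarrow>
        cinner (a1 p') (a0 0) * cinner (a0 0) (a0 p) / of_real N
          = - (\<Sum>r\<le>p'. cinner (a1 (p' - r)) (a0 (p - r)))))"

definition admissible_2dim :: "(complex \<Rightarrow> complex^2) \<Rightarrow> (complex \<Rightarrow> complex^2) \<Rightarrow> bool"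
  where "admissible_2dim a0 a1 \<longleftrightarrow>
    (AE \<omega> in circle. unitary_mat (of_columns (a0 \<omega>) (a1 \<omega>))) \<and>
    norm (hardy_coeff a0 0) < 1 \<and>
    coefficient_conditions (hardy_coeff a0) (hardy_coeff a1)"

text \<open>The last two conjuncts say that \<open>B0\<close> times \<open>a0\<close> is the sum of the series with
  coefficients \<open>haar_coeff \<psi> (2 ^ k)\<close>, and that the series with coefficients
  \<open>haar_coeff \<psi> (2 ^ (k + 1) + 1)\<close> sums to zero.\<close>

definition admissible_1dim :: "(complex \<Rightarrow> complex^2) \<Rightarrow> (complex \<Rightarrow> complex^2) \<Rightarrow> bool"
  where "admissible_1dim a0 a1 \<longleftrightarrow>
    (\<exists>V. vec.dim V = 1 \<and>
      (AE \<omega> in circle. partial_isometry_with V (of_columns (a0 \<omega>) (a1 \<omega>)))) \<and>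
    (AE \<omega> in circle. a1 \<omega> = 0) \<and>
    (\<exists>B0 \<psi>. B0 \<noteq> 0 \<and> (\<forall>i. \<psi> i \<in> L2_unit_interval) \<and>
      tight_wavelet_frame \<psi> ((cmod B0)\<^sup>2) \<and>
      hardy_expansion (\<lambda>\<omega>. B0 *s a0 \<omega>) (\<lambda>k. haar_coeff \<psi> (2 ^ k)) \<and>
      hardy_expansion (\<lambda>\<omega>. 0) (\<lambda>k. haar_coeff \<psi> (2 ^ (k + 1) + 1)))"

definition admissible :: "(complex \<Rightarrow> complex^2) \<Rightarrow> (complex \<Rightarrow> complex^2) \<Rightarrow> bool"
  where "admissible a0 a1 \<longleftrightarrow>
    M_plus_inner (\<lambda>\<omega>. of_columns (a0 \<omega>) (a1 \<omega>)) \<and>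
    (admissible_2dim a0 a1 \<or> admissible_1dim a0 a1)"


section \<open>The five types\<close>

text \<open>Sums over \<open>k \<ge> 1\<close> are reindexed to start at \<open>0\<close>.\<close>

definition type1 :: "(complex \<Rightarrow> complex^2) \<Rightarrow> (complex \<Rightarrow> complex^2) \<Rightarrow> bool"
  where "type1 a0 a1 \<longleftrightarrow>
    (\<exists>u0. norm u0 = 1 \<and> (AE \<omega> in circle. a0 \<omega> = u0 \<and> a1 \<omega> = 0))"

definition type2 :: "(complex \<Rightarrow> complex^2) \<Rightarrow> (complex \<Rightarrow> complex^2) \<Rightarrow> bool"
  where "type2 a0 a1 \<longleftrightarrow>
    (\<exists>u0 u1. orthonormal_basis u0 u1 \<and>
      (AE \<omega> in circle. a0 \<omega> = \<omega> *s u0 \<and> a1 \<omega> = u1))"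

definition type3 :: "(complex \<Rightarrow> complex^2) \<Rightarrow> (complex \<Rightarrow> complex^2) \<Rightarrow> bool"
  where "type3 a0 a1 \<longleftrightarrow>
    (\<exists>u0 u1 (\<rho>::real) (\<theta>::real). orthonormal_basis u0 u1 \<and> 0 < \<rho> \<and> \<rho> < 1 \<and>
      (AE \<omega> in circle.
        a0 \<omega> = of_real \<rho> *s u0 + (\<omega> * of_real (sqrt (1 - \<rho>\<^sup>2))) *s u1 \<and>
        a1 \<omega> = cis \<theta> *s (of_real (sqrt (1 - \<rho>\<^sup>2)) *s u0 - (\<omega> * of_real \<rho>) *s u1)))"

definition type4 :: "(complex \<Rightarrow> complex^2) \<Rightarrow> (complex \<Rightarrow> complex^2) \<Rightarrow> bool"
  where "type4 a0 a1 \<longleftrightarrow>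
    (\<exists>u0 u1 (\<rho>::real) (\<theta>::real). orthonormal_basis u0 u1 \<and> 0 < \<rho> \<and> \<rho> < 1 \<and>
      (AE \<omega> in circle.
        a0 \<omega> = (of_real \<rho> + of_real (1 - \<rho>\<^sup>2) * cis \<theta>
                  * (\<Sum>k. \<omega> ^ Suc k * (- of_real \<rho> * cis \<theta>) ^ k)) *s u0 \<and>
        a1 \<omega> = u1))"

definition type5 :: "(complex \<Rightarrow> complex^2) \<Rightarrow> (complex \<Rightarrow> complex^2) \<Rightarrow> bool"
  where "type5 a0 a1 \<longleftrightarrow>
    (\<exists>(\<rho>0::complex) (\<rho>1::complex) (\<tau>0::complex) u0 u1 v.
      0 < cmod \<rho>0 \<and> cmod \<rho>0 < 1 \<and>
      norm u0 = 1 \<and> norm u1 = 1 \<and> norm v = 1 \<and>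
      cinner v u0 \<noteq> 0 \<and> cinner u1 u0 \<noteq> 0 \<and>
      (let c = (cmod \<rho>0)\<^sup>2 / (1 - (cmod \<rho>0)\<^sup>2);
           r = - (cnj \<rho>0 / cnj \<rho>1) * (cinner v u0 / of_real (1 + c * (cmod (cinner v u0))\<^sup>2));
           \<tau>1 = \<tau>0 * (\<rho>1 * cinner u1 v / (\<rho>0 * cinner u0 v))
       in of_real c * cinner u0 u1 * cinner v u0 + cinner v u1 = 0 \<and>
          (cmod \<rho>1)\<^sup>2 = (1 - (cmod \<rho>0)\<^sup>2) / (1 + c * (cmod (cinner v u0))\<^sup>2) \<and>
          (cmod \<tau>0)\<^sup>2 = 1 / (1 + c * (cmod (cinner u1 u0))\<^sup>2) \<and>
          (AE \<omega> in circle.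
            a0 \<omega> = \<rho>0 *s u0 + (\<rho>1 * (\<Sum>k. \<omega> ^ Suc k * r ^ k)) *s v \<and>
            a1 \<omega> = \<tau>0 *s u1 + (\<tau>1 * (\<Sum>k. \<omega> ^ Suc k * r ^ k)) *s v)))"

end

theory Submission
  imports Defs
begin

text \<open>
  In the two-dimensional case write \<open>w\<close>, \<open>y\<close>, \<open>b\<close> for the coefficients \<open>a0\<^sub>0\<close>, \<open>a0\<^sub>1\<close>, \<open>a1\<^sub>0\<close>,
  put \<open>N = 1 - |w|\<^sup>2\<close>, and consider the inner product
  \<open>[u, v] = \<langle>u, v\<rangle> + \<langle>u, w\<rangle>\<langle>w, v\<rangle> / N\<close> (\<open>twisted\<close>). With all terms on one side, the coefficient
  conditions prescribe the values of certain partial Gram sums (\<open>gram\<close>), and the values with an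
  index at most one say that \<open>b\<close> and \<open>y / sqrt N\<close> are an orthonormal basis for
  \<open>[\<cdot>, \<cdot>]\<close>, that all later coefficients of both columns are orthogonal to \<open>b\<close>, and that their product with
  \<open>y\<close> is minus the product of the preceding coefficient with \<open>w\<close>. Two dimensions leave no freedom:
  each later coefficient is a multiple of \<open>y\<close>, the multiples satisfy a first-order recursion, and
  both columns are geometric series with the same ratio \<open>r = - \<langle>y, w\<rangle> / N\<close>:
  \<open>a0 = w + z y\<close> and \<open>a1 = b - (\<langle>b, w\<rangle> / N) z y\<close>, where \<open>z = \<omega> / (1 - r \<omega>)\<close>
  (\<open>coefficient_conditions_imp_realization\<close>). Conversely, for such series the Gram sums are constant
  along diagonals, so the three relations for \<open>w\<close>, \<open>y\<close>, \<open>b\<close> give back all conditions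
  (\<open>realization_imp_coefficient_conditions\<close>), and \<open>\<bar>z\<bar> = \<bar>1 + r z\<bar>\<close> on the circle makes the matrix unitary
  there (\<open>realization_unitary\<close>).

  It remains to list the triples \<open>(w, y, b)\<close> (\<open>realization\<close>). If \<open>w = 0\<close> they are orthonormal bases:
  Type 2. If \<open>y\<close> is orthogonal to \<open>w\<close>, then so it is to \<open>b\<close>, hence \<open>b\<close> is parallel to \<open>w\<close>: Type 3. If \<open>b\<close> is
  orthogonal to \<open>w\<close>, then \<open>y\<close> is parallel to \<open>w\<close>: Type 4. Otherwise normalizing the three vectors
  gives the parameters of Type 5.

  In the one-dimensional case the frame identity is tested against the Haar wavelet
  \<open>\<psi>\<^sup>H\<close> and its translate to \<open>[1, 2)\<close> (\<open>tight_frame_rigidity\<close>). Every level finer than the translate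
  contributes the same amount, the squared moduli of the means of the generators, so the means
  vanish. The coarser levels contribute the Haar coefficients of index \<open>2\<^sup>m + 1\<close>, which vanish since
  \<open>h\<^sub>1 = 0\<close>. What is left is the coefficient of index \<open>1\<close>, so it carries the full
  frame bound. Then the untranslated wavelet leaves no room for the coefficients of index \<open>2\<^sup>m\<close> with
  \<open>m > 0\<close>, and \<open>a0\<close> is constant: Type 1. Conversely, scaling the Haar wavelet by the entries of a unit
  vector gives a tight frame because the Haar system is an orthonormal basis of \<open>L\<^sup>2\<close> of the
  line (\<open>orthonormal_haar_system\<close>, \<open>approximable_haar_system\<close>).
\<close>

section \<open>Geometric series in the Hardy space\<close>

lemma space_circle: "space circle = sphere 0 1"
  by (simp add: circle_def space_restrict_space)

lemma AE_circle: "AE \<omega> in circle. cmod \<omega> = 1"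
  by (rule AE_I2) (simp add: space_circle)

lemma finite_measure_circle: "finite_measure circle"
  by standard (simp add: emeasure_space_circle)

lemma borel_measurable_circle: "f \<in> borel_measurable borel \<Longrightarrow> f \<in> borel_measurable circle"
  unfolding circle_def measurable_distr_eq1 by (rule measurable_restrict_space1)

lemma measurable_polynomial:
  "(\<lambda>\<omega>. \<Sum>k<n. \<omega> ^ k *s (h k :: complex^2)) \<in> borel_measurable circle"
  by (intro borel_measurable_circle borel_measurable_continuous_onI continuous_polynomial)

lemma continuous_on_vector_scalar: "continuous_on S (\<lambda>c. c *s (v :: complex^2))"
  unfolding vector_scalar_mult_def by (intro continuous_on_vec_lambda continuous_intros)

lemma norm_scale: "norm (c *s (x :: complex^2)) = cmod c * norm x"
  by (simp add: norm_vec_def norm_mult L2_set_right_distrib)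

lemma hardy_expansion_measurable: "hardy_expansion f h \<Longrightarrow> f \<in> borel_measurable circle"
  by (simp add: hardy_expansion_def square_integrable_def)

lemma integrable_hardy_remainder:
  assumes "hardy_expansion f h"
  shows "integrable circle (\<lambda>\<omega>. (norm (f \<omega> - (\<Sum>k<n. \<omega> ^ k *s h' k)))\<^sup>2)"
proof (rule Bochner_Integration.integrable_bound)
  let ?S = "\<lambda>\<omega>. \<Sum>k<n. \<omega> ^ k *s (h' k :: complex^2)"
  show "integrable circle (\<lambda>\<omega>. 2 * (norm (f \<omega>))\<^sup>2 + 2 * (norm (?S \<omega>))\<^sup>2)"
    using assms unfolding hardy_expansion_def square_integrable_def
    by (intro Bochner_Integration.integrable_add integrable_mult_right
        integrable_circle_continuous[of "\<lambda>\<omega>. (norm (?S \<omega>))\<^sup>2"]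
        continuous_intros continuous_polynomial) simp
  show "(\<lambda>\<omega>. (norm (f \<omega> - ?S \<omega>))\<^sup>2) \<in> borel_measurable circle"
    using hardy_expansion_measurable[OF assms] measurable_polynomial
    by (intro borel_measurable_power borel_measurable_norm borel_measurable_diff) auto
  show "AE \<omega> in circle. norm ((norm (f \<omega> - ?S \<omega>))\<^sup>2)
      \<le> norm (2 * (norm (f \<omega>))\<^sup>2 + 2 * (norm (?S \<omega>))\<^sup>2)"
    using norm_diff_square_le[of "f _" "?S _" 0] by (simp add: algebra_simps)
qed

text \<open>Converse to \<open>hardy_expansion_unique\<close>: the coefficients determine the function up to null
  sets, since both functions are limits of the same partial sums. This turns identities between
  coefficient sequences into identities almost everywhere.\<close>

lemma hardy_expansion_AE_unique:
  assumes f: "hardy_expansion f h" and g: "hardy_expansion g h"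
  shows "AE \<omega> in circle. f \<omega> = g \<omega>"
proof -
  let ?S = "\<lambda>n \<omega>. \<Sum>k<n. \<omega> ^ k *s (h k :: complex^2)"
  let ?I = "\<integral>\<omega>. (norm (f \<omega> - g \<omega>))\<^sup>2 \<partial>circle"
  have bound: "(norm (f \<omega> - g \<omega>))\<^sup>2 \<le>
      2 * (norm (f \<omega> - ?S n \<omega>))\<^sup>2 + 2 * (norm (g \<omega> - ?S n \<omega>))\<^sup>2" for \<omega> n
    using norm_diff_square_le[of "f \<omega>" "g \<omega>" "?S n \<omega>"] by (simp add: norm_minus_commute)
  have int: "integrable circle (\<lambda>\<omega>. 2 * (norm (f \<omega> - ?S n \<omega>))\<^sup>2 + 2 * (norm (g \<omega> - ?S n \<omega>))\<^sup>2)" for n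
    by (intro Bochner_Integration.integrable_add integrable_mult_right
        integrable_hardy_remainder[OF f] integrable_hardy_remainder[OF g])
  have int_fg: "integrable circle (\<lambda>\<omega>. (norm (f \<omega> - g \<omega>))\<^sup>2)"
  proof (rule Bochner_Integration.integrable_bound[OF int[of 0]])
    show "(\<lambda>\<omega>. (norm (f \<omega> - g \<omega>))\<^sup>2) \<in> borel_measurable circle"
      using hardy_expansion_measurable[OF f] hardy_expansion_measurable[OF g]
      by (intro borel_measurable_power borel_measurable_norm borel_measurable_diff) auto
  qed (use bound[of _ 0] in auto)
  have "?I \<le> 2 * (\<integral>\<omega>. (norm (f \<omega> - ?S n \<omega>))\<^sup>2 \<partial>circle) + 2 * (\<integral>\<omega>. (norm (g \<omega> - ?S n \<omega>))\<^sup>2 \<partial>circle)" for n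
  proof -
    have "?I \<le> (\<integral>\<omega>. 2 * (norm (f \<omega> - ?S n \<omega>))\<^sup>2 + 2 * (norm (g \<omega> - ?S n \<omega>))\<^sup>2 \<partial>circle)"
      by (intro integral_mono int_fg int bound)
    then show ?thesis
      using integrable_hardy_remainder[OF f, of h n] integrable_hardy_remainder[OF g, of h n] by simp
  qed
  moreover have "(\<lambda>n. 2 * (\<integral>\<omega>. (norm (f \<omega> - ?S n \<omega>))\<^sup>2 \<partial>circle)
      + 2 * (\<integral>\<omega>. (norm (g \<omega> - ?S n \<omega>))\<^sup>2 \<partial>circle)) \<longlonglongrightarrow> 2 * 0 + 2 * 0"
    using f g unfolding hardy_expansion_def by (intro tendsto_intros) auto
  ultimately have "?I \<le> 0"
    using LIMSEQ_le_const[of _ 0 ?I] by fastforce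
  moreover have "?I \<ge> 0" by simp
  ultimately have "?I = 0" by linarith
  then show ?thesis
    using integral_nonneg_eq_0_iff_AE[OF int_fg] by simp
qed

text \<open>The sum of \<open>\<omega>\<^sup>k\<^sup>+\<^sup>1 r\<^sup>k\<close> over \<open>k \<ge> 0\<close>, see \<open>kernel_series\<close>.\<close>

definition geometric_kernel :: "complex \<Rightarrow> complex \<Rightarrow> complex"
  where "geometric_kernel r \<omega> = \<omega> / (1 - r * \<omega>)"

definition geometric_coeffs :: "complex^2 \<Rightarrow> complex^2 \<Rightarrow> complex \<Rightarrow> nat \<Rightarrow> complex^2"
  where "geometric_coeffs x y r k = (case k of 0 \<Rightarrow> x | Suc j \<Rightarrow> r ^ j *s y)"

lemma one_minus_nonzero:
  assumes "cmod r < 1" "cmod \<omega> = 1"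
  shows "1 - r * \<omega> \<noteq> 0" "1 - cmod r \<le> cmod (1 - r * \<omega>)"
proof -
  show "1 - cmod r \<le> cmod (1 - r * \<omega>)"
    using norm_triangle_ineq2[of 1 "r * \<omega>"] assms by (simp add: norm_mult)
  then show "1 - r * \<omega> \<noteq> 0"
    using assms by auto
qed

lemma kernel_series:
  assumes "cmod r < 1" "cmod \<omega> = 1"
  shows "(\<Sum>k. \<omega> ^ Suc k * r ^ k) = geometric_kernel r \<omega>"
proof -
  have "cmod (r * \<omega>) < 1"
    using assms by (simp add: norm_mult)
  then have "(\<lambda>k. \<omega> * (r * \<omega>) ^ k) sums (\<omega> * (1 / (1 - r * \<omega>)))"
    by (intro sums_mult geometric_sums)
  then show ?thesis
    by (simp add: sums_iff geometric_kernel_def power_mult_distrib mult_ac)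
qed

text \<open>The remainder after \<open>n + 1\<close> terms is the kernel summand times \<open>(r \<omega>)\<^sup>n\<close>, so it tends to zero uniformly
  on the circle. The function is only required to have the right values almost everywhere,
  because this is how the five types are given.\<close>

lemma hardy_expansion_geometric:
  assumes r: "cmod r < 1" and m: "f \<in> borel_measurable circle"
    and f: "AE \<omega> in circle. f \<omega> = x + geometric_kernel r \<omega> *s y"
  shows "hardy_expansion f (geometric_coeffs x y r)"
proof -
  interpret finite_measure circle by (rule finite_measure_circle)
  let ?S = "\<lambda>n \<omega>. \<Sum>k<n. \<omega> ^ k *s geometric_coeffs x y r k"
  define C where "C = norm y / (1 - cmod r)"
  have kernel_le: "cmod (geometric_kernel r \<omega>) * norm y \<le> C" if "cmod \<omega> = 1" for \<omega>
  proof -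
    have "norm y / cmod (1 - r * \<omega>) \<le> norm y / (1 - cmod r)"
      using one_minus_nonzero(2)[OF r that] r by (intro frac_le) auto
    then show ?thesis
      using that by (simp add: geometric_kernel_def C_def norm_divide)
  qed
  have remainder: "x + geometric_kernel r \<omega> *s y - ?S (Suc n) \<omega> = (geometric_kernel r \<omega> * (r * \<omega>) ^ n) *s y"
    if "cmod \<omega> = 1" for \<omega> n
  proof (induction n)
    case 0
    show ?case by (simp add: geometric_coeffs_def)
  next
    case (Suc n)
    have "\<omega> ^ Suc n * r ^ n = (r * \<omega>) ^ n * (geometric_kernel r \<omega> * (1 - r * \<omega>))"
      using one_minus_nonzero(1)[OF r that] by (simp add: geometric_kernel_def power_mult_distrib)
    then have "\<omega> ^ Suc n *s geometric_coeffs x y r (Suc n) = ((r * \<omega>) ^ n * (geometric_kernel r \<omega> * (1 - r * \<omega>))) *s y"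
      by (simp add: geometric_coeffs_def vector_smult_assoc)
    moreover have "?S (Suc (Suc n)) \<omega> = ?S (Suc n) \<omega> + \<omega> ^ Suc n *s geometric_coeffs x y r (Suc n)"
      by (rule sum.lessThan_Suc)
    ultimately have "x + geometric_kernel r \<omega> *s y - ?S (Suc (Suc n)) \<omega> =
        (geometric_kernel r \<omega> * (r * \<omega>) ^ n) *s y - ((r * \<omega>) ^ n * (geometric_kernel r \<omega> * (1 - r * \<omega>))) *s y"
      by (simp only: diff_diff_eq[symmetric] Suc)
    also have "\<dots> = (geometric_kernel r \<omega> * (r * \<omega>) ^ n - (r * \<omega>) ^ n * (geometric_kernel r \<omega> * (1 - r * \<omega>))) *s y"
      by (rule vector_sub_rdistrib[symmetric])
    also have "geometric_kernel r \<omega> * (r * \<omega>) ^ n - (r * \<omega>) ^ n * (geometric_kernel r \<omega> * (1 - r * \<omega>)) =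
        geometric_kernel r \<omega> * (r * \<omega>) ^ Suc n"
      by (simp add: algebra_simps)
    finally show ?case .
  qed
  have sq: "square_integrable circle f"
    unfolding square_integrable_def
  proof
    show "integrable circle (\<lambda>\<omega>. (norm (f \<omega>))\<^sup>2)"
    proof (rule integrable_const_bound)
      show "AE \<omega> in circle. norm ((norm (f \<omega>))\<^sup>2) \<le> (norm x + C)\<^sup>2"
        using f AE_circle
      proof eventually_elim
        case (elim \<omega>)
        have "norm (f \<omega>) \<le> norm x + cmod (geometric_kernel r \<omega>) * norm y"
          using norm_triangle_ineq[of x "geometric_kernel r \<omega> *s y"] elim by (simp add: norm_scale)
        with kernel_le[OF elim(2)] have "norm (f \<omega>) \<le> norm x + C"
          by linarith
        then show ?case by (simp add: power_mono)
      qed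
      show "(\<lambda>\<omega>. (norm (f \<omega>))\<^sup>2) \<in> borel_measurable circle"
        using m by (intro borel_measurable_power) auto
    qed
  qed (rule m)
  have "summable (\<lambda>j. (norm y)\<^sup>2 * ((cmod r)\<^sup>2) ^ j)"
    using r by (intro summable_mult summable_geometric) (simp add: abs_square_less_1)
  then have "summable (\<lambda>k. (norm (geometric_coeffs x y r (Suc k)))\<^sup>2)"
    by (simp add: geometric_coeffs_def norm_scale power_mult_distrib norm_power mult.commute flip: power_mult)
  then have summable: "summable (\<lambda>k. (norm (geometric_coeffs x y r k))\<^sup>2)"
    by (subst (asm) summable_Suc_iff)
  have bound: "(\<integral>\<omega>. (norm (f \<omega> - ?S (Suc n) \<omega>))\<^sup>2 \<partial>circle) \<le> C\<^sup>2 * ((cmod r)\<^sup>2) ^ n" for n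
  proof -
    have "(\<integral>\<omega>. (norm (f \<omega> - ?S (Suc n) \<omega>))\<^sup>2 \<partial>circle) \<le> (\<integral>\<omega>. C\<^sup>2 * ((cmod r)\<^sup>2) ^ n \<partial>circle)"
    proof (rule integral_mono_AE)
      show AE: "AE \<omega> in circle. (norm (f \<omega> - ?S (Suc n) \<omega>))\<^sup>2 \<le> C\<^sup>2 * ((cmod r)\<^sup>2) ^ n"
        using f AE_circle
      proof eventually_elim
        case (elim \<omega>)
        have "norm (f \<omega> - ?S (Suc n) \<omega>) = (cmod (geometric_kernel r \<omega>) * norm y) * cmod r ^ n"
          unfolding elim(1) remainder[OF elim(2)] using elim(2) by (simp add: norm_scale norm_mult norm_power)
        also have "\<dots> \<le> C * cmod r ^ n"
          using kernel_le[OF elim(2)] by (intro mult_right_mono) auto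
        finally have "(norm (f \<omega> - ?S (Suc n) \<omega>))\<^sup>2 \<le> (C * cmod r ^ n)\<^sup>2"
          by (intro power_mono) auto
        then show ?case
          by (simp add: power_mult_distrib mult.commute flip: power_mult)
      qed
      show "integrable circle (\<lambda>\<omega>. (norm (f \<omega> - ?S (Suc n) \<omega>))\<^sup>2)"
      proof (rule integrable_const_bound)
        show "AE \<omega> in circle. norm ((norm (f \<omega> - ?S (Suc n) \<omega>))\<^sup>2) \<le> C\<^sup>2 * ((cmod r)\<^sup>2) ^ n"
          using AE by simp
        show "(\<lambda>\<omega>. (norm (f \<omega> - ?S (Suc n) \<omega>))\<^sup>2) \<in> borel_measurable circle"
          by (intro borel_measurable_power measurable_compose[OF _ borel_measurable_norm]
              borel_measurable_diff m measurable_polynomial)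
      qed
    qed simp
    also have "\<dots> = C\<^sup>2 * ((cmod r)\<^sup>2) ^ n"
      using emeasure_space_circle by (simp add: measure_def)
    finally show ?thesis .
  qed
  have "(\<lambda>n. C\<^sup>2 * ((cmod r)\<^sup>2) ^ n) \<longlonglongrightarrow> C\<^sup>2 * 0"
    using r by (intro tendsto_intros LIMSEQ_power_zero) (simp add: abs_square_less_1)
  then have "(\<lambda>n. C\<^sup>2 * ((cmod r)\<^sup>2) ^ n) \<longlonglongrightarrow> 0"
    by simp
  then have "(\<lambda>n. \<integral>\<omega>. (norm (f \<omega> - ?S (Suc n) \<omega>))\<^sup>2 \<partial>circle) \<longlonglongrightarrow> 0"
    by (rule tendsto_sandwich[rotated 2, OF tendsto_const[of 0]]) (use bound in auto)
  then have "(\<lambda>n. \<integral>\<omega>. (norm (f \<omega> - ?S n \<omega>))\<^sup>2 \<partial>circle) \<longlonglongrightarrow> 0"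
    by (rule LIMSEQ_imp_Suc)
  with sq summable show ?thesis
    by (simp add: hardy_expansion_def)
qed

lemma geometric_kernel_measurable: "(\<lambda>\<omega>. x + geometric_kernel r \<omega> *s (y :: complex^2)) \<in> borel_measurable circle"
proof (rule borel_measurable_circle)
  have "(\<lambda>\<omega>. geometric_kernel r \<omega>) \<in> borel_measurable borel"
    unfolding geometric_kernel_def by measurable
  from measurable_compose[OF this borel_measurable_continuous_onI[OF continuous_on_vector_scalar[of UNIV y]]]
  show "(\<lambda>\<omega>. x + geometric_kernel r \<omega> *s y) \<in> borel_measurable borel"
    by (intro borel_measurable_add) auto
qed

lemma geometric_function_if_coeffs:
  assumes "cmod r < 1" "hardy_expansion f (geometric_coeffs x y r)"
  shows "AE \<omega> in circle. f \<omega> = x + geometric_kernel r \<omega> *s y"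
  by (rule hardy_expansion_AE_unique[OF assms(2) hardy_expansion_geometric[OF assms(1) geometric_kernel_measurable]]) simp

lemma of_columns_mult: "of_columns x y *v z = z $ 1 *s x + z $ 2 *s y"
  by (simp add: of_columns_def matrix_vector_mult_def vec_eq_iff sum_2 mult.commute)

text \<open>The image of a constant vector is again a geometric series with the same ratio, hence in the
  Hardy space.\<close>

lemma M_plus_inner_geometric:
  assumes r: "cmod r < 1" and m: "a0 \<in> borel_measurable circle" "a1 \<in> borel_measurable circle"
    and form: "AE \<omega> in circle. a0 \<omega> = w + geometric_kernel r \<omega> *s y \<and> a1 \<omega> = b + geometric_kernel r \<omega> *s d"
    and iso: "AE \<omega> in circle. partial_isometry_with V (of_columns (a0 \<omega>) (a1 \<omega>))"
  shows "M_plus_inner (\<lambda>\<omega>. of_columns (a0 \<omega>) (a1 \<omega>))"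
proof -
  have scale: "(\<lambda>\<omega>. c *s f \<omega>) \<in> borel_measurable circle"
    if "f \<in> borel_measurable circle" for c and f :: "complex \<Rightarrow> complex^2"
  proof (rule measurable_compose[OF that borel_measurable_continuous_onI])
    show "continuous_on UNIV (\<lambda>x. c *s (x :: complex^2))"
      unfolding vector_scalar_mult_def by (intro continuous_on_vec_lambda continuous_intros)
  qed
  have col: "(\<lambda>\<omega>. of_columns (a0 \<omega>) (a1 \<omega>) *v x) \<in> borel_measurable circle" for x
    unfolding of_columns_mult by (intro borel_measurable_add scale m)
  have "(\<lambda>\<omega>. cinner (of_columns (a0 \<omega>) (a1 \<omega>) *v x) z) \<in> borel_measurable circle" for x z
  proof (rule measurable_compose[OF col borel_measurable_continuous_onI])
    show "continuous_on UNIV (\<lambda>v. cinner v z)"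
      unfolding cinner_def by (intro continuous_intros)
  qed
  moreover have "(\<lambda>\<omega>. of_columns (a0 \<omega>) (a1 \<omega>) *v x) \<in> hardy_space" for x
  proof -
    have "AE \<omega> in circle. of_columns (a0 \<omega>) (a1 \<omega>) *v x =
        (x $ 1 *s w + x $ 2 *s b) + geometric_kernel r \<omega> *s (x $ 1 *s y + x $ 2 *s d)"
      using form by eventually_elim (simp add: of_columns_mult vec_eq_iff algebra_simps)
    from hardy_expansion_geometric[OF r col this] show ?thesis
      by (auto simp: hardy_space_def)
  qed
  ultimately show ?thesis
    using iso by (auto simp: M_plus_inner_def)
qed

section \<open>The twisted inner product\<close>

lemma cinner_add_left: "cinner (x + y) z = cinner x z + cinner y z"
  and cinner_add_right: "cinner z (x + y) = cinner z x + cinner z y"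
  and cinner_scale_left: "cinner (c *s x) y = c * cinner x y"
  and cinner_scale_right: "cinner x (c *s y) = cnj c * cinner x y"
  and cinner_zero_left: "cinner 0 x = 0"
  and cinner_zero_right: "cinner x 0 = 0"
  by (simp_all add: cinner_def sum_2 algebra_simps)

lemma cnj_cinner: "cnj (cinner x y) = cinner y x"
  by (simp add: cinner_def mult.commute)

lemma cinner_self_zero: "cinner x x = 0 \<longleftrightarrow> x = 0"
  by (simp add: cinner_self)

text \<open>The orthogonal complement of a nonzero vector of the plane is a line.\<close>

lemma common_orthogonal_parallel:
  assumes "cinner x c = 0" "cinner y c = 0" "c \<noteq> 0" "y \<noteq> 0"
  obtains s where "x = s *s y"
proof -
  have x: "x $ 1 * cnj (c $ 1) + x $ 2 * cnj (c $ 2) = 0"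
    and y: "y $ 1 * cnj (c $ 1) + y $ 2 * cnj (c $ 2) = 0"
    using assms by (simp_all add: cinner_def sum_2)
  have c: "c $ 1 \<noteq> 0 \<or> c $ 2 \<noteq> 0" and y0: "y $ 1 \<noteq> 0 \<or> y $ 2 \<noteq> 0"
    using assms(3,4) by (auto simp: vec_eq_iff forall_2)
  have "(x $ 1 * y $ 2 - x $ 2 * y $ 1) * cnj (c $ 1) =
      (x $ 1 * cnj (c $ 1) + x $ 2 * cnj (c $ 2)) * y $ 2 - x $ 2 * (y $ 1 * cnj (c $ 1) + y $ 2 * cnj (c $ 2))"
    "(x $ 1 * y $ 2 - x $ 2 * y $ 1) * cnj (c $ 2) =
      x $ 1 * (y $ 1 * cnj (c $ 1) + y $ 2 * cnj (c $ 2)) - (x $ 1 * cnj (c $ 1) + x $ 2 * cnj (c $ 2)) * y $ 1"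
    by (simp_all add: algebra_simps)
  then have "(x $ 1 * y $ 2 - x $ 2 * y $ 1) * cnj (c $ 1) = 0" "(x $ 1 * y $ 2 - x $ 2 * y $ 1) * cnj (c $ 2) = 0"
    by (simp_all only: x y mult_zero_left mult_zero_right diff_zero)
  with c have det: "x $ 1 * y $ 2 = x $ 2 * y $ 1"
    by auto
  show thesis
  proof (cases "y $ 1 = 0")
    case True
    with y0 det have "x = (x $ 2 / y $ 2) *s y"
      by (simp add: vec_eq_iff forall_2)
    then show thesis by (rule that)
  next
    case False
    with det have "x = (x $ 1 / y $ 1) *s y"
      by (simp add: vec_eq_iff forall_2 field_simps)
    then show thesis by (rule that)
  qed
qed

definition defect :: "complex^2 \<Rightarrow> complex"
  where "defect w = of_real (1 - (norm w)\<^sup>2)"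

text \<open>The rank-one summand is the left-hand side of the coefficient conditions, so that they
  become statements about Gram matrices.\<close>

definition twisted :: "complex^2 \<Rightarrow> complex^2 \<Rightarrow> complex^2 \<Rightarrow> complex"
  where "twisted w x y = cinner x y + cinner x w * cinner w y / defect w"

lemma defect_alt: "defect w = 1 - cinner w w"
  by (simp add: defect_def cinner_self)

lemma cnj_defect: "cnj (defect w) = defect w"
  by (simp add: defect_def)

lemma defect_nonzero: "norm w < 1 \<Longrightarrow> defect w \<noteq> 0"
proof -
  assume "norm w < 1"
  then have "1 - (norm w)\<^sup>2 \<noteq> 0"
    using abs_square_less_1[of "norm w"] by simp
  then show ?thesis
    unfolding defect_def of_real_eq_0_iff .
qed

lemma twisted_scale_left: "twisted w (c *s x) y = c * twisted w x y"
  and twisted_scale_right: "twisted w x (c *s y) = cnj c * twisted w x y"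
  by (simp_all add: twisted_def cinner_scale_left cinner_scale_right algebra_simps)

lemma cnj_twisted: "cnj (twisted w x y) = twisted w y x"
  by (simp add: twisted_def cnj_cinner cnj_defect mult.commute)

text \<open>The twisted product with \<open>b\<close> is the ordinary product with another nonzero vector, so the
  twisted orthogonal complement of \<open>b\<close> is a line too, and \<open>y\<close> spans it.\<close>

lemma twisted_parallel:
  assumes "twisted w x b = 0" "twisted w b y = 0" "twisted w b b \<noteq> 0" "twisted w y y \<noteq> 0"
  shows "x = (twisted w x y / twisted w y y) *s y"
proof -
  define c where "c = b + (cinner b w / defect w) *s w"
  have c: "twisted w z b = cinner z c" for z
    by (simp add: twisted_def c_def cinner_add_right cinner_scale_right cnj_cinner cnj_defect)
  have "cinner y c = 0"
    using assms(2) cnj_twisted[of w b y] by (simp add: c)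
  moreover have "cinner x c = 0" "c \<noteq> 0" "y \<noteq> 0"
    using assms(1,3,4) c[of x] c[of b]
    by (simp, metis cinner_zero_right, metis cinner_zero_left mult_zero_left div_0 add_0 twisted_def)
  ultimately obtain s where s: "x = s *s y"
    using common_orthogonal_parallel[of x c y] by blast
  then show ?thesis
    using assms(4) unfolding s by (simp add: twisted_scale_left)
qed

section \<open>The coefficient conditions\<close>

text \<open>All five coefficient conditions prescribe values of this expression, see
  \<open>coefficient_conditions_iff_gram\<close>. The minimum in the summation range merges the two cases of the
  last condition.\<close>

definition gram :: "complex^2 \<Rightarrow> (nat \<Rightarrow> complex^2) \<Rightarrow> (nat \<Rightarrow> complex^2) \<Rightarrow> nat \<Rightarrow> nat \<Rightarrow> complex"
  where "gram w x y m n = cinner (x m) w * cinner w (y n) / defect w +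
    (\<Sum>r\<le>min m n. cinner (x (m - r)) (y (n - r)))"

lemma gram_0: "gram w x y m 0 = twisted w (x m) (y 0)" "gram w x y 0 n = twisted w (x 0) (y n)"
  by (simp_all add: gram_def twisted_def)

lemma gram_Suc: "gram w x y (Suc m) (Suc n) =
    twisted w (x (Suc m)) (y (Suc n)) + (\<Sum>r\<le>min m n. cinner (x (m - r)) (y (n - r)))"
  by (simp add: gram_def twisted_def sum.atMost_Suc_shift del: sum.atMost_Suc)

text \<open>A step along the diagonal adds the twisted product of the new entries and drops the rank-one
  term of the old ones. The hypothesis says that the two cancel.\<close>

lemma gram_diagonal:
  assumes "\<And>i j. m0 \<le> i \<Longrightarrow> n0 \<le> j \<Longrightarrow>
      twisted w (x (Suc i)) (y (Suc j)) = cinner (x i) w * cinner w (y j) / defect w"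
  shows "gram w x y (m0 + k) (n0 + k) = gram w x y m0 n0"
proof (induction k)
  case (Suc k)
  have "gram w x y (m0 + Suc k) (n0 + Suc k) = gram w x y (m0 + k) (n0 + k)"
    using assms[of "m0 + k" "n0 + k"] by (simp add: gram_Suc) (simp add: gram_def)
  with Suc show ?case by simp
qed simp

lemma cinner_square: "cinner x w * cinner w x = of_real ((cmod (cinner x w))\<^sup>2)"
  using complex_norm_square[of "cinner x w"] by (simp add: cnj_cinner)

lemma gram_same:
  "gram w x x p p = 1 \<longleftrightarrow>
    (cmod (cinner (x p) w))\<^sup>2 / (1 - (norm w)\<^sup>2) = 1 - (\<Sum>k\<le>p. (norm (x k))\<^sup>2)"
proof -
  have "(\<Sum>r\<le>p. cinner (x (p - r)) (x (p - r))) = (\<Sum>k\<le>p. cinner (x k) (x k))"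
    by (rule sum.nat_diff_reindex[of "\<lambda>k. cinner (x k) (x k)" "Suc p", unfolded lessThan_Suc_atMost, simplified])
  then have "gram w x x p p =
      of_real ((cmod (cinner (x p) w))\<^sup>2 / (1 - (norm w)\<^sup>2) + (\<Sum>k\<le>p. (norm (x k))\<^sup>2))"
    by (simp add: gram_def cinner_square cinner_self defect_def)
  also have "\<dots> = 1 \<longleftrightarrow> (cmod (cinner (x p) w))\<^sup>2 / (1 - (norm w)\<^sup>2) + (\<Sum>k\<le>p. (norm (x k))\<^sup>2) = 1"
    by (metis of_real_eq_1_iff)
  finally show ?thesis by (simp add: eq_diff_eq)
qed

lemma coefficient_conditions_iff_gram:
  "coefficient_conditions a b \<longleftrightarrow>
    (\<forall>p m. 0 < p \<and> p \<le> m \<longrightarrow> gram (a 0) a a m p = of_bool (m = p)) \<and>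
    (\<forall>p m. p \<le> m \<longrightarrow> gram (a 0) b b m p = of_bool (m = p)) \<and>
    (\<forall>p m. 0 < p \<longrightarrow> gram (a 0) b a m p = 0)"
proof -
  let ?f = "\<lambda>x y m p. cinner (x m) (a 0) * cinner (a 0) (y p) / of_real (1 - (norm (a 0))\<^sup>2)"
  have off: "gram (a 0) x y m p = 0 \<longleftrightarrow> ?f x y m p = - (\<Sum>r\<le>min m p. cinner (x (m - r)) (y (p - r)))"
    for x y m p
    by (simp add: gram_def defect_def eq_neg_iff_add_eq_0)
  have ge: "gram (a 0) x y m p = 0 \<longleftrightarrow> ?f x y m p = - (\<Sum>r\<le>p. cinner (x (m - r)) (y (p - r)))"
    if "p \<le> m" for x y m p
    using off that by (simp only: min_absorb2)
  have lt: "gram (a 0) x y m p = 0 \<longleftrightarrow> ?f x y m p = - (\<Sum>r\<le>m. cinner (x (m - r)) (y (p - r)))"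
    if "m < p" for x y m p
    using off[of x y m p] min_absorb1[OF less_imp_le[OF that]] by (simp only:)
  have aa: "(\<forall>p m. 0 < p \<and> p \<le> m \<longrightarrow> gram (a 0) a a m p = of_bool (m = p)) \<longleftrightarrow>
      (\<forall>p>0. gram (a 0) a a p p = 1) \<and> (\<forall>p m. 0 < p \<and> p < m \<longrightarrow> gram (a 0) a a m p = 0)"
    by (auto simp: le_less)
  have bb: "(\<forall>p m. p \<le> m \<longrightarrow> gram (a 0) b b m p = of_bool (m = p)) \<longleftrightarrow>
      (\<forall>p. gram (a 0) b b p p = 1) \<and> (\<forall>p m. p < m \<longrightarrow> gram (a 0) b b m p = 0)"
    by (auto simp: le_less)
  have ba: "(\<forall>p m. 0 < p \<longrightarrow> gram (a 0) b a m p = 0) \<longleftrightarrow>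
      (\<forall>p m. 0 < p \<and> p \<le> m \<longrightarrow> gram (a 0) b a m p = 0) \<and> (\<forall>p m. m < p \<longrightarrow> gram (a 0) b a m p = 0)"
    (is "?L \<longleftrightarrow> ?R")
  proof
    assume ?R
    show ?L
    proof (intro allI impI)
      fix p m :: nat assume "0 < p"
      with \<open>?R\<close> show "gram (a 0) b a m p = 0"
        by (cases "p \<le> m") simp_all
    qed
  qed simp
  have aa': "(\<forall>p m. 0 < p \<and> p < m \<longrightarrow> gram (a 0) a a m p = 0) \<longleftrightarrow>
      (\<forall>p m. 0 < p \<and> p < m \<longrightarrow> ?f a a m p = - (\<Sum>r\<le>p. cinner (a (m - r)) (a (p - r))))"
    by (intro all_cong1 imp_cong refl ge) auto
  have bb': "(\<forall>p m. p < m \<longrightarrow> gram (a 0) b b m p = 0) \<longleftrightarrow>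
      (\<forall>p m. p < m \<longrightarrow> ?f b b m p = - (\<Sum>r\<le>p. cinner (b (m - r)) (b (p - r))))"
    by (intro all_cong1 imp_cong refl ge) auto
  have ba': "(\<forall>p m. 0 < p \<and> p \<le> m \<longrightarrow> gram (a 0) b a m p = 0) \<longleftrightarrow>
      (\<forall>p m. 0 < p \<and> p \<le> m \<longrightarrow> ?f b a m p = - (\<Sum>r\<le>p. cinner (b (m - r)) (a (p - r))))"
    by (intro all_cong1 imp_cong refl ge) auto
  have ba'': "(\<forall>p m. m < p \<longrightarrow> gram (a 0) b a m p = 0) \<longleftrightarrow>
      (\<forall>p m. m < p \<longrightarrow> ?f b a m p = - (\<Sum>r\<le>m. cinner (b (m - r)) (a (p - r))))"
    by (intro all_cong1 imp_cong refl lt)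
  show ?thesis
    unfolding aa bb ba aa' bb' ba' ba'' gram_same coefficient_conditions_def Let_def
    by (rule iffI; elim conjE; intro conjI; assumption)
qed

text \<open>The free data of a two-dimensional solution: the constant coefficient \<open>w\<close> and the linear
  coefficient \<open>y\<close> of the first column and the constant coefficient \<open>b\<close> of the second. The vectors \<open>b\<close>
  and \<open>y\<close> are orthogonal for the twisted product, with squared norms one and \<open>defect w\<close>.\<close>

definition realization :: "complex^2 \<Rightarrow> complex^2 \<Rightarrow> complex^2 \<Rightarrow> bool"
  where "realization w y b \<longleftrightarrow> norm w < 1 \<and>
    twisted w y y = defect w \<and> twisted w b b = 1 \<and> twisted w b y = 0"

text \<open>Ratio of the two geometric series.\<close>

definition ratio :: "complex^2 \<Rightarrow> complex^2 \<Rightarrow> complex"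
  where "ratio w y = - cinner y w / defect w"

text \<open>The second column has linear coefficient \<open>weight w b *s y\<close>.\<close>

definition weight :: "complex^2 \<Rightarrow> complex^2 \<Rightarrow> complex"
  where "weight w b = - cinner b w / defect w"

text \<open>Gram values with one index at most one are enough: they determine the twisted products of
  every coefficient with \<open>b 0\<close> and \<open>a 1\<close>, and these two vectors are a twisted orthogonal basis.\<close>

lemma coefficient_conditions_imp_realization:
  assumes cc: "coefficient_conditions a b" and w: "norm (a 0) < 1"
  shows "realization (a 0) (a 1) (b 0)"
    and "a = geometric_coeffs (a 0) (a 1) (ratio (a 0) (a 1))"
    and "b = geometric_coeffs (b 0) (weight (a 0) (b 0) *s a 1) (ratio (a 0) (a 1))"
proof -
  let ?w = "a 0" and ?N = "defect (a 0)" and ?r = "ratio (a 0) (a 1)"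
  have aa: "gram ?w a a m p = of_bool (m = p)" if "0 < p" "p \<le> m" for m p
    using cc that by (simp add: coefficient_conditions_iff_gram)
  have bb: "gram ?w b b m p = of_bool (m = p)" if "p \<le> m" for m p
    using cc that by (simp add: coefficient_conditions_iff_gram)
  have ba: "gram ?w b a m p = 0" if "0 < p" for m p
    using cc that by (simp add: coefficient_conditions_iff_gram)
  have N: "?N \<noteq> 0" using w by (rule defect_nonzero)
  have a1a1: "twisted ?w (a 1) (a 1) = ?N"
    using aa[of 1 1] gram_Suc[of ?w a a 0 0] by (simp add: defect_alt eq_diff_eq)
  have b0b0: "twisted ?w (b 0) (b 0) = 1"
    using bb[of 0 0] by (simp add: gram_0)
  have bb0: "twisted ?w (b (Suc k)) (b 0) = 0" for k
    using bb[of 0 "Suc k"] by (simp add: gram_0)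
  have b0a: "twisted ?w (b 0) (a (Suc k)) = 0" for k
    using ba[of "Suc k" 0] by (simp add: gram_0)
  then have ab0: "twisted ?w (a (Suc k)) (b 0) = 0" for k
    using cnj_twisted[of ?w "b 0" "a (Suc k)"] by simp
  have aa1: "twisted ?w (a (Suc (Suc k))) (a 1) = - cinner (a (Suc k)) ?w" for k
    using aa[of 1 "Suc (Suc k)"] gram_Suc[of ?w a a "Suc k" 0] by (simp add: eq_neg_iff_add_eq_0)
  have ba1: "twisted ?w (b (Suc k)) (a 1) = - cinner (b k) ?w" for k
    using ba[of 1 "Suc k"] gram_Suc[of ?w b a k 0] by (simp add: eq_neg_iff_add_eq_0)
  \<comment> \<open>Both columns enter the recursion through this: coefficients orthogonal to \<open>b 0\<close> are read off
    from their product with \<open>a 1\<close>, which \<open>aa1\<close> and \<open>ba1\<close> express by the preceding coefficient.\<close>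
  have multiple: "x = (twisted ?w x (a 1) / ?N) *s a 1" if "twisted ?w x (b 0) = 0" for x
    using twisted_parallel[of ?w x "b 0" "a 1"] that b0a[of 0] b0b0 a1a1 N by simp
  show "realization ?w (a 1) (b 0)"
    using w a1a1 b0b0 b0a[of 0] by (simp add: realization_def)
  have a: "a (Suc k) = ?r ^ k *s a 1" for k
  proof (induction k)
    case (Suc k)
    have "a (Suc (Suc k)) = (- cinner (a (Suc k)) ?w / ?N) *s a 1"
      using multiple[OF ab0[of "Suc k"]] by (simp only: aa1)
    then show ?case
      by (simp add: Suc cinner_scale_left ratio_def mult.commute)
  qed simp
  show "a = geometric_coeffs ?w (a 1) ?r"
  proof
    show "a k = geometric_coeffs ?w (a 1) ?r k" for k
      using a[of "k - 1"] by (cases k) (simp_all only: geometric_coeffs_def nat.case diff_Suc_1)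
  qed
  have bS: "b (Suc k) = (- cinner (b k) ?w / ?N) *s a 1" for k
    using multiple[OF bb0[of k]] by (simp only: ba1)
  have bw: "cinner (b k) ?w = ?r ^ k * cinner (b 0) ?w" for k
  proof (induction k)
    case (Suc k)
    show ?case
      unfolding bS[of k] cinner_scale_left Suc by (simp add: ratio_def)
  qed simp
  have b: "b (Suc k) = ?r ^ k *s (weight ?w (b 0) *s a 1)" for k
    unfolding bS[of k] bw[of k] by (simp add: weight_def vector_smult_assoc)
  show "b = geometric_coeffs (b 0) (weight ?w (b 0) *s a 1) ?r"
  proof
    show "b k = geometric_coeffs (b 0) (weight ?w (b 0) *s a 1) ?r k" for k
      using b[of "k - 1"] by (cases k) (simp_all only: geometric_coeffs_def nat.case diff_Suc_1)
  qed
qed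

lemma cinner_eq_ratio: "norm w < 1 \<Longrightarrow> cinner y w = - defect w * ratio w y"
  and cinner_eq_weight: "norm w < 1 \<Longrightarrow> cinner b w = - defect w * weight w b"
  using defect_nonzero[of w] by (simp_all add: ratio_def weight_def)

text \<open>Except for \<open>w\<close> itself, the product of the coefficient of index \<open>k\<close> with \<open>w\<close> is proportional to \<open>r\<^sup>k\<close>, and
  the next coefficient is \<open>r\<^sup>k\<close> times the linear one; this proportionality is the cancellation that
  \<open>gram_diagonal\<close> needs. Each prescribed Gram value is thus equal to one at the start of its diagonal.\<close>

lemma realization_imp_coefficient_conditions:
  assumes R: "realization w y b"
  shows "coefficient_conditions (geometric_coeffs w y (ratio w y))
    (geometric_coeffs b (weight w b *s y) (ratio w y))"
proof -
  define r where "r = ratio w y"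
  define q where "q = weight w b"
  define N where "N = defect w"
  let ?a = "geometric_coeffs w y r" and ?b = "geometric_coeffs b (q *s y) r"
  have w: "norm w < 1" and yy: "twisted w y y = N" and bb: "twisted w b b = 1" and bY: "twisted w b y = 0"
    using R by (auto simp: realization_def N_def)
  have N: "N \<noteq> 0" and cN: "cnj N = N"
    using defect_nonzero[OF w] by (auto simp: N_def cnj_defect)
  have yb: "twisted w y b = 0"
    using bY cnj_twisted[of w b y] by simp
  have yw: "cinner y w = - N * r" and bw: "cinner b w = - N * q"
    using cinner_eq_ratio[OF w] cinner_eq_weight[OF w] by (simp_all add: r_def q_def N_def)
  have wy: "cinner w y = - N * cnj r" and wb: "cinner w b = - N * cnj q"
    using cnj_cinner[of y w] cnj_cinner[of b w] by (simp_all add: yw bw cN)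
  have ww: "cinner w w = 1 - N"
    by (simp add: N_def defect_alt)
  have a0: "?a 0 = w" and aS: "?a (Suc k) = r ^ k *s y" and b0: "?b 0 = b" and bS: "?b (Suc k) = (r ^ k * q) *s y" for k
    by (simp_all add: geometric_coeffs_def vector_smult_assoc)
  have aw: "cinner (?a (Suc k)) w = - N * r ^ Suc k" and wa: "cinner w (?a (Suc k)) = - N * cnj r ^ Suc k" for k
    by (simp_all only: aS cinner_scale_left cinner_scale_right yw wy) (simp_all add: mult_ac)
  have bw': "cinner (?b k) w = - N * q * r ^ k" and wb': "cinner w (?b k) = - N * cnj q * cnj r ^ k" for k
    by (cases k; simp add: bS b0 cinner_scale_left cinner_scale_right yw wy bw wb)+
  have cancel: "(- N * A) * (- N * B) / N = A * (B * N)" for A B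
    using N by (simp add: field_simps)
  have step: "twisted w ((A * c) *s y) ((B * d) *s y) = (- N * (c * A)) * (- N * (cnj d * cnj B)) / N" for A B c d
    unfolding cancel by (simp add: twisted_scale_left twisted_scale_right yy)
  have aa: "gram w ?a ?a (1 + d + k) (1 + k) = of_bool (d = 0)" for d k
  proof -
    have "gram w ?a ?a (1 + d + k) (1 + k) = gram w ?a ?a (1 + d) 1"
    proof (rule gram_diagonal)
      fix i j :: nat assume "1 + d \<le> i" "1 \<le> j"
      then obtain i' j' where ij: "i = Suc i'" "j = Suc j'"
        by (cases i; cases j) auto
      show "twisted w (?a (Suc i)) (?a (Suc j)) = cinner (?a i) w * cinner w (?a j) / defect w"
        using step[of "r ^ i" 1 "r ^ j" 1] unfolding ij aw wa N_def[symmetric] unfolding aS by simp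
    qed
    also have "\<dots> = twisted w (?a (Suc d)) (?a (Suc 0)) + cinner (?a d) (?a 0)"
      using gram_Suc[of w ?a ?a d 0] by simp
    also have "\<dots> = of_bool (d = 0)"
      by (cases d) (simp_all only: aw a0, simp_all add: aS twisted_scale_left yy ww a0)
    finally show ?thesis .
  qed
  have bb: "gram w ?b ?b (d + k) k = of_bool (d = 0)" for d k
  proof -
    have "gram w ?b ?b (d + k) (0 + k) = gram w ?b ?b d 0"
    proof (rule gram_diagonal)
      show "twisted w (?b (Suc i)) (?b (Suc j)) = cinner (?b i) w * cinner w (?b j) / defect w" for i j
        using step[of "r ^ i" q "r ^ j" q] unfolding bw' wb' N_def[symmetric] unfolding bS by (simp add: mult.assoc)
    qed
    also have "\<dots> = of_bool (d = 0)"
      unfolding gram_0 by (cases d) (simp_all add: bS b0 twisted_scale_left yb bb)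
    finally show ?thesis by simp
  qed
  have ba_diag: "twisted w (?b (Suc i)) (?a (Suc j)) = cinner (?b i) w * cinner w (?a j) / defect w" if j: "1 \<le> j" for i j
  proof -
    from j obtain j' where j': "j = Suc j'" by (cases j) auto
    show ?thesis
      using step[of "r ^ i" q "r ^ j" 1] unfolding j' bw' wa N_def[symmetric] unfolding bS aS by (simp add: mult.assoc)
  qed
  have ba1: "gram w ?b ?a (d + k) (1 + k) = 0" for d k
  proof -
    have "gram w ?b ?a (d + k) (1 + k) = gram w ?b ?a d 1"
      by (rule gram_diagonal) (use ba_diag in auto)
    also have "\<dots> = 0"
    proof (cases d)
      case 0
      then show ?thesis by (simp add: gram_0 b0 aS[of 0, simplified] bY)
    next
      case (Suc e)
      have "gram w ?b ?a d 1 = twisted w (?b (Suc e)) (?a (Suc 0)) + cinner (?b e) (?a 0)"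
        using gram_Suc[of w ?b ?a e 0] by (simp add: Suc)
      then show ?thesis
        by (simp only: a0 bw') (simp add: aS bS twisted_scale_left yy)
    qed
    finally show ?thesis .
  qed
  have ba2: "gram w ?b ?a k (Suc d + k) = 0" for d k
  proof -
    have "gram w ?b ?a (0 + k) (Suc d + k) = gram w ?b ?a 0 (Suc d)"
      by (rule gram_diagonal) (use ba_diag in auto)
    also have "\<dots> = 0"
      by (simp add: gram_0 b0 aS twisted_scale_right bY)
    finally show ?thesis by simp
  qed
  have "coefficient_conditions ?a ?b"
    unfolding coefficient_conditions_iff_gram a0
  proof (intro conjI allI impI)
    fix p m :: nat assume "0 < p \<and> p \<le> m"
    then have "m = 1 + (m - p) + (p - 1)" "p = 1 + (p - 1)" by auto
    then show "gram w ?a ?a m p = of_bool (m = p)"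
      using aa[of "m - p" "p - 1"] \<open>0 < p \<and> p \<le> m\<close> by (auto simp: le_antisym)
  next
    fix p m :: nat assume "p \<le> m"
    then show "gram w ?b ?b m p = of_bool (m = p)"
      using bb[of "m - p" p] by auto
  next
    fix p m :: nat assume p: "0 < p"
    show "gram w ?b ?a m p = 0"
    proof (cases "p - 1 \<le> m")
      case True
      then show ?thesis using ba1[of "m - (p - 1)" "p - 1"] p by simp
    next
      case False
      then show ?thesis using ba2[of m "p - m - 1"] p by simp
    qed
  qed
  then show ?thesis by (simp add: r_def q_def)
qed

section \<open>Unitarity on the circle\<close>

text \<open>In terms of defect, ratio and weight, all inner products of the three vectors are explicit, so
  that unitarity becomes an identity between polynomials.\<close>

lemma realization_facts:
  assumes R: "realization w y b"
  defines "N \<equiv> defect w" and "r \<equiv> ratio w y" and "q \<equiv> weight w b"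
  shows "N \<noteq> 0" "cinner w w = 1 - N" "cinner y w = - N * r" "cinner w y = - N * cnj r"
    "cinner b w = - N * q" "cinner w b = - N * cnj q" "cinner y y = N * (1 - r * cnj r)"
    "cinner b b = 1 - N * q * cnj q" "cinner b y = - N * q * cnj r" "cinner y b = - N * cnj q * r"
proof -
  have w: "norm w < 1" and yy: "twisted w y y = N" and bb: "twisted w b b = 1" and bY: "twisted w b y = 0"
    using R by (auto simp: realization_def N_def)
  show N: "N \<noteq> 0"
    using defect_nonzero[OF w] by (simp add: N_def)
  have cN: "cnj N = N" by (simp add: N_def cnj_defect)
  show "cinner w w = 1 - N"
    by (simp add: N_def defect_alt)
  show yw: "cinner y w = - N * r" and bw: "cinner b w = - N * q"
    using cinner_eq_ratio[OF w] cinner_eq_weight[OF w] by (simp_all add: r_def q_def N_def)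
  show wy: "cinner w y = - N * cnj r" and wb: "cinner w b = - N * cnj q"
    using cnj_cinner[of y w] cnj_cinner[of b w] by (simp_all add: yw bw cN)
  show "cinner y y = N * (1 - r * cnj r)" "cinner b b = 1 - N * q * cnj q"
    using yy bb N unfolding twisted_def N_def[symmetric] yw wy bw wb by (simp_all add: algebra_simps)
  show "cinner b y = - N * q * cnj r"
    using bY N unfolding twisted_def N_def[symmetric] bw wy by (simp add: algebra_simps eq_neg_iff_add_eq_0)
  then show "cinner y b = - N * cnj q * r"
    using cnj_cinner[of b y] by (simp add: cN)
qed

text \<open>The twisted norm of \<open>y\<close> gives \<open>|y|\<^sup>2 = N (1 - |r|\<^sup>2)\<close>, and \<open>y\<close> is not zero.\<close>

lemma ratio_less_one:
  assumes R: "realization w y b"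
  shows "cmod (ratio w y) < 1"
proof -
  define n where "n = 1 - (norm w)\<^sup>2"
  have n: "n > 0"
    using R by (simp add: realization_def n_def abs_square_less_1)
  have N: "defect w = of_real n" by (simp add: defect_def n_def)
  have "y \<noteq> 0"
    using R n by (auto simp: realization_def twisted_def cinner_zero_left N)
  have "complex_of_real ((norm y)\<^sup>2) = of_real (n * (1 - (cmod (ratio w y))\<^sup>2))"
    using realization_facts(7)[OF R] complex_norm_square[of "ratio w y"] by (simp add: cinner_self N)
  then have "(norm y)\<^sup>2 = n * (1 - (cmod (ratio w y))\<^sup>2)"
    by (simp only: of_real_eq_iff)
  with \<open>y \<noteq> 0\<close> have "n * (1 - (cmod (ratio w y))\<^sup>2) > 0"
    by (metis zero_less_power2 norm_eq_zero)
  with n have "(cmod (ratio w y))\<^sup>2 < 1"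
    by (simp add: zero_less_mult_iff)
  then show ?thesis
    by (simp add: abs_square_less_1)
qed

lemma unitary_mat_of_columns:
  "unitary_mat (of_columns x y) \<longleftrightarrow> cinner x x = 1 \<and> cinner y y = 1 \<and> cinner x y = 0"
proof -
  have "unitary_mat (of_columns x y) \<longleftrightarrow> cadjoint (of_columns x y) ** of_columns x y = mat 1"
    unfolding unitary_mat_def using matrix_left_right_inverse by blast
  also have "\<dots> \<longleftrightarrow> cinner x x = 1 \<and> cinner y y = 1 \<and> cinner x y = 0 \<and> cinner y x = 0"
    by (auto simp: cadjoint_def of_columns_def matrix_matrix_mult_def mat_def vec_eq_iff forall_2 sum_2
        cinner_def mult.commute)
  also have "\<dots> \<longleftrightarrow> cinner x x = 1 \<and> cinner y y = 1 \<and> cinner x y = 0"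
    using cnj_cinner[of x y] by auto
  finally show ?thesis .
qed

lemma partial_isometry_if_unitary:
  assumes "unitary_mat (of_columns x y)"
  shows "partial_isometry_with UNIV (of_columns x y)"
  unfolding partial_isometry_with_def
proof (intro conjI ballI allI impI)
  have xy: "cinner x x = 1" "cinner y y = 1" "cinner x y = 0" "cinner y x = 0"
    using assms cnj_cinner[of x y] by (auto simp: unitary_mat_of_columns)
  show "norm (of_columns x y *v z) = norm z" for z
  proof -
    have "cinner (of_columns x y *v z) (of_columns x y *v z) = cinner z z"
      by (simp add: of_columns_mult cinner_add_left cinner_add_right cinner_scale_left cinner_scale_right xy)
         (simp add: cinner_def sum_2)
    then have "(norm (of_columns x y *v z))\<^sup>2 = (norm z)\<^sup>2"
      unfolding cinner_self of_real_eq_iff .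
    then show ?thesis by (simp add: power2_eq_iff_nonneg)
  qed
  show "of_columns x y *v z = 0" if "\<forall>u\<in>UNIV. cinner z u = 0" for z
  proof -
    have "z = 0" using that cinner_self_zero by blast
    then show ?thesis by (simp add: of_columns_mult)
  qed
qed simp

text \<open>With \<open>z\<close> the kernel, \<open>1 + r z = 1 / (1 - r \<omega>)\<close>, which differs from \<open>z\<close> by the unimodular factor \<open>\<omega>\<close>.
  Expanded without moduli so that it can serve as a rewrite rule.\<close>

lemma kernel_modulus:
  assumes "cmod r < 1" "cmod \<omega> = 1"
  defines "z \<equiv> geometric_kernel r \<omega>"
  shows "z * cnj z = (1 + r * z) * (1 + cnj r * cnj z)"
proof -
  have nz: "1 - r * \<omega> \<noteq> 0"
    using one_minus_nonzero(1)[OF assms(1,2)] .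
  then have "1 + r * z = 1 / (1 - r * \<omega>)"
    by (simp add: z_def geometric_kernel_def field_simps)
  moreover from this have "1 + cnj r * cnj z = cnj (1 / (1 - r * \<omega>))"
    by (metis complex_cnj_add complex_cnj_mult complex_cnj_one)
  moreover have "z * cnj z = (\<omega> * cnj \<omega>) * ((1 / (1 - r * \<omega>)) * cnj (1 / (1 - r * \<omega>)))"
    by (simp add: z_def geometric_kernel_def)
  moreover have "\<omega> * cnj \<omega> = 1"
    using assms(2) complex_norm_square[of \<omega>] by simp
  ultimately show ?thesis by simp
qed

text \<open>Each of the three products deviates from its target by a multiple of the difference of the
  two sides of \<open>kernel_modulus\<close>.\<close>

lemma realization_unitary:
  assumes R: "realization w y b" and \<omega>: "cmod \<omega> = 1"
  defines "z \<equiv> geometric_kernel (ratio w y) \<omega>"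
  shows "unitary_mat (of_columns (w + z *s y) (b + z *s (weight w b *s y)))"
proof -
  define N r q where "N = defect w" and "r = ratio w y" and "q = weight w b"
  note facts = realization_facts[OF R, folded N_def r_def q_def]
  have E: "z * cnj z = (1 + r * z) * (1 + cnj r * cnj z)"
    using kernel_modulus[OF ratio_less_one[OF R] \<omega>] by (simp add: z_def r_def)
  have "cinner (w + z *s y) (w + z *s y) =
      1 - N * ((1 + r * z) * (1 + cnj r * cnj z) - z * cnj z)"
    by (simp add: cinner_add_left cinner_add_right cinner_scale_left cinner_scale_right facts)
       (simp add: algebra_simps)
  moreover have "cinner (b + z *s (q *s y)) (b + z *s (q *s y)) =
      1 - N * q * cnj q * ((1 + r * z) * (1 + cnj r * cnj z) - z * cnj z)"
    by (simp add: cinner_add_left cinner_add_right cinner_scale_left cinner_scale_right facts)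
       (simp add: algebra_simps)
  moreover have "cinner (w + z *s y) (b + z *s (q *s y)) =
      - N * cnj q * ((1 + r * z) * (1 + cnj r * cnj z) - z * cnj z)"
    by (simp add: cinner_add_left cinner_add_right cinner_scale_left cinner_scale_right facts)
       (simp add: algebra_simps)
  ultimately show ?thesis
    unfolding unitary_mat_of_columns q_def[symmetric] by (simp only: E diff_self mult_zero_right diff_zero)
qed

definition realized_by :: "complex^2 \<Rightarrow> complex^2 \<Rightarrow> complex^2 \<Rightarrow> (complex \<Rightarrow> complex^2) \<Rightarrow> (complex \<Rightarrow> complex^2) \<Rightarrow> bool"
  where "realized_by w y b a0 a1 \<longleftrightarrow> (AE \<omega> in circle.
    a0 \<omega> = w + geometric_kernel (ratio w y) \<omega> *s y \<and>
    a1 \<omega> = b + geometric_kernel (ratio w y) \<omega> *s (weight w b *s y))"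

lemma admissible_2dim_imp_realization:
  assumes h: "a0 \<in> hardy_space" "a1 \<in> hardy_space" and adm: "admissible_2dim a0 a1"
  obtains w y b where "realization w y b" "realized_by w y b a0 a1"
proof -
  obtain h0 h1 where h0: "hardy_expansion a0 h0" and h1: "hardy_expansion a1 h1"
    using h by (auto simp: hardy_space_def)
  then have cc: "coefficient_conditions h0 h1" and n: "norm (h0 0) < 1"
    using adm by (auto simp: admissible_2dim_def hardy_coeff_eqI)
  let ?r = "ratio (h0 0) (h0 1)"
  have R: "realization (h0 0) (h0 1) (h1 0)"
    by (rule coefficient_conditions_imp_realization(1)[OF cc n])
  have "hardy_expansion a0 (geometric_coeffs (h0 0) (h0 1) ?r)"
    by (rule subst[where P = "hardy_expansion a0", OF coefficient_conditions_imp_realization(2)[OF cc n] h0])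
  moreover have "hardy_expansion a1 (geometric_coeffs (h1 0) (weight (h0 0) (h1 0) *s h0 1) ?r)"
    by (rule subst[where P = "hardy_expansion a1", OF coefficient_conditions_imp_realization(3)[OF cc n] h1])
  ultimately have "realized_by (h0 0) (h0 1) (h1 0) a0 a1"
    unfolding realized_by_def AE_conj_iff
    using geometric_function_if_coeffs[OF ratio_less_one[OF R]] by blast
  with R show thesis by (rule that)
qed

lemma realization_imp_admissible:
  assumes h: "a0 \<in> hardy_space" "a1 \<in> hardy_space"
    and R: "realization w y b" and f: "realized_by w y b a0 a1"
  shows "admissible a0 a1"
proof -
  let ?r = "ratio w y"
  note r = ratio_less_one[OF R]
  have m: "a0 \<in> borel_measurable circle" "a1 \<in> borel_measurable circle"
    using h by (auto simp: hardy_space_def dest: hardy_expansion_measurable)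
  have U: "AE \<omega> in circle. unitary_mat (of_columns (a0 \<omega>) (a1 \<omega>))"
    using f[unfolded realized_by_def] AE_circle
    by eventually_elim (simp only: realization_unitary[OF R])
  have "hardy_expansion a0 (geometric_coeffs w y ?r)"
    by (rule hardy_expansion_geometric[OF r m(1)]) (use f in \<open>simp add: realized_by_def\<close>)
  moreover have "hardy_expansion a1 (geometric_coeffs b (weight w b *s y) ?r)"
    by (rule hardy_expansion_geometric[OF r m(2)]) (use f in \<open>simp add: realized_by_def\<close>)
  moreover have "norm w < 1"
    using R by (simp add: realization_def)
  moreover have "geometric_coeffs w y ?r 0 = w"
    by (simp add: geometric_coeffs_def)
  ultimately have "admissible_2dim a0 a1"
    using U realization_imp_coefficient_conditions[OF R]
    by (simp add: admissible_2dim_def hardy_coeff_eqI)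
  moreover have "AE \<omega> in circle. partial_isometry_with UNIV (of_columns (a0 \<omega>) (a1 \<omega>))"
    using U by eventually_elim (rule partial_isometry_if_unitary)
  ultimately show ?thesis
    using M_plus_inner_geometric[OF r m f[unfolded realized_by_def]] by (simp add: admissible_def)
qed

section \<open>Normal forms of realizations\<close>

text \<open>Spanning is automatic: a square matrix with orthonormal columns is also a left inverse of its
  adjoint, which expands any vector in the columns.\<close>

lemma orthonormal_basis_iff:
  "orthonormal_basis u0 u1 \<longleftrightarrow> norm u0 = 1 \<and> norm u1 = 1 \<and> cinner u0 u1 = 0"
proof -
  have "x \<in> vec.span {u0, u1}" if "norm u0 = 1" "norm u1 = 1" "cinner u0 u1 = 0" for x
  proof -
    let ?C = "of_columns u0 u1"
    have "unitary_mat ?C"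
      using that by (simp add: unitary_mat_of_columns cinner_self)
    then have "x = ?C *v (cadjoint ?C *v x)"
      by (simp add: unitary_mat_def matrix_vector_mul_assoc)
    also have "\<dots> \<in> vec.span {u0, u1}"
      unfolding of_columns_mult by (intro vec.span_add vec.span_scale vec.span_base) auto
    finally show ?thesis .
  qed
  then show ?thesis
    by (auto simp: orthonormal_basis_def)
qed

lemma AE_circle_cong:
  "(\<And>\<omega>. cmod \<omega> = 1 \<Longrightarrow> P \<omega> \<longleftrightarrow> Q \<omega>) \<Longrightarrow> (AE \<omega> in circle. P \<omega>) \<longleftrightarrow> (AE \<omega> in circle. Q \<omega>)"
  by (rule AE_cong) (simp add: space_circle)

lemma cinner_unit: "norm u = 1 \<Longrightarrow> cinner u u = 1"
  by (simp add: cinner_self)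

lemma defect_scale: "norm u = 1 \<Longrightarrow> defect (c *s u) = of_real (1 - (cmod c)\<^sup>2)"
  by (simp add: defect_def norm_scale)

lemma twisted_unit_self:
  assumes "norm u = 1" "norm u0 = 1"
  shows "twisted (c *s u0) (k *s u) (k *s u) =
    of_real ((cmod k)\<^sup>2 * (1 + (cmod c)\<^sup>2 / (1 - (cmod c)\<^sup>2) * (cmod (cinner u u0))\<^sup>2))"
proof -
  have "twisted (c *s u0) (k *s u) (k *s u) = k * cnj k * twisted (c *s u0) u u"
    by (simp add: twisted_scale_left twisted_scale_right)
  also have "twisted (c *s u0) u u = 1 + c * cnj c * (cinner u u0 * cnj (cinner u u0)) / of_real (1 - (cmod c)\<^sup>2)"
    unfolding twisted_def defect_scale[OF assms(2)] cinner_unit[OF assms(1)]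
    by (simp add: cinner_scale_left cinner_scale_right cnj_cinner mult_ac)
  finally show ?thesis
    by (simp add: complex_norm_square[symmetric] del: complex_norm_square)
qed

lemma type2_realization:
  assumes "orthonormal_basis u0 u1"
  shows "realization 0 u0 u1"
    and "realized_by 0 u0 u1 a0 a1 \<longleftrightarrow> (AE \<omega> in circle. a0 \<omega> = \<omega> *s u0 \<and> a1 \<omega> = u1)"
proof -
  have u: "cinner u0 u0 = 1" "cinner u1 u1 = 1" "cinner u1 u0 = 0"
    using assms cnj_cinner[of u0 u1] by (auto simp: orthonormal_basis_def cinner_unit)
  show "realization 0 u0 u1"
    by (simp add: realization_def twisted_def defect_def cinner_zero_left cinner_zero_right u)
  show "realized_by 0 u0 u1 a0 a1 \<longleftrightarrow> (AE \<omega> in circle. a0 \<omega> = \<omega> *s u0 \<and> a1 \<omega> = u1)"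
    by (simp add: realized_by_def ratio_def weight_def cinner_zero_right geometric_kernel_def)
qed

text \<open>Here the first two vectors are orthogonal, so the ratio vanishes and the series are linear in \<open>\<omega>\<close>.\<close>

lemma type3_realization:
  fixes \<rho> \<theta> :: real
  assumes onb: "orthonormal_basis u0 u1" and \<rho>: "0 < \<rho>" "\<rho> < 1"
  defines "s \<equiv> sqrt (1 - \<rho>\<^sup>2)"
  defines "w \<equiv> of_real \<rho> *s u0" and "y \<equiv> of_real s *s u1" and "b \<equiv> (cis \<theta> * of_real s) *s u0"
  shows "realization w y b"
    and "realized_by w y b a0 a1 \<longleftrightarrow> (AE \<omega> in circle.
        a0 \<omega> = of_real \<rho> *s u0 + (\<omega> * of_real (sqrt (1 - \<rho>\<^sup>2))) *s u1 \<and>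
        a1 \<omega> = cis \<theta> *s (of_real (sqrt (1 - \<rho>\<^sup>2)) *s u0 - (\<omega> * of_real \<rho>) *s u1))"
proof -
  have n: "norm u0 = 1" "norm u1 = 1"
    using onb by (auto simp: orthonormal_basis_def)
  have u: "cinner u0 u0 = 1" "cinner u1 u1 = 1" "cinner u0 u1 = 0" "cinner u1 u0 = 0"
    using onb cnj_cinner[of u0 u1] by (auto simp: orthonormal_basis_def cinner_unit)
  have pos: "\<rho>\<^sup>2 < 1"
    using \<rho> by (simp add: abs_square_less_1)
  then have s: "s > 0" "s\<^sup>2 = 1 - \<rho>\<^sup>2"
    by (simp_all add: s_def)
  have N: "defect w = of_real (s\<^sup>2)"
    unfolding w_def defect_scale[OF n(1)] s(2) by simp
  have cis: "cis \<theta> * cnj (cis \<theta>) = 1"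
    by (simp add: cis_cnj cis_mult)
  have "twisted w b b = of_real ((cmod (cis \<theta> * of_real s))\<^sup>2 * (1 + \<rho>\<^sup>2 / (1 - \<rho>\<^sup>2)))"
    unfolding w_def b_def twisted_unit_self[OF n(1) n(1)] by (simp add: u)
  also have "(cmod (cis \<theta> * of_real s))\<^sup>2 * (1 + \<rho>\<^sup>2 / (1 - \<rho>\<^sup>2)) = 1"
    using s pos by (simp add: norm_mult field_simps)
  finally have "twisted w b b = 1" by simp
  moreover have "twisted w y y = defect w"
    unfolding N unfolding w_def y_def twisted_unit_self[OF n(2) n(1)] by (simp add: u)
  ultimately show "realization w y b"
    using \<rho> by (simp add: realization_def twisted_def w_def y_def b_def cinner_scale_left cinner_scale_right u norm_scale n)
  have r: "ratio w y = 0"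
    by (simp add: ratio_def w_def y_def cinner_scale_left cinner_scale_right u)
  have "weight w b * of_real s = - (cis \<theta> * of_real (s * \<rho>) / of_real (s\<^sup>2)) * of_real s"
    unfolding weight_def N by (simp add: w_def b_def cinner_scale_left cinner_scale_right u)
  also have "\<dots> = - (cis \<theta> * of_real \<rho>)"
    using s(1) by (simp add: power2_eq_square)
  finally have q: "weight w b * of_real s = - (cis \<theta> * of_real \<rho>)" .
  have "b + \<omega> *s (weight w b *s y) = cis \<theta> *s (of_real s *s u0 - (\<omega> * of_real \<rho>) *s u1)" for \<omega>
  proof -
    have "b + \<omega> *s (weight w b *s y) = (cis \<theta> * of_real s) *s u0 + (\<omega> * (weight w b * of_real s)) *s u1"
      by (simp add: b_def y_def vector_smult_assoc mult.assoc)
    then show ?thesis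
      unfolding q by (simp add: vec_eq_iff algebra_simps)
  qed
  moreover have "w + \<omega> *s y = of_real \<rho> *s u0 + (\<omega> * of_real s) *s u1" for \<omega>
    by (simp add: w_def y_def vector_smult_assoc)
  ultimately show "realized_by w y b a0 a1 \<longleftrightarrow> (AE \<omega> in circle.
        a0 \<omega> = of_real \<rho> *s u0 + (\<omega> * of_real (sqrt (1 - \<rho>\<^sup>2))) *s u1 \<and>
        a1 \<omega> = cis \<theta> *s (of_real (sqrt (1 - \<rho>\<^sup>2)) *s u0 - (\<omega> * of_real \<rho>) *s u1))"
    unfolding realized_by_def r s_def[symmetric] geometric_kernel_def mult_zero_left diff_zero div_by_1 by (simp only:)
qed

text \<open>Here the weight vanishes, so the second column is constant.\<close>

lemma type4_realization:
  fixes \<rho> \<theta> :: real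
  assumes onb: "orthonormal_basis u0 u1" and \<rho>: "0 < \<rho>" "\<rho> < 1"
  defines "w \<equiv> of_real \<rho> *s u0" and "y \<equiv> (of_real (1 - \<rho>\<^sup>2) * cis \<theta>) *s u0"
  shows "realization w y u1"
    and "realized_by w y u1 a0 a1 \<longleftrightarrow> (AE \<omega> in circle.
        a0 \<omega> = (of_real \<rho> + of_real (1 - \<rho>\<^sup>2) * cis \<theta>
                  * (\<Sum>k. \<omega> ^ Suc k * (- of_real \<rho> * cis \<theta>) ^ k)) *s u0 \<and>
        a1 \<omega> = u1)"
proof -
  have n: "norm u0 = 1" "norm u1 = 1"
    using onb by (auto simp: orthonormal_basis_def)
  have u: "cinner u0 u0 = 1" "cinner u1 u1 = 1" "cinner u0 u1 = 0" "cinner u1 u0 = 0"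
    using onb cnj_cinner[of u0 u1] by (auto simp: orthonormal_basis_def cinner_unit)
  have pos: "\<rho>\<^sup>2 < 1"
    using \<rho> by (simp add: abs_square_less_1)
  have N: "defect w = of_real (1 - \<rho>\<^sup>2)"
    unfolding w_def defect_scale[OF n(1)] by simp
  have "twisted w y y = of_real ((cmod (of_real (1 - \<rho>\<^sup>2) * cis \<theta>))\<^sup>2 * (1 + \<rho>\<^sup>2 / (1 - \<rho>\<^sup>2)))"
    unfolding w_def y_def twisted_unit_self[OF n(1) n(1)] by (simp add: u)
  also have "cmod (of_real (1 - \<rho>\<^sup>2) * cis \<theta>) = 1 - \<rho>\<^sup>2"
    unfolding norm_mult norm_of_real using pos by simp
  also have "(1 - \<rho>\<^sup>2)\<^sup>2 * (1 + \<rho>\<^sup>2 / (1 - \<rho>\<^sup>2)) = 1 - \<rho>\<^sup>2"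
    using pos by (simp add: field_simps power2_eq_square)
  finally have "twisted w y y = defect w"
    by (simp only: N)
  then show R: "realization w y u1"
    using \<rho> by (simp add: realization_def twisted_def w_def y_def cinner_scale_left cinner_scale_right u norm_scale n)
  have "of_real (1 - \<rho>\<^sup>2) \<noteq> (0 :: complex)"
    unfolding of_real_eq_0_iff using pos by simp
  then have r: "ratio w y = - of_real \<rho> * cis \<theta>"
    unfolding ratio_def N unfolding w_def y_def cinner_scale_left cinner_scale_right u by simp
  have q: "weight w u1 = 0"
    by (simp add: weight_def w_def cinner_scale_right u)
  have series: "(\<Sum>k. \<omega> ^ Suc k * (- of_real \<rho> * cis \<theta>) ^ k) = geometric_kernel (ratio w y) \<omega>" if "cmod \<omega> = 1" for \<omega>
    using kernel_series[OF ratio_less_one[OF R] that] unfolding r .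
  show "realized_by w y u1 a0 a1 \<longleftrightarrow> (AE \<omega> in circle.
        a0 \<omega> = (of_real \<rho> + of_real (1 - \<rho>\<^sup>2) * cis \<theta>
                  * (\<Sum>k. \<omega> ^ Suc k * (- of_real \<rho> * cis \<theta>) ^ k)) *s u0 \<and>
        a1 \<omega> = u1)"
    unfolding realized_by_def
  proof (rule AE_circle_cong)
    fix \<omega> :: complex assume \<omega>: "cmod \<omega> = 1"
    have "w + geometric_kernel (ratio w y) \<omega> *s y = (of_real \<rho> + of_real (1 - \<rho>\<^sup>2) * cis \<theta> * geometric_kernel (ratio w y) \<omega>) *s u0"
      unfolding w_def y_def vector_smult_assoc vector_sadd_rdistrib[symmetric] by (simp only: mult_ac)
    then show "(a0 \<omega> = w + geometric_kernel (ratio w y) \<omega> *s y \<and> a1 \<omega> = u1 + geometric_kernel (ratio w y) \<omega> *s (weight w u1 *s y)) \<longleftrightarrow>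
        (a0 \<omega> = (of_real \<rho> + of_real (1 - \<rho>\<^sup>2) * cis \<theta>
                  * (\<Sum>k. \<omega> ^ Suc k * (- of_real \<rho> * cis \<theta>) ^ k)) *s u0 \<and>
        a1 \<omega> = u1)"
      unfolding series[OF \<omega>] q by simp
  qed
qed

text \<open>The three parameter conditions of this type are the three relations of a realization, divided
  by the nonzero scalars.\<close>

lemma type5_realization:
  fixes \<rho>0 \<rho>1 \<tau>0 :: complex
  assumes \<rho>0: "0 < cmod \<rho>0" "cmod \<rho>0 < 1" and n: "norm u0 = 1" "norm u1 = 1" "norm v = 1"
    and nz: "\<rho>1 \<noteq> 0" "\<tau>0 \<noteq> 0"
  defines "c \<equiv> (cmod \<rho>0)\<^sup>2 / (1 - (cmod \<rho>0)\<^sup>2)"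
  shows "realization (\<rho>0 *s u0) (\<rho>1 *s v) (\<tau>0 *s u1) \<longleftrightarrow>
      of_real c * cinner u0 u1 * cinner v u0 + cinner v u1 = 0 \<and>
      (cmod \<rho>1)\<^sup>2 = (1 - (cmod \<rho>0)\<^sup>2) / (1 + c * (cmod (cinner v u0))\<^sup>2) \<and>
      (cmod \<tau>0)\<^sup>2 = 1 / (1 + c * (cmod (cinner u1 u0))\<^sup>2)"
proof -
  have pos: "(cmod \<rho>0)\<^sup>2 < 1"
    using \<rho>0 by (simp add: abs_square_less_1)
  then have c: "c \<ge> 0" by (simp add: c_def)
  then have cp: "1 + c * t\<^sup>2 > 0" for t :: real
    by (simp add: add_pos_nonneg)
  let ?w = "\<rho>0 *s u0"
  have N: "defect ?w = of_real (1 - (cmod \<rho>0)\<^sup>2)"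
    by (rule defect_scale[OF n(1)])
  have "twisted ?w (\<rho>1 *s v) (\<rho>1 *s v) = defect ?w \<longleftrightarrow>
      (cmod \<rho>1)\<^sup>2 * (1 + c * (cmod (cinner v u0))\<^sup>2) = 1 - (cmod \<rho>0)\<^sup>2"
    unfolding N twisted_unit_self[OF n(3) n(1)] c_def of_real_eq_iff ..
  moreover have "twisted ?w (\<tau>0 *s u1) (\<tau>0 *s u1) = 1 \<longleftrightarrow>
      (cmod \<tau>0)\<^sup>2 * (1 + c * (cmod (cinner u1 u0))\<^sup>2) = 1"
    unfolding twisted_unit_self[OF n(2) n(1)] c_def of_real_eq_1_iff ..
  moreover have "twisted ?w (\<tau>0 *s u1) (\<rho>1 *s v) = 0 \<longleftrightarrow>
      of_real c * cinner u0 u1 * cinner v u0 + cinner v u1 = 0"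
  proof -
    have "twisted ?w (\<tau>0 *s u1) (\<rho>1 *s v) = \<tau>0 * cnj \<rho>1 * twisted ?w u1 v"
      by (simp add: twisted_scale_left twisted_scale_right)
    also have "twisted ?w u1 v = cnj (twisted ?w v u1)"
      by (simp add: cnj_twisted)
    finally have "twisted ?w (\<tau>0 *s u1) (\<rho>1 *s v) = 0 \<longleftrightarrow> twisted ?w v u1 = 0"
      using nz by simp
    also have "twisted ?w v u1 = of_real c * cinner u0 u1 * cinner v u0 + cinner v u1"
      unfolding twisted_def N c_def using complex_norm_square[of \<rho>0]
      by (simp add: cinner_scale_left cinner_scale_right mult.commute)
    finally show ?thesis .
  qed
  moreover have "norm ?w < 1"
    using \<rho>0 n by (simp add: norm_scale)
  ultimately show ?thesis
    unfolding realization_def nonzero_eq_divide_eq[OF less_imp_neq[OF cp, symmetric]] by blast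
qed

text \<open>The parameters \<open>r\<close> and \<open>\<tau>1\<close> are \<open>ratio\<close> and the coefficient of \<open>v\<close> in the linear term,
  rewritten by means of the modulus of \<open>\<rho>1\<close> and of the orthogonality relation respectively.\<close>

lemma type5_realized_by:
  fixes \<rho>0 \<rho>1 \<tau>0 :: complex
  assumes \<rho>0: "0 < cmod \<rho>0" "cmod \<rho>0 < 1" and n: "norm u0 = 1" "norm u1 = 1" "norm v = 1"
    and nz: "\<rho>1 \<noteq> 0" and vu0: "cinner v u0 \<noteq> 0"
  defines "c \<equiv> (cmod \<rho>0)\<^sup>2 / (1 - (cmod \<rho>0)\<^sup>2)"
  defines "r \<equiv> - (cnj \<rho>0 / cnj \<rho>1) * (cinner v u0 / of_real (1 + c * (cmod (cinner v u0))\<^sup>2))"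
  defines "\<tau>1 \<equiv> \<tau>0 * (\<rho>1 * cinner u1 v / (\<rho>0 * cinner u0 v))"
  assumes R: "realization (\<rho>0 *s u0) (\<rho>1 *s v) (\<tau>0 *s u1)"
    and orth: "of_real c * cinner u0 u1 * cinner v u0 + cinner v u1 = 0"
    and \<rho>1: "(cmod \<rho>1)\<^sup>2 = (1 - (cmod \<rho>0)\<^sup>2) / (1 + c * (cmod (cinner v u0))\<^sup>2)"
  shows "realized_by (\<rho>0 *s u0) (\<rho>1 *s v) (\<tau>0 *s u1) a0 a1 \<longleftrightarrow> (AE \<omega> in circle.
    a0 \<omega> = \<rho>0 *s u0 + (\<rho>1 * (\<Sum>k. \<omega> ^ Suc k * r ^ k)) *s v \<and>
    a1 \<omega> = \<tau>0 *s u1 + (\<tau>1 * (\<Sum>k. \<omega> ^ Suc k * r ^ k)) *s v)"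
proof -
  let ?w = "\<rho>0 *s u0" and ?y = "\<rho>1 *s v" and ?b = "\<tau>0 *s u1"
  have pos: "(cmod \<rho>0)\<^sup>2 < 1"
    using \<rho>0 by (simp add: abs_square_less_1)
  define N where "N = 1 - (cmod \<rho>0)\<^sup>2"
  define D where "D = 1 + c * (cmod (cinner v u0))\<^sup>2"
  have N0: "N > 0" using pos by (simp add: N_def)
  then have D0: "D > 0" using pos by (simp add: D_def c_def add_pos_nonneg)
  have N: "defect ?w = of_real N"
    unfolding N_def by (rule defect_scale[OF n(1)])
  have "\<rho>1 * cnj \<rho>1 = of_real (N / D)"
    using \<rho>1 complex_norm_square[of \<rho>1] by (simp add: N_def D_def)
  then have ND: "\<rho>1 / of_real N = 1 / (cnj \<rho>1 * of_real D)"
    using N0 D0 nz by (simp add: field_simps)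
  have r: "ratio ?w ?y = r"
  proof -
    have "ratio ?w ?y = - (\<rho>1 / of_real N) * (cnj \<rho>0 * cinner v u0)"
      unfolding ratio_def N by (simp add: cinner_scale_left cinner_scale_right)
    then show ?thesis
      unfolding ND r_def D_def[symmetric] by simp
  qed
  have \<rho>00: "\<rho>0 \<noteq> 0" using \<rho>0 by auto
  have u0v: "cinner u0 v \<noteq> 0"
    using vu0 cnj_cinner[of v u0] by auto
  have q: "weight ?w ?b * \<rho>1 = \<tau>1"
  proof -
    have "cnj (of_real c * cinner u0 u1 * cinner v u0 + cinner v u1) = 0"
      unfolding orth by simp
    then have "cinner u1 v = - (of_real c * cinner u1 u0 * cinner u0 v)"
      by (simp add: cnj_cinner add_eq_0_iff)
    moreover have "complex_of_real c = \<rho>0 * cnj \<rho>0 / of_real N"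
      using complex_norm_square[of \<rho>0] by (simp add: c_def N_def)
    ultimately have "\<tau>1 = - (\<tau>0 * cnj \<rho>0 * cinner u1 u0 / of_real N) * \<rho>1"
      using \<rho>00 u0v by (simp add: \<tau>1_def)
    then show ?thesis
      unfolding weight_def N by (simp add: cinner_scale_left cinner_scale_right)
  qed
  show ?thesis
    unfolding realized_by_def r
  proof (rule AE_circle_cong)
    fix \<omega> :: complex assume \<omega>: "cmod \<omega> = 1"
    have series: "(\<Sum>k. \<omega> ^ Suc k * r ^ k) = geometric_kernel r \<omega>"
      using kernel_series[OF ratio_less_one[OF R] \<omega>] unfolding r .
    have "geometric_kernel r \<omega> *s (weight ?w ?b *s ?y) = (weight ?w ?b * \<rho>1 * geometric_kernel r \<omega>) *s v"
      unfolding vector_smult_assoc by (simp only: mult.commute)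
    moreover have "geometric_kernel r \<omega> *s ?y = (\<rho>1 * geometric_kernel r \<omega>) *s v"
      unfolding vector_smult_assoc by (simp only: mult.commute)
    ultimately show "(a0 \<omega> = ?w + geometric_kernel r \<omega> *s ?y \<and> a1 \<omega> = ?b + geometric_kernel r \<omega> *s (weight ?w ?b *s ?y)) \<longleftrightarrow>
      (a0 \<omega> = ?w + (\<rho>1 * (\<Sum>k. \<omega> ^ Suc k * r ^ k)) *s v \<and>
       a1 \<omega> = ?b + (\<tau>1 * (\<Sum>k. \<omega> ^ Suc k * r ^ k)) *s v)"
      unfolding series q by (simp only:)
  qed
qed

lemma unit_direction:
  assumes "x \<noteq> (0 :: complex^2)"
  obtains u where "norm u = 1" "x = of_real (norm x) *s u"
proof
  show "norm (of_real (1 / norm x) *s x) = 1"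
    using assms by (simp add: norm_scale norm_divide)
  show "x = of_real (norm x) *s (of_real (1 / norm x) *s x)"
    using assms by (simp add: vector_smult_assoc)
qed

lemma complex_eq_modulus_cis: "z = of_real (cmod z) * cis (Arg z)"
  using rcis_cmod_Arg[of z] by (simp add: rcis_def)

lemma norm_eq_1_if_cinner: "cinner x x = 1 \<Longrightarrow> norm x = 1"
proof -
  assume "cinner x x = 1"
  then have "(norm x)\<^sup>2 = 1"
    unfolding cinner_self of_real_eq_1_iff .
  then show "norm x = 1"
    using norm_ge_zero[of x] by (simp add: power2_eq_1_iff del: norm_ge_zero)
qed

lemma realization_type2:
  assumes R: "realization 0 y b"
  shows "orthonormal_basis y b"
proof -
  have "cinner y y = 1" "cinner b b = 1" "cinner b y = 0"
    using R by (auto simp: realization_def twisted_def defect_def cinner_zero_left cinner_zero_right)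
  then show ?thesis
    using cnj_cinner[of b y] by (simp add: orthonormal_basis_iff norm_eq_1_if_cinner)
qed

lemma twisted_multiple_of_base:
  assumes "norm w < 1"
  shows "twisted w (t *s w) (t *s w) = of_real ((cmod t * norm w)\<^sup>2) / defect w"
proof -
  have "twisted w (t *s w) (t *s w) = t * cnj t * twisted w w w"
    by (simp add: twisted_scale_left twisted_scale_right)
  also have "t * cnj t = of_real ((cmod t)\<^sup>2)"
    by (rule complex_norm_square[symmetric])
  also have "twisted w w w = cinner w w / defect w"
    using defect_nonzero[OF assms] by (simp add: twisted_def defect_alt field_simps)
  finally show ?thesis
    by (simp add: cinner_self power_mult_distrib)
qed

text \<open>Both \<open>w\<close> and \<open>b\<close> are orthogonal to \<open>y\<close>, hence parallel; the norms follow from the twisted norms,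
  and the argument of the proportionality factor is the free angle.\<close>

lemma realization_type3:
  assumes R: "realization w y b" and w: "w \<noteq> 0" and yw: "cinner y w = 0"
  shows "\<exists>u0 u1 (\<rho>::real) \<theta>. orthonormal_basis u0 u1 \<and> 0 < \<rho> \<and> \<rho> < 1 \<and> w = of_real \<rho> *s u0 \<and>
    y = of_real (sqrt (1 - \<rho>\<^sup>2)) *s u1 \<and> b = (cis \<theta> * of_real (sqrt (1 - \<rho>\<^sup>2))) *s u0"
proof -
  have w1: "norm w < 1" and yy: "twisted w y y = defect w" and bb: "twisted w b b = 1" and bY: "twisted w b y = 0"
    using R by (auto simp: realization_def)
  have wy: "cinner w y = 0"
    using yw cnj_cinner[of y w] by simp
  obtain u0 where u0: "norm u0 = 1" "w = of_real (norm w) *s u0"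
    using unit_direction[OF w] .
  define \<rho> where "\<rho> = norm w"
  define s where "s = sqrt (1 - \<rho>\<^sup>2)"
  have \<rho>: "0 < \<rho>" "\<rho> < 1" "\<rho>\<^sup>2 < 1"
    using w w1 by (auto simp: \<rho>_def abs_square_less_1)
  then have s: "s > 0" "s\<^sup>2 = 1 - \<rho>\<^sup>2" by (simp_all add: s_def)
  have "complex_of_real ((norm y)\<^sup>2) = of_real (s\<^sup>2)"
    using yy by (simp add: twisted_def wy cinner_self defect_def s(2) \<rho>_def)
  then have ny: "norm y = s"
    using s(1) by (simp only: of_real_eq_iff power2_eq_iff_nonneg norm_ge_zero less_imp_le)
  then have "y \<noteq> 0" using s by auto
  then obtain u1 where u1: "norm u1 = 1" "y = of_real s *s u1"
    using unit_direction ny by metis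
  have "cinner b y = 0"
    using bY by (simp add: twisted_def wy)
  then obtain t where t: "b = t *s w"
    using common_orthogonal_parallel[OF _ wy \<open>y \<noteq> 0\<close> w] by blast
  have "of_real ((cmod t * \<rho>)\<^sup>2) / complex_of_real (s\<^sup>2) = 1"
    using bb twisted_multiple_of_base[OF w1, of t] by (simp add: t defect_def s(2) \<rho>_def)
  then have "complex_of_real ((cmod t * \<rho>)\<^sup>2) = of_real (s\<^sup>2)"
    using s(1) by simp
  then have "cmod t * \<rho> = s"
    using s(1) \<rho>(1) unfolding of_real_eq_iff by (simp add: power2_eq_iff_nonneg)
  then have "t * of_real \<rho> = cis (Arg t) * of_real s"
    using complex_eq_modulus_cis[of t] by (metis mult.assoc mult.commute of_real_mult)
  then have b: "b = (cis (Arg t) * of_real s) *s u0"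
    using u0(2) t by (metis \<rho>_def vector_smult_assoc)
  have "cinner u0 u1 = 0"
    using wy s(1) \<rho>(1) u0(2) u1(2) unfolding \<rho>_def
    by (metis cinner_scale_left cinner_scale_right complex_cnj_complex_of_real mult_eq_0_iff of_real_eq_0_iff less_irrefl)
  then show ?thesis
    unfolding orthonormal_basis_iff using u0[folded \<rho>_def] u1[unfolded s_def] \<rho> b[unfolded s_def] by blast
qed

text \<open>Both \<open>w\<close> and \<open>y\<close> are orthogonal to \<open>b\<close>, hence parallel, again with a free angle.\<close>

lemma realization_type4:
  assumes R: "realization w y b" and w: "w \<noteq> 0" and bw: "cinner b w = 0"
  shows "\<exists>u0 (\<rho>::real) \<theta>. orthonormal_basis u0 b \<and> 0 < \<rho> \<and> \<rho> < 1 \<and> w = of_real \<rho> *s u0 \<and>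
    y = (of_real (1 - \<rho>\<^sup>2) * cis \<theta>) *s u0"
proof -
  have w1: "norm w < 1" and yy: "twisted w y y = defect w" and bb: "twisted w b b = 1" and bY: "twisted w b y = 0"
    using R by (auto simp: realization_def)
  have wb: "cinner w b = 0"
    using bw cnj_cinner[of b w] by simp
  have N: "defect w \<noteq> 0" using defect_nonzero[OF w1] .
  obtain u0 where u0: "norm u0 = 1" "w = of_real (norm w) *s u0"
    using unit_direction[OF w] .
  define \<rho> where "\<rho> = norm w"
  have \<rho>: "0 < \<rho>" "\<rho> < 1" "\<rho>\<^sup>2 < 1"
    using w w1 by (auto simp: \<rho>_def abs_square_less_1)
  have "cinner b b = 1" "cinner b y = 0"
    using bb bY by (simp_all add: twisted_def bw)
  then have nb: "norm b = 1" and "cinner y b = 0" and "b \<noteq> 0"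
    using cnj_cinner[of b y] norm_eq_1_if_cinner by (auto simp: cinner_zero_left)
  then obtain t where t: "y = t *s w"
    using common_orthogonal_parallel[OF _ wb _ w] by blast
  have "complex_of_real ((cmod t * \<rho>)\<^sup>2) = of_real ((1 - \<rho>\<^sup>2)\<^sup>2)"
  proof -
    have "of_real ((cmod t * \<rho>)\<^sup>2) / defect w = defect w"
      using yy twisted_multiple_of_base[OF w1, of t] by (simp add: t \<rho>_def)
    then have "of_real ((cmod t * \<rho>)\<^sup>2) = defect w * defect w"
      using N by (simp add: field_simps)
    then show ?thesis
      by (simp add: defect_def \<rho>_def power2_eq_square)
  qed
  then have "cmod t * \<rho> = 1 - \<rho>\<^sup>2"
    using \<rho> unfolding of_real_eq_iff by (simp add: power2_eq_iff_nonneg)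
  then have "t * of_real \<rho> = of_real (1 - \<rho>\<^sup>2) * cis (Arg t)"
    using complex_eq_modulus_cis[of t] by (metis mult.assoc mult.commute of_real_mult)
  then have y: "y = (of_real (1 - \<rho>\<^sup>2) * cis (Arg t)) *s u0"
    using u0(2) t by (metis \<rho>_def vector_smult_assoc)
  have "cinner u0 b = 0"
    using wb w u0(2) by (metis cinner_scale_left mult_eq_0_iff of_real_eq_0_iff norm_eq_zero)
  then show ?thesis
    unfolding orthonormal_basis_iff using u0[folded \<rho>_def] nb \<rho> y by blast
qed

text \<open>The last type collects the triples for which neither \<open>w\<close> nor one of the two inner products with
  \<open>w\<close> vanishes. Its three scalars can be chosen positive, all phases going into the unit vectors.\<close>

lemma realization_imp_types:
  assumes R: "realization w y b" and f: "realized_by w y b a0 a1"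
  shows "type2 a0 a1 \<or> type3 a0 a1 \<or> type4 a0 a1 \<or> type5 a0 a1"
proof -
  consider "w = 0" | "w \<noteq> 0" "cinner y w = 0" | "w \<noteq> 0" "cinner b w = 0"
    | "w \<noteq> 0" "cinner y w \<noteq> 0" "cinner b w \<noteq> 0" by blast
  then show ?thesis
  proof cases
    case 1
    then have onb: "orthonormal_basis y b"
      using R realization_type2 by simp
    then have "type2 a0 a1"
      using f type2_realization(2)[OF onb] 1 unfolding type2_def by blast
    then show ?thesis by simp
  next
    case 2
    obtain u0 u1 and \<rho> \<theta> :: real where onb: "orthonormal_basis u0 u1" and \<rho>: "0 < \<rho>" "\<rho> < 1"
      and eq: "w = of_real \<rho> *s u0" "y = of_real (sqrt (1 - \<rho>\<^sup>2)) *s u1"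
        "b = (cis \<theta> * of_real (sqrt (1 - \<rho>\<^sup>2))) *s u0"
      using realization_type3[OF R 2] by blast
    have "type3 a0 a1"
      using f onb \<rho> unfolding eq type3_realization(2)[OF onb \<rho>] type3_def by blast
    then show ?thesis by simp
  next
    case 3
    obtain u0 and \<rho> \<theta> :: real where onb: "orthonormal_basis u0 b" and \<rho>: "0 < \<rho>" "\<rho> < 1"
      and eq: "w = of_real \<rho> *s u0" "y = (of_real (1 - \<rho>\<^sup>2) * cis \<theta>) *s u0"
      using realization_type4[OF R 3] by blast
    have "type4 a0 a1"
      using f onb \<rho> unfolding eq type4_realization(2)[OF onb \<rho>] type4_def by blast
    then show ?thesis by simp
  next
    case 4
    then have "y \<noteq> 0" "b \<noteq> 0"
      by (auto simp: cinner_zero_left)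
    obtain u0 where u0: "norm u0 = 1" "w = of_real (norm w) *s u0"
      using unit_direction[OF 4(1)] .
    obtain v where v: "norm v = 1" "y = of_real (norm y) *s v"
      using unit_direction[OF \<open>y \<noteq> 0\<close>] .
    obtain u1 where u1: "norm u1 = 1" "b = of_real (norm b) *s u1"
      using unit_direction[OF \<open>b \<noteq> 0\<close>] .
    define \<rho>0 \<rho>1 \<tau>0 where "\<rho>0 = complex_of_real (norm w)"
      and "\<rho>1 = complex_of_real (norm y)" and "\<tau>0 = complex_of_real (norm b)"
    note eq = u0(2)[folded \<rho>0_def] v(2)[folded \<rho>1_def] u1(2)[folded \<tau>0_def]
    have nz: "\<rho>1 \<noteq> 0" "\<tau>0 \<noteq> 0" and \<rho>0: "0 < cmod \<rho>0" "cmod \<rho>0 < 1"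
      using \<open>y \<noteq> 0\<close> \<open>b \<noteq> 0\<close> 4(1) R by (auto simp: \<rho>0_def \<rho>1_def \<tau>0_def realization_def)
    have "cinner y w = \<rho>1 * cnj \<rho>0 * cinner v u0" "cinner b w = \<tau>0 * cnj \<rho>0 * cinner u1 u0"
      by (subst eq(1), subst eq, simp add: cinner_scale_left cinner_scale_right)+
    with 4 have inner: "cinner v u0 \<noteq> 0" "cinner u1 u0 \<noteq> 0"
      by auto
    have R': "realization (\<rho>0 *s u0) (\<rho>1 *s v) (\<tau>0 *s u1)"
      and f': "realized_by (\<rho>0 *s u0) (\<rho>1 *s v) (\<tau>0 *s u1) a0 a1"
      using R f eq by simp_all
    note conds = R'[unfolded type5_realization[OF \<rho>0 u0(1) u1(1) v(1) nz]]
    have "type5 a0 a1"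
      unfolding type5_def Let_def
      using \<rho>0 u0(1) u1(1) v(1) inner conds
        f'[unfolded type5_realized_by[OF \<rho>0 u0(1) u1(1) v(1) nz(1) inner(1) R' conds[THEN conjunct1]
          conds[THEN conjunct2, THEN conjunct1]]]
      by blast
    then show ?thesis by simp
  qed
qed

lemma types_imp_realization:
  assumes "type2 a0 a1 \<or> type3 a0 a1 \<or> type4 a0 a1 \<or> type5 a0 a1"
  obtains w y b where "realization w y b" "realized_by w y b a0 a1"
  using assms
proof (elim disjE)
  assume "type2 a0 a1"
  then show thesis
    unfolding type2_def using type2_realization that by blast
next
  assume "type3 a0 a1"
  then obtain u0 u1 and \<rho> \<theta> :: real where onb: "orthonormal_basis u0 u1" and \<rho>: "0 < \<rho>" "\<rho> < 1"
    and AE: "AE \<omega> in circle.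
        a0 \<omega> = of_real \<rho> *s u0 + (\<omega> * of_real (sqrt (1 - \<rho>\<^sup>2))) *s u1 \<and>
        a1 \<omega> = cis \<theta> *s (of_real (sqrt (1 - \<rho>\<^sup>2)) *s u0 - (\<omega> * of_real \<rho>) *s u1)"
    unfolding type3_def by blast
  show thesis
    by (rule that[OF type3_realization(1)[OF onb \<rho>] type3_realization(2)[OF onb \<rho>, THEN iffD2, OF AE]])
next
  assume "type4 a0 a1"
  then obtain u0 u1 and \<rho> \<theta> :: real where onb: "orthonormal_basis u0 u1" and \<rho>: "0 < \<rho>" "\<rho> < 1"
    and AE: "AE \<omega> in circle.
        a0 \<omega> = (of_real \<rho> + of_real (1 - \<rho>\<^sup>2) * cis \<theta>
                  * (\<Sum>k. \<omega> ^ Suc k * (- of_real \<rho> * cis \<theta>) ^ k)) *s u0 \<and>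
        a1 \<omega> = u1"
    unfolding type4_def by blast
  show thesis
    by (rule that[OF type4_realization(1)[OF onb \<rho>] type4_realization(2)[OF onb \<rho>, THEN iffD2, OF AE]])
next
  assume "type5 a0 a1"
  then obtain \<rho>0 \<rho>1 \<tau>0 u0 u1 v where \<rho>0: "0 < cmod \<rho>0" "cmod \<rho>0 < 1"
    and n: "norm u0 = 1" "norm u1 = 1" "norm v = 1" and vu0: "cinner v u0 \<noteq> 0"
    and orth: "of_real ((cmod \<rho>0)\<^sup>2 / (1 - (cmod \<rho>0)\<^sup>2)) * cinner u0 u1 * cinner v u0 + cinner v u1 = 0"
    and \<rho>1: "(cmod \<rho>1)\<^sup>2 = (1 - (cmod \<rho>0)\<^sup>2) / (1 + (cmod \<rho>0)\<^sup>2 / (1 - (cmod \<rho>0)\<^sup>2) * (cmod (cinner v u0))\<^sup>2)"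
    and \<tau>0: "(cmod \<tau>0)\<^sup>2 = 1 / (1 + (cmod \<rho>0)\<^sup>2 / (1 - (cmod \<rho>0)\<^sup>2) * (cmod (cinner u1 u0))\<^sup>2)"
    and AE: "AE \<omega> in circle.
      a0 \<omega> = \<rho>0 *s u0 + (\<rho>1 * (\<Sum>k. \<omega> ^ Suc k * (- (cnj \<rho>0 / cnj \<rho>1) * (cinner v u0 /
        of_real (1 + (cmod \<rho>0)\<^sup>2 / (1 - (cmod \<rho>0)\<^sup>2) * (cmod (cinner v u0))\<^sup>2))) ^ k)) *s v \<and>
      a1 \<omega> = \<tau>0 *s u1 + (\<tau>0 * (\<rho>1 * cinner u1 v / (\<rho>0 * cinner u0 v)) *
        (\<Sum>k. \<omega> ^ Suc k * (- (cnj \<rho>0 / cnj \<rho>1) * (cinner v u0 /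
        of_real (1 + (cmod \<rho>0)\<^sup>2 / (1 - (cmod \<rho>0)\<^sup>2) * (cmod (cinner v u0))\<^sup>2))) ^ k)) *s v"
    unfolding type5_def Let_def by (elim exE conjE) (rule that)
  have pos: "1 - (cmod \<rho>0)\<^sup>2 > 0"
    using \<rho>0 by (simp add: abs_square_less_1)
  have den: "1 + (cmod \<rho>0)\<^sup>2 / (1 - (cmod \<rho>0)\<^sup>2) * t\<^sup>2 > 0" for t
    using pos by (intro add_pos_nonneg) auto
  have nz: "\<rho>1 \<noteq> 0" "\<tau>0 \<noteq> 0"
    using divide_pos_pos[OF pos den, of "cmod (cinner v u0)"] \<rho>1
      divide_pos_pos[OF zero_less_one den, of "cmod (cinner u1 u0)"] \<tau>0 by auto
  have R: "realization (\<rho>0 *s u0) (\<rho>1 *s v) (\<tau>0 *s u1)"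
    unfolding type5_realization[OF \<rho>0 n nz] using orth \<rho>1 \<tau>0 by blast
  show thesis
    by (rule that[OF R type5_realized_by[OF \<rho>0 n nz(1) vu0 R orth \<rho>1, THEN iffD2, OF AE]])
qed

section \<open>Orthonormal systems on the line\<close>

definition sqnorm :: "(real \<Rightarrow> complex) \<Rightarrow> real"
  where "sqnorm f = (\<integral>x. (cmod (f x))\<^sup>2 \<partial>lborel)"

lemma cmod_add_square_le: "(cmod (x + y))\<^sup>2 \<le> 2 * (cmod x)\<^sup>2 + 2 * (cmod y)\<^sup>2"
  using norm_diff_square_le[of x "- y" 0] by simp

lemma borel_measurable_cnj:
  assumes "f \<in> borel_measurable M"
  shows "(\<lambda>x. cnj (f x)) \<in> borel_measurable M"
proof (rule measurable_compose[OF assms])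
  show "cnj \<in> borel_measurable borel"
    by (rule borel_measurable_continuous_onI) (rule continuous_on_cnj[OF continuous_on_id])
qed

lemma integrable_mult_cnj:
  assumes "square_integrable lborel f" "square_integrable lborel g"
  shows "integrable lborel (\<lambda>x. f x * cnj (g x))"
proof (rule Bochner_Integration.integrable_bound)
  show "integrable lborel (\<lambda>x. (cmod (f x))\<^sup>2 + (cmod (g x))\<^sup>2)"
    using assms by (auto simp: square_integrable_def)
  show "(\<lambda>x. f x * cnj (g x)) \<in> borel_measurable lborel"
    using assms unfolding square_integrable_def
    by (intro borel_measurable_times borel_measurable_cnj) auto
  have "cmod (f x) * cmod (g x) \<le> (cmod (f x))\<^sup>2 + (cmod (g x))\<^sup>2" for x
    using sum_squares_bound[of "cmod (f x)" "cmod (g x)"] mult_nonneg_nonneg[of "cmod (f x)" "cmod (g x)"]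
      norm_ge_zero[of "f x"] norm_ge_zero[of "g x"] by linarith
  then show "AE x in lborel. norm (f x * cnj (g x)) \<le> norm ((cmod (f x))\<^sup>2 + (cmod (g x))\<^sup>2)"
    by (auto simp: norm_mult)
qed

lemma square_integrable_add:
  assumes "square_integrable lborel f" "square_integrable lborel g"
  shows "square_integrable lborel (\<lambda>x. f x + g x :: complex)"
  unfolding square_integrable_def
proof
  show m: "(\<lambda>x. f x + g x) \<in> borel_measurable lborel"
    using assms by (auto simp: square_integrable_def)
  show "integrable lborel (\<lambda>x. (cmod (f x + g x))\<^sup>2)"
  proof (rule Bochner_Integration.integrable_bound)
    show "integrable lborel (\<lambda>x. 2 * (cmod (f x))\<^sup>2 + 2 * (cmod (g x))\<^sup>2)"
      using assms by (auto simp: square_integrable_def)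
    show "(\<lambda>x. (cmod (f x + g x))\<^sup>2) \<in> borel_measurable lborel"
      using m by measurable
  qed (use cmod_add_square_le in auto)
qed

lemma square_integrable_cmult:
  "square_integrable lborel f \<Longrightarrow> square_integrable lborel (\<lambda>x. c * f x :: complex)"
  by (auto simp: square_integrable_def norm_mult power_mult_distrib)

lemma square_integrable_diff:
  assumes "square_integrable lborel f" "square_integrable lborel g"
  shows "square_integrable lborel (\<lambda>x. f x - g x :: complex)"
  using square_integrable_add[OF assms(1) square_integrable_cmult[OF assms(2), of "-1"]] by simp

lemma square_integrable_zero: "square_integrable lborel (\<lambda>x. 0 :: complex)"
  by (simp add: square_integrable_def)

lemma square_integrable_sum:
  assumes "\<And>i. i \<in> F \<Longrightarrow> square_integrable lborel (f i)"
  shows "square_integrable lborel (\<lambda>x. \<Sum>i\<in>F. f i x :: complex)"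
  using assms
  by (induction F rule: infinite_finite_induct)
     (auto intro: square_integrable_add square_integrable_zero)

lemma L2_inner_add_left:
  assumes "square_integrable lborel f" "square_integrable lborel g" "square_integrable lborel h"
  shows "L2_inner (\<lambda>x. f x + g x) h = L2_inner f h + L2_inner g h"
  unfolding L2_inner_def distrib_right
  by (rule Bochner_Integration.integral_add) (auto intro: integrable_mult_cnj assms)

lemma L2_inner_cmult_left: "L2_inner (\<lambda>x. c * f x) h = c * L2_inner f h"
  unfolding L2_inner_def by (simp add: mult.assoc)

lemma L2_inner_diff_left:
  assumes "square_integrable lborel f" "square_integrable lborel g" "square_integrable lborel h"
  shows "L2_inner (\<lambda>x. f x - g x) h = L2_inner f h - L2_inner g h"
  unfolding L2_inner_def left_diff_distrib
  by (rule Bochner_Integration.integral_diff) (auto intro: integrable_mult_cnj assms)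

lemma L2_inner_commute: "L2_inner g f = cnj (L2_inner f g)"
  unfolding L2_inner_def
  by (subst Bochner_Integration.integral_cnj[symmetric])
     (simp only: mult.commute complex_cnj_mult complex_cnj_cnj)

lemma L2_inner_self: "L2_inner f f = of_real (sqnorm f)"
  unfolding L2_inner_def sqnorm_def integral_complex_of_real[symmetric]
  by (simp add: complex_norm_square[symmetric] del: complex_norm_square of_real_power)

lemma L2_inner_cmult_right: "L2_inner f (\<lambda>x. c * h x) = cnj c * L2_inner f h"
  unfolding L2_inner_def by (simp add: mult.left_commute)

lemma sqnorm_nonneg: "0 \<le> sqnorm f"
  by (simp add: sqnorm_def)

lemma sqnorm_cmult: "sqnorm (\<lambda>x. c * f x) = (cmod c)\<^sup>2 * sqnorm f"
  by (simp add: sqnorm_def norm_mult power_mult_distrib)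

lemma sqnorm_add_le:
  assumes "square_integrable lborel f" "square_integrable lborel g"
  shows "sqnorm (\<lambda>x. f x + g x) \<le> 2 * sqnorm f + 2 * sqnorm g"
proof -
  have "sqnorm (\<lambda>x. f x + g x) \<le> (\<integral>x. 2 * (cmod (f x))\<^sup>2 + 2 * (cmod (g x))\<^sup>2 \<partial>lborel)"
    unfolding sqnorm_def using assms square_integrable_add[OF assms]
    by (intro integral_mono cmod_add_square_le) (auto simp: square_integrable_def)
  also have "\<dots> = 2 * sqnorm f + 2 * sqnorm g"
    using assms by (simp add: sqnorm_def square_integrable_def)
  finally show ?thesis .
qed

definition orthonormal_system :: "('i \<Rightarrow> real \<Rightarrow> complex) \<Rightarrow> bool"
  where "orthonormal_system e \<longleftrightarrow> (\<forall>i. square_integrable lborel (e i)) \<and>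
    (\<forall>i j. L2_inner (e i) (e j) = of_bool (i = j))"

definition residual :: "('i \<Rightarrow> real \<Rightarrow> complex) \<Rightarrow> 'i set \<Rightarrow> (real \<Rightarrow> complex) \<Rightarrow> real \<Rightarrow> complex"
  where "residual e F f = (\<lambda>x. f x - (\<Sum>i\<in>F. L2_inner f (e i) * e i x))"

lemma square_integrable_residual:
  assumes "orthonormal_system e" "square_integrable lborel f"
  shows "square_integrable lborel (residual e F f)"
  unfolding residual_def using assms
  by (intro square_integrable_diff square_integrable_sum square_integrable_cmult)
     (auto simp: orthonormal_system_def)

text \<open>Subtracting one component after the other, each step is Pythagoras and leaves the remaining
  coefficients unchanged.\<close>

lemma residual_orthogonal_and_sqnorm:
  assumes e: "orthonormal_system e" and f: "square_integrable lborel f" and "finite F"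
  shows "(\<forall>j. j \<notin> F \<longrightarrow> L2_inner (residual e F f) (e j) = L2_inner f (e j)) \<and>
    sqnorm (residual e F f) = sqnorm f - (\<Sum>i\<in>F. (cmod (L2_inner f (e i)))\<^sup>2)"
  using \<open>finite F\<close>
proof (induction F)
  case empty
  show ?case by (simp add: residual_def)
next
  case (insert i F)
  let ?g = "residual e F f" and ?c = "L2_inner f (e i)"
  have g: "square_integrable lborel ?g"
    using e f by (rule square_integrable_residual)
  have ei: "square_integrable lborel (e j)" for j
    using e by (simp add: orthonormal_system_def)
  have on: "L2_inner (e j) (e k) = of_bool (j = k)" for j k
    using e by (simp add: orthonormal_system_def)
  have eq: "residual e (insert i F) f = (\<lambda>x. ?g x - ?c * e i x)"
    using insert by (simp add: residual_def fun_eq_iff)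
  have ci: "L2_inner ?g (e i) = ?c"
    using insert by simp
  have left: "L2_inner (\<lambda>x. ?g x - ?c * e i x) h = L2_inner ?g h - ?c * L2_inner (e i) h"
    if "square_integrable lborel h" for h
    using that by (subst L2_inner_diff_left) (auto simp: g ei square_integrable_cmult L2_inner_cmult_left)
  have sq: "square_integrable lborel (\<lambda>x. ?g x - ?c * e i x)"
    using g ei by (intro square_integrable_diff square_integrable_cmult)
  have "of_real (sqnorm (\<lambda>x. ?g x - ?c * e i x)) =
      L2_inner ?g (\<lambda>x. ?g x - ?c * e i x) - ?c * L2_inner (e i) (\<lambda>x. ?g x - ?c * e i x)"
    unfolding L2_inner_self[symmetric] by (rule left[OF sq])
  also have "L2_inner ?g (\<lambda>x. ?g x - ?c * e i x) = of_real (sqnorm ?g) - cnj ?c * ?c"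
    by (subst L2_inner_commute) (simp add: left[OF g] L2_inner_self L2_inner_commute[of "e i" ?g] ci)
  also have "L2_inner (e i) (\<lambda>x. ?g x - ?c * e i x) = 0"
    by (subst L2_inner_commute) (simp add: left[OF ei] ci on)
  finally have "sqnorm (\<lambda>x. ?g x - ?c * e i x) = sqnorm ?g - (cmod ?c)\<^sup>2"
    by (simp add: mult.commute[of "cnj _"] complex_norm_square[symmetric] flip: of_real_diff
          del: complex_norm_square of_real_power)
  with insert show ?case
    by (auto simp: eq left[OF ei] on)
qed

lemmas sqnorm_residual = residual_orthogonal_and_sqnorm[THEN conjunct2]

lemma Bessel:
  assumes "orthonormal_system e" "square_integrable lborel f" "finite F"
  shows "(\<Sum>i\<in>F. (cmod (L2_inner f (e i)))\<^sup>2) \<le> sqnorm f"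
  using sqnorm_residual[OF assms] sqnorm_nonneg[of "residual e F f"] by simp

text \<open>Membership in the closed span of the system. The best approximations on finite index sets are
  used instead of arbitrary combinations, because they depend linearly on \<open>f\<close> and their errors
  decrease with the index set.\<close>

definition approximable :: "('i \<Rightarrow> real \<Rightarrow> complex) \<Rightarrow> (real \<Rightarrow> complex) \<Rightarrow> bool"
  where "approximable e f \<longleftrightarrow> square_integrable lborel f \<and>
    (\<forall>\<epsilon>>0. \<exists>F. finite F \<and> sqnorm (residual e F f) < \<epsilon>)"

lemma Parseval_if_approximable:
  assumes e: "orthonormal_system e" and f: "approximable e f"
  shows "((\<lambda>i. (cmod (L2_inner f (e i)))\<^sup>2) has_sum sqnorm f) UNIV"
  unfolding has_sum_def tendsto_iff eventually_finite_subsets_at_top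
proof (intro allI impI)
  fix \<epsilon> :: real assume "\<epsilon> > 0"
  have sq: "square_integrable lborel f"
    using f by (simp add: approximable_def)
  from f \<open>\<epsilon> > 0\<close> obtain F where F: "finite F" "sqnorm (residual e F f) < \<epsilon>"
    by (auto simp: approximable_def)
  show "\<exists>X. finite X \<and> X \<subseteq> UNIV \<and> (\<forall>Y. finite Y \<and> X \<subseteq> Y \<and> Y \<subseteq> UNIV \<longrightarrow>
      dist (\<Sum>i\<in>Y. (cmod (L2_inner f (e i)))\<^sup>2) (sqnorm f) < \<epsilon>)"
  proof (intro exI conjI allI impI)
    fix Y assume Y: "finite Y \<and> F \<subseteq> Y \<and> Y \<subseteq> UNIV"
    then have "(\<Sum>i\<in>F. (cmod (L2_inner f (e i)))\<^sup>2) \<le> (\<Sum>i\<in>Y. (cmod (L2_inner f (e i)))\<^sup>2)"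
      by (intro sum_mono2) auto
    with F sqnorm_residual[OF e sq F(1)] Bessel[OF e sq, of Y] Y
    show "dist (\<Sum>i\<in>Y. (cmod (L2_inner f (e i)))\<^sup>2) (sqnorm f) < \<epsilon>"
      by (simp add: dist_real_def)
  qed (use F in auto)
qed

lemma sqnorm_residual_antimono:
  assumes "orthonormal_system e" "square_integrable lborel f" "finite G" "F \<subseteq> G"
  shows "sqnorm (residual e G f) \<le> sqnorm (residual e F f)"
proof -
  have "(\<Sum>i\<in>F. (cmod (L2_inner f (e i)))\<^sup>2) \<le> (\<Sum>i\<in>G. (cmod (L2_inner f (e i)))\<^sup>2)"
    using assms by (intro sum_mono2) auto
  then show ?thesis
    using assms finite_subset[OF assms(4,3)] by (simp add: sqnorm_residual)
qed

lemma residual_add: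
  assumes "orthonormal_system e" "square_integrable lborel f" "square_integrable lborel g"
  shows "residual e F (\<lambda>x. f x + g x) = (\<lambda>x. residual e F f x + residual e F g x)"
  using assms
  by (simp add: residual_def L2_inner_add_left orthonormal_system_def sum.distrib algebra_simps)

lemma approximable_add:
  assumes e: "orthonormal_system e" and "approximable e f" "approximable e g"
  shows "approximable e (\<lambda>x. f x + g x)"
  unfolding approximable_def
proof (intro conjI allI impI)
  have f: "square_integrable lborel f" and g: "square_integrable lborel g"
    using assms by (auto simp: approximable_def)
  then show "square_integrable lborel (\<lambda>x. f x + g x)"
    by (rule square_integrable_add)
  fix \<epsilon> :: real assume "\<epsilon> > 0"
  then have "\<epsilon> / 4 > 0" by simp
  with assms obtain F G where F: "finite F" "sqnorm (residual e F f) < \<epsilon> / 4"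
    and G: "finite G" "sqnorm (residual e G g) < \<epsilon> / 4"
    unfolding approximable_def by meson
  have "sqnorm (residual e (F \<union> G) f) < \<epsilon> / 4"
    using F G sqnorm_residual_antimono[OF e f, of "F \<union> G" F] by auto
  moreover have "sqnorm (residual e (F \<union> G) g) < \<epsilon> / 4"
    using F G sqnorm_residual_antimono[OF e g, of "F \<union> G" G] by auto
  moreover have "sqnorm (residual e (F \<union> G) (\<lambda>x. f x + g x)) \<le>
      2 * sqnorm (residual e (F \<union> G) f) + 2 * sqnorm (residual e (F \<union> G) g)"
    unfolding residual_add[OF e f g]
    using e f g by (intro sqnorm_add_le square_integrable_residual)
  ultimately have "sqnorm (residual e (F \<union> G) (\<lambda>x. f x + g x)) < \<epsilon>"
    by linarith
  with F G show "\<exists>F. finite F \<and> sqnorm (residual e F (\<lambda>x. f x + g x)) < \<epsilon>"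
    by blast
qed

lemma approximable_cmult:
  assumes "approximable e f"
  shows "approximable e (\<lambda>x. c * f x)"
  unfolding approximable_def
proof (intro conjI allI impI)
  show "square_integrable lborel (\<lambda>x. c * f x)"
    using assms by (simp add: approximable_def square_integrable_cmult)
  fix \<epsilon> :: real assume "\<epsilon> > 0"
  then have "\<epsilon> / ((cmod c)\<^sup>2 + 1) > 0"
    by (simp add: add_nonneg_pos)
  with assms obtain F where F: "finite F" "sqnorm (residual e F f) < \<epsilon> / ((cmod c)\<^sup>2 + 1)"
    unfolding approximable_def by meson
  have "residual e F (\<lambda>x. c * f x) = (\<lambda>x. c * residual e F f x)"
    by (simp add: residual_def L2_inner_cmult_left algebra_simps sum_distrib_left)
  then have "sqnorm (residual e F (\<lambda>x. c * f x)) = (cmod c)\<^sup>2 * sqnorm (residual e F f)"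
    by (simp add: sqnorm_cmult)
  also have "\<dots> \<le> ((cmod c)\<^sup>2 + 1) * sqnorm (residual e F f)"
    by (simp add: mult_right_mono sqnorm_nonneg)
  also have "\<dots> < \<epsilon>"
  proof -
    have "0 < (cmod c)\<^sup>2 + 1"
      by (simp add: add_nonneg_pos)
    with F(2) have "sqnorm (residual e F f) * ((cmod c)\<^sup>2 + 1) < \<epsilon>"
      by (simp only: pos_less_divide_eq)
    then show ?thesis by (simp only: mult.commute)
  qed
  finally show "\<exists>F. finite F \<and> sqnorm (residual e F (\<lambda>x. c * f x)) < \<epsilon>"
    using F by blast
qed

lemma approximable_zero: "approximable e (\<lambda>x. 0)"
  unfolding approximable_def
  by (auto simp: square_integrable_zero residual_def L2_inner_def sqnorm_def intro!: exI[of _ "{}"])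

lemma approximable_sum:
  assumes "orthonormal_system e" "\<And>i. i \<in> F \<Longrightarrow> approximable e (f i)"
  shows "approximable e (\<lambda>x. \<Sum>i\<in>F. f i x)"
  using assms(2)
  by (induction F rule: infinite_finite_induct)
     (auto intro: approximable_add[OF assms(1)] approximable_zero)

lemma approximable_limit:
  assumes e: "orthonormal_system e" and f: "square_integrable lborel f"
    and g: "\<And>n. approximable e (g n)"
    and lim: "(\<lambda>n. sqnorm (\<lambda>x. f x - g n x)) \<longlonglongrightarrow> 0"
  shows "approximable e f"
  unfolding approximable_def
proof (intro conjI allI impI f)
  fix \<epsilon> :: real assume "\<epsilon> > 0"
  then have \<epsilon>: "\<epsilon> / 4 > 0" by simp
  then obtain n where n: "sqnorm (\<lambda>x. f x - g n x) < \<epsilon> / 4"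
    using order_tendstoD(2)[OF lim] by (fastforce dest: eventually_happens)
  from g[of n] \<epsilon> obtain F where F: "finite F" "sqnorm (residual e F (g n)) < \<epsilon> / 4"
    unfolding approximable_def by meson
  have gn: "square_integrable lborel (g n)"
    using g by (simp add: approximable_def)
  have d: "square_integrable lborel (\<lambda>x. f x - g n x)"
    using f gn by (rule square_integrable_diff)
  have "residual e F f = (\<lambda>x. residual e F (g n) x + residual e F (\<lambda>x. f x - g n x) x)"
    using residual_add[OF e gn d, of F] by simp
  then have "sqnorm (residual e F f) \<le> 2 * sqnorm (residual e F (g n)) + 2 * sqnorm (residual e F (\<lambda>x. f x - g n x))"
    using e gn d by (simp add: sqnorm_add_le square_integrable_residual)
  also have "sqnorm (residual e F (\<lambda>x. f x - g n x)) \<le> sqnorm (\<lambda>x. f x - g n x)"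
    using F e d by (simp add: sqnorm_residual sum_nonneg)
  finally have "sqnorm (residual e F f) < \<epsilon>"
    using n F by linarith
  with F show "\<exists>F. finite F \<and> sqnorm (residual e F f) < \<epsilon>"
    by blast
qed

section \<open>The Haar system\<close>

definition dyadic :: "int \<Rightarrow> int \<Rightarrow> real set"
  where "dyadic k j = {x. \<lfloor>2 powi k * x\<rfloor> = j}"

lemma dyadic_eq_interval: "dyadic k j = {of_int j / 2 powi k ..< (of_int j + 1) / 2 powi k}"
  by (auto simp: dyadic_def floor_eq_iff field_simps)

lemma dyadic_sets [measurable]: "dyadic k j \<in> sets borel"
  by (simp add: dyadic_eq_interval)

lemma measure_dyadic: "measure lborel (dyadic k j) = 2 powi (- k)"
  and emeasure_dyadic_finite: "emeasure lborel (dyadic k j) < \<infinity>"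
proof -
  have "of_int j / (2::real) powi k \<le> (of_int j + 1) / 2 powi k"
    by (intro divide_right_mono) auto
  then show "measure lborel (dyadic k j) = 2 powi (- k)" "emeasure lborel (dyadic k j) < \<infinity>"
    by (auto simp: dyadic_eq_interval power_int_minus field_simps)
qed

text \<open>Passing to a coarser level drops binary digits of the cell index.\<close>

lemma dyadic_coarser:
  assumes "x \<in> dyadic l j" "k \<le> l"
  shows "x \<in> dyadic k (j div 2 ^ nat (l - k))"
proof -
  have "(2::real) powi l = 2 powi k * 2 powi (l - k)"
    by (simp flip: power_int_add)
  also have "(2::real) powi (l - k) = of_int (2 ^ nat (l - k))"
    using assms(2) by (simp add: power_int_def)
  finally have "2 powi k * x = 2 powi l * x / real_of_int (2 ^ nat (l - k))"
    by simp
  then show ?thesis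
    using assms(1) by (simp only: dyadic_def mem_Collect_eq floor_divide_real_eq_div zero_le_power zero_le_numeral)
qed

text \<open>Same function as the dilated and translated Haar wavelet (\<open>haar_atom_eq\<close>), but expressed by the
  two halves of its cell, which makes its values depend on the cell index alone.\<close>

definition haar_atom :: "int \<Rightarrow> int \<Rightarrow> real \<Rightarrow> complex"
  where "haar_atom k j x = of_real (2 powr (of_int k / 2)) *
    (indicator (dyadic (k + 1) (2 * j)) x - indicator (dyadic (k + 1) (2 * j + 1)) x)"

lemma haar_wavelet_eq: "haar_wavelet (2 powi k * x - of_int j) =
    indicator (dyadic (k + 1) (2 * j)) x - indicator (dyadic (k + 1) (2 * j + 1)) x"
proof -
  have "2 powi (k + 1) * x = 2 * (2 powi k * x)"
    by (simp add: power_int_add)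
  then show ?thesis
    by (auto simp: haar_wavelet_def dyadic_def indicator_def floor_eq_iff)
qed

lemma haar_atom_eq:
  "haar_atom k j = dilation_pow k (translation_pow j (\<lambda>x. of_real (haar_wavelet x)))"
  unfolding haar_atom_def dilation_pow_def translation_pow_def haar_wavelet_eq
  by (auto simp: fun_eq_iff indicator_def)

lemma haar_atom_on_dyadic:
  assumes "x \<in> dyadic l j" "k < l"
  shows "haar_atom k m x = of_real (2 powr (of_int k / 2)) *
    (of_bool (j div 2 ^ nat (l - k - 1) = 2 * m) - of_bool (j div 2 ^ nat (l - k - 1) = 2 * m + 1))"
  using dyadic_coarser[OF assms(1), of "k + 1"] assms(2)
  by (auto simp: haar_atom_def dyadic_def indicator_def diff_diff_eq)

lemma haar_atom_outside:
  assumes "x \<notin> dyadic k j"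
  shows "haar_atom k j x = 0"
proof -
  have "x \<notin> dyadic (k + 1) (2 * j)" "x \<notin> dyadic (k + 1) (2 * j + 1)"
    using assms dyadic_coarser[of x "k + 1" "2 * j" k] dyadic_coarser[of x "k + 1" "2 * j + 1" k] by auto
  then show ?thesis
    by (simp add: haar_atom_def)
qed

lemma powr_half_power2: "((2::real) powr (of_int k / 2))\<^sup>2 = 2 powi k"
proof -
  have "((2::real) powr (of_int k / 2))\<^sup>2 = 2 powr (of_int k / 2 + of_int k / 2)"
    unfolding powr_add power2_eq_square ..
  then show ?thesis
    by (simp add: powr_real_of_int')
qed

lemma integrable_indicator_dyadic: "integrable lborel (indicator (dyadic k j) :: real \<Rightarrow> complex)"
  and integral_indicator_dyadic: "(\<integral>x. indicator (dyadic k j) x \<partial>lborel) = complex_of_real (2 powi (- k))"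
proof -
  have eq: "indicator (dyadic k j) = (\<lambda>x. complex_of_real (indicator (dyadic k j) x))"
    by (auto simp: indicator_def)
  show "integrable lborel (indicator (dyadic k j) :: real \<Rightarrow> complex)"
    unfolding eq using emeasure_dyadic_finite by (intro integrable_of_real integrable_real_indicator) auto
  show "(\<integral>x. indicator (dyadic k j) x \<partial>lborel) = complex_of_real (2 powi (- k))"
    by (subst eq) (simp add: measure_dyadic del: power_int_minus of_real_power_int)
qed

lemma norm_haar_atom: "(cmod (haar_atom k j x))\<^sup>2 =
    2 powi k * (indicator (dyadic (k + 1) (2 * j)) x + indicator (dyadic (k + 1) (2 * j + 1)) x)"
  by (auto simp: haar_atom_def norm_mult power_mult_distrib powr_half_power2 indicator_def dyadic_def)

lemma square_integrable_haar_atom: "square_integrable lborel (haar_atom k j)"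
  and integral_haar_atom: "(\<integral>x. haar_atom k j x \<partial>lborel) = 0"
  and sqnorm_haar_atom: "sqnorm (haar_atom k j) = 1"
proof -
  have i: "integrable lborel (indicator (dyadic k j) :: real \<Rightarrow> real)" for k j
    using emeasure_dyadic_finite by (intro integrable_real_indicator) auto
  have m: "haar_atom k j \<in> borel_measurable lborel"
    unfolding haar_atom_def by measurable
  then show "square_integrable lborel (haar_atom k j)"
    unfolding square_integrable_def norm_haar_atom using i by auto
  show "(\<integral>x. haar_atom k j x \<partial>lborel) = 0"
    unfolding haar_atom_def using integrable_indicator_dyadic
    by (simp add: integral_indicator_dyadic)
  show "sqnorm (haar_atom k j) = 1"
    unfolding sqnorm_def norm_haar_atom using i 
    by (simp add: measure_dyadic power_int_diff power_int_minus)
qed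

lemma L2_inner_const:
  assumes "\<And>x. f x \<noteq> 0 \<Longrightarrow> g x = c"
  shows "L2_inner f g = cnj c * (\<integral>x. f x \<partial>lborel)"
proof -
  have "f x * cnj (g x) = cnj c * f x" for x
    using assms[of x] by (cases "f x = 0") auto
  then have "L2_inner f g = (\<integral>x. cnj c * f x \<partial>lborel)"
    unfolding L2_inner_def by presburger
  then show ?thesis by simp
qed

definition haar_system :: "int \<times> int \<Rightarrow> real \<Rightarrow> complex"
  where "haar_system = (\<lambda>(k, j). haar_atom k j)"

lemma haar_atom_orthogonal_coarser:
  assumes "k < l"
  shows "L2_inner (haar_atom l j) (haar_atom k m) = 0"
  using L2_inner_const[of "haar_atom l j" "haar_atom k m", OF haar_atom_on_dyadic[of _ l j k m]]
    haar_atom_outside[of _ l j] assms integral_haar_atom[of l j] by fastforce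

text \<open>On the support of a finer atom a coarser one is constant, and the finer one has mean zero.\<close>

lemma orthonormal_haar_system: "orthonormal_system haar_system"
  unfolding orthonormal_system_def
proof (intro conjI allI)
  show "square_integrable lborel (haar_system i)" for i
    by (cases i) (simp add: haar_system_def square_integrable_haar_atom)
  have "L2_inner (haar_atom k j) (haar_atom l m) = of_bool (k = l \<and> j = m)" for k j l m
  proof -
    consider "k < l" | "l < k" | "k = l" "j \<noteq> m" | "k = l" "j = m" by force
    then show ?thesis
    proof cases
      case 1 then show ?thesis
        using haar_atom_orthogonal_coarser[of k l m j] L2_inner_commute[of "haar_atom k j" "haar_atom l m"] by simp
    next
      case 2 then show ?thesis
        using haar_atom_orthogonal_coarser[of l k j m] by simp
    next
      case 3
      have "haar_atom k j x * cnj (haar_atom l m x) = 0" for x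
        using haar_atom_outside[of x k j] haar_atom_outside[of x l m] 3 by (cases "x \<in> dyadic k j") (auto simp: dyadic_def)
      then have "L2_inner (haar_atom k j) (haar_atom l m) = (\<integral>x. 0 \<partial>(lborel :: real measure))"
        by (simp only: L2_inner_def)
      with 3 show ?thesis by simp
    next
      case 4 then show ?thesis by (simp add: L2_inner_self sqnorm_haar_atom)
    qed
  qed
  then show "L2_inner (haar_system i) (haar_system j) = of_bool (i = j)" for i j
    by (cases i; cases j) (simp add: haar_system_def)
qed

lemma square_integrable_indicator:
  assumes "A \<in> sets borel" "emeasure lborel A < \<infinity>"
  shows "square_integrable lborel (indicator A :: real \<Rightarrow> complex)"
proof -
  have "(\<lambda>x. (cmod (indicator A x))\<^sup>2) = (indicator A :: real \<Rightarrow> real)"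
    by (auto simp: indicator_def)
  then show ?thesis
    unfolding square_integrable_def using assms by auto
qed

lemma sqnorm_indicator: "A \<in> sets borel \<Longrightarrow> emeasure lborel A < \<infinity> \<Longrightarrow> sqnorm (indicator A) = measure lborel A"
proof -
  have "(\<lambda>x. (cmod (indicator A x))\<^sup>2) = (indicator A :: real \<Rightarrow> real)"
    by (auto simp: indicator_def)
  then show ?thesis
    unfolding sqnorm_def by simp
qed

text \<open>A cell of level \<open>k\<close> meets one atom on every coarser level \<open>k - i\<close>, and the atom is constant on it;
  the squared coefficients are \<open>2\<^sup>-\<^sup>k 2\<^sup>-\<^sup>i\<close>, and they sum up to the measure of the cell.\<close>

lemma approximable_dyadic: "approximable haar_system (indicator (dyadic k j))"
  unfolding approximable_def
proof (intro conjI allI impI)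
  let ?f = "indicator (dyadic k j) :: real \<Rightarrow> complex"
  show sq: "square_integrable lborel ?f"
    using emeasure_dyadic_finite by (intro square_integrable_indicator) auto
  have coeff: "(cmod (L2_inner ?f (haar_atom (k - int i) (j div 2 ^ i))))\<^sup>2 = 2 powi (- k) * (1 / 2) ^ i"
    if "0 < i" for i
  proof -
    define c :: complex where "c = of_real (2 powr (of_int (k - int i) / 2)) *
      (of_bool (j div 2 ^ (i - 1) = 2 * (j div 2 ^ i)) - of_bool (j div 2 ^ (i - 1) = 2 * (j div 2 ^ i) + 1))"
    have "nat (int i - 1) = i - 1" by simp
    then have "haar_atom (k - int i) (j div 2 ^ i) x = c" if "x \<in> dyadic k j" for x
      using haar_atom_on_dyadic[OF that, of "k - int i"] \<open>0 < i\<close> by (simp add: c_def)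
    then have "L2_inner ?f (haar_atom (k - int i) (j div 2 ^ i)) = cnj c * of_real (2 powi (- k))"
      unfolding integral_indicator_dyadic[symmetric, of k j]
      by (intro L2_inner_const) (simp add: indicator_def split: if_splits)
    moreover have "(cmod c)\<^sup>2 = 2 powi (k - int i)"
    proof -
      have "j div 2 ^ i = (j div 2 ^ (i - 1)) div 2"
        using that zdiv_zmult2_eq[of 2 j "2 ^ (i - 1)"] power_minus_mult[of i "2::int"] by simp
      moreover have "q = 2 * (q div 2) \<or> q = 2 * (q div 2) + 1" for q :: int by presburger
      ultimately have "j div 2 ^ (i - 1) = 2 * (j div 2 ^ i) \<or> j div 2 ^ (i - 1) = 2 * (j div 2 ^ i) + 1"
        by metis
      then have "cmod c = 2 powr (of_int (k - int i) / 2)"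
        unfolding c_def norm_mult by (elim disjE) simp_all
      then show ?thesis by (simp only: powr_half_power2)
    qed
    ultimately have "(cmod (L2_inner ?f (haar_atom (k - int i) (j div 2 ^ i))))\<^sup>2 =
        2 powi (k - int i) * (2 powi (- k))\<^sup>2"
      by (simp add: norm_mult power_mult_distrib norm_power_int)
    also have "\<dots> = 2 powi (- k) * (1 / 2) ^ i"
      by (simp add: power_int_diff power_int_minus power2_eq_square field_simps power_one_over)
    finally show ?thesis .
  qed
  fix \<epsilon> :: real assume "\<epsilon> > 0"
  have "(\<lambda>n. 2 powi (- k) * (1 / 2) ^ n :: real) \<longlonglongrightarrow> 2 powi (- k) * 0"
    by (intro tendsto_intros) auto
  then obtain n where n: "2 powi (- k) * (1 / 2) ^ n < \<epsilon>"
    using order_tendstoD(2)[of _ _ _ \<epsilon>] \<open>\<epsilon> > 0\<close> by (fastforce dest: eventually_happens)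
  define F where "F = (\<lambda>i. (k - int i, j div 2 ^ i)) ` {1..n}"
  have "inj_on (\<lambda>i. (k - int i, j div 2 ^ i)) {1..n}"
    by (auto simp: inj_on_def)
  then have "(\<Sum>i\<in>F. (cmod (L2_inner ?f (haar_system i)))\<^sup>2) =
      (\<Sum>i=1..n. (cmod (L2_inner ?f (haar_atom (k - int i) (j div 2 ^ i))))\<^sup>2)"
    unfolding F_def by (simp add: sum.reindex haar_system_def)
  also have "\<dots> = (\<Sum>i=1..n. 2 powi (- k) * (1 / 2) ^ i)"
    by (intro sum.cong refl coeff) auto
  also have "\<dots> = 2 powi (- k) * (1 - (1 / 2) ^ n)"
    by (induction n) (simp_all add: algebra_simps)
  finally have "sqnorm (residual haar_system F ?f) = 2 powi (- k) * (1 / 2) ^ n"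
    using sqnorm_residual[OF orthonormal_haar_system sq, of F] emeasure_dyadic_finite[of k j]
    by (simp add: F_def sqnorm_indicator measure_dyadic algebra_simps)
  with n show "\<exists>F. finite F \<and> sqnorm (residual haar_system F ?f) < \<epsilon>"
    by (intro exI[of _ F]) (simp add: F_def)
qed

text \<open>Bounded Borel sets have finite measure. Windows with integer ends are unions of unit cells, so
  cutting a cell of nonnegative level by a window leaves all of it or nothing.\<close>

definition window :: "nat \<Rightarrow> real set"
  where "window N = {x. \<lfloor>x\<rfloor> \<in> {- int N..<int N}}"

lemma window_eq_interval: "window N = {- real N..<real N}"
  by (auto simp: window_def le_floor_iff floor_less_iff)

lemma window_sets [measurable]: "window N \<in> sets borel"
  by (simp add: window_eq_interval)

lemma emeasure_window_finite: "emeasure lborel (window N) < \<infinity>"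
  by (simp add: window_eq_interval)

lemma emeasure_Int_window_finite: "A \<in> sets borel \<Longrightarrow> emeasure lborel (A \<inter> window N) < \<infinity>"
  by (rule le_less_trans[OF emeasure_mono emeasure_window_finite[of N]]) auto

lemma approximable_window: "approximable haar_system (indicator (window N))"
proof -
  have "indicator (window N) x = (\<Sum>i\<in>{- int N..<int N}. indicator (dyadic 0 i) x :: complex)" for x
    by (simp add: window_def dyadic_def indicator_def)
  then have "indicator (window N) = (\<lambda>x. \<Sum>i\<in>{- int N..<int N}. indicator (dyadic 0 i) x :: complex)" 
    by blast
  then show ?thesis
    by (simp add: approximable_sum approximable_dyadic orthonormal_haar_system)
qed

text \<open>The empty set makes this family stable under intersection, as two cells are nested or
  disjoint. Coarse cells are excluded because windows would cut them.\<close>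

definition small_dyadics :: "real set set"
  where "small_dyadics = insert {} {dyadic (int k) j |k j. True}"

lemma Int_stable_small_dyadics: "Int_stable small_dyadics"
proof -
  have le: "dyadic (int k) j \<inter> dyadic (int l) m \<in> {{}, dyadic (int l) m}" if "k \<le> l" for k l j m
    using dyadic_coarser[of _ "int l" m "int k"] that by (fastforce simp: dyadic_def)
  have "dyadic (int k) j \<inter> dyadic (int l) m \<in> small_dyadics" for k l j m
  proof (cases "k \<le> l")
    case True
    with le[of k l j m] show ?thesis by (auto simp: small_dyadics_def)
  next
    case False
    with le[of l k m j] show ?thesis by (auto simp: small_dyadics_def Int_commute)
  qed
  moreover have "{} \<in> small_dyadics"
    by (simp add: small_dyadics_def)
  ultimately show ?thesis
    unfolding Int_stable_def by (subst small_dyadics_def, subst small_dyadics_def) auto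
qed

lemma sigma_small_dyadics: "sigma_sets UNIV small_dyadics = sets borel"
proof
  show "sigma_sets UNIV small_dyadics \<subseteq> sets borel"
    by (rule sigma_algebra.sigma_sets_subset[OF sets.sigma_algebra_axioms[of borel, simplified]])
       (auto simp: small_dyadics_def)
  have "S \<in> sigma_sets UNIV small_dyadics" if "open S" for S :: "real set"
  proof -
    define B where "B = {D \<in> range (\<lambda>(k, j). dyadic (int k) j). D \<subseteq> S}"
    have "x \<in> \<Union>B" if "x \<in> S" for x
    proof -
      from \<open>open S\<close> that obtain e where e: "e > 0" "ball x e \<subseteq> S"
        by (auto simp: open_contains_ball)
      obtain k where k: "(1 / 2) ^ k < e"
        using real_arch_pow_inv[of e "1 / 2"] e by auto
      define j where "j = \<lfloor>2 powi int k * x\<rfloor>"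
      have "dyadic (int k) j \<subseteq> ball x e"
      proof
        fix y assume "y \<in> dyadic (int k) j"
        then have "\<bar>2 ^ k * y - 2 ^ k * x\<bar> < 1"
          by (auto simp: dyadic_def j_def) linarith
        also have "2 ^ k * y - 2 ^ k * x = 2 ^ k * (y - x)"
          by (simp add: algebra_simps)
        finally have "2 ^ k * \<bar>y - x\<bar> < 1"
          by (simp only: abs_mult power_abs abs_numeral)
        then have "\<bar>y - x\<bar> < (1 / 2) ^ k"
          by (simp add: field_simps)
        with k show "y \<in> ball x e"
          by (simp add: dist_real_def abs_minus_commute)
      qed
      with e have "dyadic (int k) j \<in> B"
        by (auto simp: B_def)
      moreover have "x \<in> dyadic (int k) j"
        by (simp add: dyadic_def j_def)
      ultimately show ?thesis by blast
    qed
    then have "S = \<Union>B"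
      by (auto simp: B_def)
    moreover have "\<Union>B \<in> sigma_sets UNIV small_dyadics"
    proof (rule sigma_sets_UNION)
      show "countable B"
        unfolding B_def by (rule countable_subset[OF Collect_restrict]) auto
      show "b \<in> sigma_sets UNIV small_dyadics" if "b \<in> B" for b
        using that by (intro sigma_sets.Basic) (auto simp: B_def small_dyadics_def)
    qed
    ultimately show ?thesis by simp
  qed
  then have "sigma_sets UNIV {S :: real set. open S} \<subseteq> sigma_sets UNIV small_dyadics"
    by (intro sigma_sets_mono) auto
  then show "sets borel \<subseteq> sigma_sets UNIV small_dyadics"
    by (simp add: borel_def)
qed

text \<open>A Dynkin argument. Complements stay within the window because its indicator is
  approximable, and disjoint unions are limits in mean square by dominated convergence.\<close>

lemma approximable_indicator:
  assumes "A \<in> sets borel"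
  shows "approximable haar_system (indicator (A \<inter> window N))"
proof -
  note e = orthonormal_haar_system
  have "indicator {} = (\<lambda>x::real. 0 :: complex)"
    by (simp add: fun_eq_iff)
  then have none: "approximable haar_system (indicator {})"
    using approximable_zero[of haar_system] by metis
  have "A \<in> sigma_sets UNIV small_dyadics"
    using assms by (simp add: sigma_small_dyadics)
  from Int_stable_small_dyadics subset_UNIV[of small_dyadics, folded Pow_UNIV] this show ?thesis
  proof (induction rule: sigma_sets_induct_disjoint)
    case (basic A)
    show ?case
    proof (cases "A = {}")
      case False
      with basic obtain k j where A: "A = dyadic (int k) j"
        by (auto simp: small_dyadics_def)
      have "\<lfloor>x\<rfloor> = j div 2 ^ k" if "x \<in> A" for x
        using dyadic_coarser[of x "int k" j 0] that by (simp add: A) (simp add: dyadic_def)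
      then have "A \<inter> window N = A \<or> A \<inter> window N = {}"
        by (auto simp: window_def)
      then show ?thesis
        using approximable_dyadic[of "int k" j] none A by metis
    qed (simp add: approximable_zero)
  next
    case empty
    show ?case by (simp add: approximable_zero)
  next
    case (compl A)
    have "indicator ((UNIV - A) \<inter> window N) =
        (\<lambda>x. indicator (window N) x + (- 1) * indicator (A \<inter> window N) x :: complex)"
      by (auto simp: indicator_def)
    then show ?case
      by (simp only:) (intro approximable_add[OF e] approximable_cmult approximable_window compl)
  next
    case (union A)
    have A [measurable]: "A i \<in> sets borel" for i
      using union by (auto simp: sigma_small_dyadics)
    let ?f = "indicator ((\<Union>i. A i) \<inter> window N) :: real \<Rightarrow> complex"
    let ?g = "\<lambda>n x. \<Sum>i<n. indicator (A i \<inter> window N) x :: complex"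
    have g: "?g n x = indicator ((\<Union>i<n. A i) \<inter> window N) x" for n x
    proof -
      have "indicator (\<Union>i<n. A i \<inter> window N) x = ?g n x"
        by (rule indicator_UN_disjoint)
           (use union(1) in \<open>auto simp: disjoint_family_on_def\<close>)
      moreover have "(\<Union>i<n. A i \<inter> window N) = (\<Union>i<n. A i) \<inter> window N"
        by auto
      ultimately show ?thesis by simp
    qed
    show ?case
    proof (rule approximable_limit[OF e])
      show "square_integrable lborel ?f"
        by (intro square_integrable_indicator emeasure_Int_window_finite) auto
      show "approximable haar_system (?g n)" for n
        using union by (intro approximable_sum e) auto
      have "(\<lambda>n. \<integral>x. (cmod (?f x - ?g n x))\<^sup>2 \<partial>lborel) \<longlonglongrightarrow> (\<integral>x. 0 \<partial>(lborel :: real measure))"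
      proof (rule integral_dominated_convergence)
        show "integrable lborel (indicator (window N) :: real \<Rightarrow> real)"
          using emeasure_window_finite by (intro integrable_real_indicator) auto
        show "AE x in lborel. (\<lambda>n. (cmod (?f x - ?g n x))\<^sup>2) \<longlonglongrightarrow> 0"
        proof (intro AE_I2)
          fix x
          have "(\<lambda>n. indicator (\<Union>i<n. A i) x :: complex) \<longlonglongrightarrow> indicator (\<Union>i. A i) x"
            by (rule LIMSEQ_indicator_UN)
          then have "(\<lambda>n. indicator (window N) x * indicator (\<Union>i<n. A i) x) \<longlonglongrightarrow>
              indicator (window N) x * (indicator (\<Union>i. A i) x :: complex)"
            by (intro tendsto_intros)
          then have "(\<lambda>n. ?g n x) \<longlonglongrightarrow> ?f x"
            unfolding g by (simp add: indicator_inter_arith mult.commute)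
          then have "(\<lambda>n. (cmod (?f x - ?g n x))\<^sup>2) \<longlonglongrightarrow> (cmod (?f x - ?f x))\<^sup>2"
            by (intro tendsto_intros)
          then show "(\<lambda>n. (cmod (?f x - ?g n x))\<^sup>2) \<longlonglongrightarrow> 0"
            by simp
        qed
        show "AE x in lborel. norm ((cmod (?f x - ?g n x))\<^sup>2) \<le> indicator (window N) x" for n
          unfolding g by (auto simp: indicator_def)
      qed (auto simp: g)
      then show "(\<lambda>n. sqnorm (\<lambda>x. ?f x - ?g n x)) \<longlonglongrightarrow> 0"
        by (simp add: sqnorm_def)
    qed
  qed
qed

text \<open>Completeness of the Haar system. Approximation by simple functions cut off by windows
  reduces it to indicators of bounded Borel sets.\<close>

lemma approximable_haar_system:
  assumes f: "square_integrable lborel f"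
  shows "approximable haar_system f"
proof -
  note e = orthonormal_haar_system
  have fm: "f \<in> borel_measurable lborel" and fi: "integrable lborel (\<lambda>x. (cmod (f x))\<^sup>2)"
    using f by (auto simp: square_integrable_def)
  from borel_measurable_implies_sequence_metric[OF fm, of 0] obtain s where
    s: "\<And>i. simple_function lborel (s i)" and
    lim: "\<And>x. (\<lambda>i. s i x) \<longlonglongrightarrow> f x" and
    bound: "\<And>i x. cmod (s i x) \<le> 2 * cmod (f x)"
    by auto
  have [measurable]: "f \<in> borel_measurable borel" "s i \<in> borel_measurable borel" for i
    using fm borel_measurable_simple_function[OF s] by auto
  let ?g = "\<lambda>n x. indicator (window n) x * s n x"
  show ?thesis
  proof (rule approximable_limit[OF e f])
    fix n
    have fin: "finite (range (s n))" and pre: "s n -` {y} \<in> sets borel" for y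
      using simple_functionD[OF s[of n]] by auto
    have "?g n x = (\<Sum>y\<in>range (s n). y * indicator (s n -` {y} \<inter> window n) x)" for x
    proof -
      have "(\<Sum>y\<in>range (s n). y * indicator (s n -` {y} \<inter> window n) x) =
          (\<Sum>y\<in>{s n x}. y * indicator (s n -` {y} \<inter> window n) x)"
        using fin by (intro sum.mono_neutral_right) (auto simp: indicator_def)
      then show ?thesis by (simp add: indicator_def)
    qed
    then have "?g n = (\<lambda>x. \<Sum>y\<in>range (s n). y * indicator (s n -` {y} \<inter> window n) x)"
      by blast
    then show "approximable haar_system (?g n)"
      using approximable_sum[OF e, of "range (s n)" "\<lambda>y x. y * indicator (s n -` {y} \<inter> window n) x"]
      by (simp add: approximable_cmult approximable_indicator pre)
  next
    have "(\<lambda>n. \<integral>x. (cmod (f x - ?g n x))\<^sup>2 \<partial>lborel) \<longlonglongrightarrow> (\<integral>x. 0 \<partial>(lborel :: real measure))"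
    proof (rule integral_dominated_convergence)
      show "integrable lborel (\<lambda>x. 9 * (cmod (f x))\<^sup>2)"
        using fi by simp
      show "AE x in lborel. (\<lambda>n. (cmod (f x - ?g n x))\<^sup>2) \<longlonglongrightarrow> 0"
      proof (intro AE_I2)
        fix x :: real
        have "\<forall>\<^sub>F n in sequentially. ?g n x = s n x"
        proof (rule eventually_sequentiallyI)
          fix n assume "nat (\<lceil>\<bar>x\<bar>\<rceil> + 1) \<le> n"
          then have "\<bar>x\<bar> < real n" by linarith
          then show "?g n x = s n x"
            by (auto simp: window_eq_interval indicator_def)
        qed
        then have "(\<lambda>n. ?g n x) \<longlonglongrightarrow> f x"
          using lim[of x] by (subst tendsto_cong) auto
        then have "(\<lambda>n. (cmod (f x - ?g n x))\<^sup>2) \<longlonglongrightarrow> (cmod (f x - f x))\<^sup>2"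
          by (intro tendsto_intros)
        then show "(\<lambda>n. (cmod (f x - ?g n x))\<^sup>2) \<longlonglongrightarrow> 0"
          by simp
      qed
      show "AE x in lborel. norm ((cmod (f x - ?g n x))\<^sup>2) \<le> 9 * (cmod (f x))\<^sup>2" for n
      proof (intro AE_I2)
        fix x
        have "cmod (?g n x) \<le> 2 * cmod (f x)"
          using bound[where x = x] by (auto simp: indicator_def)
        then have "cmod (f x - ?g n x) \<le> 3 * cmod (f x)"
          using norm_triangle_ineq4[of "f x" "?g n x"] by linarith
        then have "(cmod (f x - ?g n x))\<^sup>2 \<le> (3 * cmod (f x))\<^sup>2"
          by (intro power_mono) auto
        then show "norm ((cmod (f x - ?g n x))\<^sup>2) \<le> 9 * (cmod (f x))\<^sup>2"
          by (simp add: power_mult_distrib)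
      qed
    qed auto
    then show "(\<lambda>n. sqnorm (\<lambda>x. f x - ?g n x)) \<longlonglongrightarrow> 0"
      by (simp add: sqnorm_def)
  qed
qed

section \<open>Tight frames generated on the unit interval\<close>

lemma norm_vec2_squared: "(norm (x :: complex^2))\<^sup>2 = (\<Sum>i\<in>UNIV. (cmod (x $ i))\<^sup>2)"
  by (simp add: norm_vec_def L2_set_def sum_nonneg)

text \<open>The two generators split the Parseval identity of the Haar system in the proportions of the
  squared entries of \<open>u\<close>.\<close>

lemma tight_wavelet_frame_haar:
  assumes "norm u = 1"
  shows "tight_wavelet_frame (\<lambda>i x. u $ i * of_real (haar_wavelet x)) 1"
  unfolding tight_wavelet_frame_def
proof (intro allI impI)
  fix f :: "real \<Rightarrow> complex" assume f: "square_integrable lborel f"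
  let ?g = "\<lambda>(i, k, j). (cmod (L2_inner f (dilation_pow k (translation_pow j
    (\<lambda>x. u $ i * of_real (haar_wavelet x))))))\<^sup>2"
  have "dilation_pow k (translation_pow j (\<lambda>x. u $ i * of_real (haar_wavelet x))) =
      (\<lambda>x. u $ i * haar_atom k j x)" for k j i
    unfolding haar_atom_eq dilation_pow_def translation_pow_def by (simp add: mult.left_commute)
  then have g: "?g (i, p) = (cmod (u $ i))\<^sup>2 * (cmod (L2_inner f (haar_system p)))\<^sup>2" for i p
    by (cases p) (simp add: L2_inner_cmult_right norm_mult power_mult_distrib haar_system_def)
  have level: "(?g has_sum ((cmod (u $ i))\<^sup>2 * sqnorm f)) (Pair i ` UNIV)" for i
  proof -
    have "((\<lambda>p. (cmod (u $ i))\<^sup>2 * (cmod (L2_inner f (haar_system p)))\<^sup>2) has_sum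
        ((cmod (u $ i))\<^sup>2 * sqnorm f)) UNIV"
      using f by (intro has_sum_cmult_right Parseval_if_approximable orthonormal_haar_system
          approximable_haar_system)
    then have "(?g \<circ> Pair i has_sum ((cmod (u $ i))\<^sup>2 * sqnorm f)) UNIV"
      by (simp only: o_def g)
    then show ?thesis
      by (subst has_sum_reindex) (auto simp: inj_on_def)
  qed
  have "Pair (1::2) ` (UNIV :: (int \<times> int) set) \<union> Pair 2 ` UNIV = UNIV"
    using exhaust_2 by fastforce
  moreover have "Pair (1::2) ` (UNIV :: (int \<times> int) set) \<inter> Pair 2 ` UNIV = {}"
    by auto
  moreover have "(cmod (u $ 1))\<^sup>2 * sqnorm f + (cmod (u $ 2))\<^sup>2 * sqnorm f = 1 * sqnorm f"
    using assms norm_vec2_squared[of u] by (simp add: sum_2 flip: distrib_right)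
  ultimately show "(?g has_sum (1 * (\<integral>x. (cmod (f x))\<^sup>2 \<partial>lborel))) UNIV"
    using has_sum_Un_disjoint[OF level[of 1] level[of 2]] by (auto simp: sqnorm_def)
qed

lemma haar_eq_atom: "q < 2 ^ p \<Longrightarrow> haar (2 ^ p + q) = haar_atom (int p) (int q)"
  unfolding haar_atom_eq dilation_pow_def translation_pow_def
  by (auto simp: fun_eq_iff haar_dyadic)

lemma haar_wavelet_eq_atom: "(\<lambda>x. of_real (haar_wavelet x)) = haar_atom 0 0"
  unfolding haar_atom_eq dilation_pow_def translation_pow_def by simp

lemma haar_coeff_haar_wavelet:
  fixes u :: "complex^2"
  assumes "q < 2 ^ p"
  shows "haar_coeff (\<lambda>i x. u $ i * of_real (haar_wavelet x)) (2 ^ p + q) = (if p = 0 then u else 0)"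
proof -
  have "L2_inner (haar_atom 0 0) (haar_atom (int p) (int q)) = of_bool (p = 0)"
    using orthonormal_haar_system assms
    unfolding orthonormal_system_def haar_system_def by (fastforce simp: split: prod.splits)
  then have "L2_inner (\<lambda>x. u $ i * of_real (haar_wavelet x)) (haar (2 ^ p + q)) = u $ i * of_bool (p = 0)" for i
    unfolding L2_inner_cmult_left haar_eq_atom[OF assms] haar_wavelet_eq_atom by simp
  then show ?thesis
    by (simp add: haar_coeff_def vec_eq_iff)
qed

lemma L2_inner_dilation:
  "L2_inner f (dilation_pow k g) = L2_inner (dilation_pow (- k) f) g"
proof -
  have "L2_inner f (dilation_pow k g) =
      \<bar>2 powi (- k)\<bar> *\<^sub>R (\<integral>x. f (0 + 2 powi (- k) * x) * cnj (dilation_pow k g (0 + 2 powi (- k) * x)) \<partial>lborel)"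
    unfolding L2_inner_def by (rule lborel_integral_real_affine) simp
  also have "\<dots> = (\<integral>x. dilation_pow (- k) f x * cnj (g x) \<partial>lborel)"
  proof -
    have "(2::real) powi (- k) * 2 powr (of_int k / 2) = 2 powr (of_int (- k) + of_int k / 2)"
      unfolding powr_add powr_real_of_int'[symmetric, of 2 "- k", simplified] by simp
    also have "of_int (- k) + of_int k / 2 = (of_int (- k) / 2 :: real)"
      by simp
    finally have "complex_of_real (2 powi (- k)) * of_real (2 powr (of_int k / 2)) = of_real (2 powr (of_int (- k) / 2))"
      by (simp only: flip: of_real_mult)
    then show ?thesis
      unfolding dilation_pow_def scaleR_conv_of_real
      by (subst integral_mult_right_zero[symmetric])
         (auto intro!: Bochner_Integration.integral_cong simp: power_int_minus mult_ac)
  qed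
  finally show ?thesis
    by (simp add: L2_inner_def)
qed

lemma L2_inner_translation:
  "L2_inner (translation_pow j f) (translation_pow j g) = L2_inner f g"
  unfolding L2_inner_def translation_pow_def
  using lborel_integral_real_affine[of 1 "\<lambda>x. f (x - of_int j) * cnj (g (x - of_int j))" "of_int j"]
  by simp

text \<open>Against a function that is constant on the cell of a translated generator, the generator is only
  seen through its mean. The constant zero covers disjoint supports.\<close>

lemma L2_inner_const_on_cell:
  assumes g: "g \<in> L2_unit_interval" and f: "f \<in> borel_measurable lborel"
    and c: "\<And>x. x \<in> dyadic 0 j \<Longrightarrow> f x = c"
  shows "L2_inner f (translation_pow j g) = c * cnj (\<integral>x. g x \<partial>lborel)"
proof -
  have gm: "g \<in> borel_measurable borel"
    using g by (simp add: L2_unit_interval_def square_integrable_def)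
  have gj: "(\<lambda>x. g (x - of_int j)) \<in> borel_measurable lborel"
    using measurable_compose[OF _ gm, of "\<lambda>x. x - of_int j" lborel] by simp
  have "L2_inner f (translation_pow j g) = (\<integral>x. c * cnj (g (x - of_int j)) \<partial>lborel)"
    unfolding L2_inner_def translation_pow_def
  proof (rule integral_cong_AE)
    show "AE x in lborel. f x * cnj (g (x - of_int j)) = c * cnj (g (x - of_int j))"
      \<comment> \<open>Generators may be nonzero at the right end of the closed unit interval.\<close>
      using AE_lborel_singleton[of "of_int j + 1"]
    proof eventually_elim
      case (elim x)
      show ?case
      proof (cases "x \<in> dyadic 0 j")
        case False
        with elim have "x - of_int j \<notin> {0..1}"
          by (auto simp: dyadic_eq_interval)
        with g show ?thesis by (simp add: L2_unit_interval_def)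
      qed (simp add: c)
    qed
  qed (intro borel_measurable_times borel_measurable_cnj borel_measurable_const f gj)+
  also have "\<dots> = c * cnj (\<integral>x. g (x - of_int j) \<partial>lborel)"
    by simp
  also have "(\<integral>x. g (x - of_int j) \<partial>lborel) = (\<integral>x. g x \<partial>lborel)"
    using lborel_integral_real_affine[of 1 "\<lambda>x. g (x - of_int j)" "of_int j"] by simp
  finally show ?thesis .
qed

lemma haar_atom_measurable: "haar_atom k j \<in> borel_measurable lborel"
  using square_integrable_haar_atom by (simp add: square_integrable_def)

lemma dilation_haar_atom: "dilation_pow k (haar_atom l q) = haar_atom (k + l) q"
  unfolding haar_atom_eq dilation_pow(3) ..

lemma translation_haar_atom: "haar_atom 0 q = translation_pow q (haar_atom 0 0)"
  unfolding haar_atom_eq dilation_pow(1) translation_pow(1) ..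

lemma haar_atom_frame_inner:
  "L2_inner (haar_atom 0 q) (dilation_pow k (translation_pow j g)) =
    L2_inner (haar_atom (- k) q) (translation_pow j g)"
  by (simp add: L2_inner_dilation dilation_haar_atom)

lemma haar_coeff_frame_inner:
  assumes "q < 2 ^ m"
  shows "L2_inner (haar_atom 0 (int q)) (dilation_pow (- int m) (translation_pow 0 (\<psi> i))) =
    cnj (haar_coeff \<psi> (2 ^ m + q) $ i)"
  unfolding haar_atom_frame_inner
  by (simp add: haar_coeff_def haar_eq_atom[OF assms] translation_pow(1) L2_inner_commute[of "haar_atom _ _"])

lemma haar_coeff_frame_inner_same:
  "L2_inner (haar_atom 0 q) (dilation_pow 0 (translation_pow q (\<psi> i))) = cnj (haar_coeff \<psi> 1 $ i)"
  using haar_eq_atom[of 0 0] L2_inner_commute[of "haar_atom 0 0"]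
  by (simp add: haar_coeff_def dilation_pow(1) translation_haar_atom[of q] L2_inner_translation)

text \<open>The index \<open>q\<close> below selects the test function: the Haar wavelet translated by \<open>q\<close>, that is
  \<open>haar_atom 0 q\<close>. Against it, generators on levels \<open>k > 0\<close> only show their means, on level zero only the
  translate by \<open>q\<close> is seen, and dilating by \<open>2\<^sup>m\<close> turns levels \<open>k = - m < 0\<close> into the Haar coefficients of
  index \<open>2\<^sup>m + q\<close>.\<close>

lemma tight_frame_rigidity:
  assumes \<psi>: "\<And>i. \<psi> i \<in> L2_unit_interval"
    and frame: "tight_wavelet_frame \<psi> B"
    and van: "\<And>k. haar_coeff \<psi> (2 ^ (k + 1) + 1) = 0"
  shows "(norm (haar_coeff \<psi> 1))\<^sup>2 = B" and "\<And>m. m > 0 \<Longrightarrow> haar_coeff \<psi> (2 ^ m) = 0"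
proof -
  define t where "t q = (\<lambda>(i, k, j). (cmod (L2_inner (haar_atom 0 q)
    (dilation_pow k (translation_pow j (\<psi> i)))))\<^sup>2)" for q
  have sum: "(t q has_sum B) UNIV" for q
    using frame square_integrable_haar_atom[of 0 q] sqnorm_haar_atom[of 0 q]
    unfolding tight_wavelet_frame_def t_def sqnorm_def by fastforce
  have t_nonneg: "t q x \<ge> 0" for q x
    by (simp add: t_def split: prod.splits)
  have cell: "t q (i, k, j) = (cmod c)\<^sup>2 * (cmod (\<integral>x. \<psi> i x \<partial>lborel))\<^sup>2"
    if "\<And>x. x \<in> dyadic 0 j \<Longrightarrow> haar_atom (- k) q x = c" for q i k j c
    unfolding t_def haar_atom_frame_inner
    by (simp add: L2_inner_const_on_cell[OF \<psi> haar_atom_measurable that] norm_mult power_mult_distrib)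
  \<comment> \<open>The \<open>2\<^sup>k\<close> cells of level \<open>k\<close> inside \<open>[1, 2)\<close> contribute \<open>2\<^sup>-\<^sup>k\<close> times the squared modulus of the mean
    each, so finitely many levels exceed any bound unless the mean is zero.\<close>
  have mean: "(\<integral>x. \<psi> i x \<partial>lborel) = 0" for i
  proof (rule ccontr)
    define M where "M = (cmod (\<integral>x. \<psi> i x \<partial>lborel))\<^sup>2"
    assume "(\<integral>x. \<psi> i x \<partial>lborel) \<noteq> 0"
    then have "M > 0" by (simp add: M_def)
    then obtain n where n: "B < real n * M"
      using reals_Archimedean3 by blast
    define J where "J = (\<lambda>k::nat. {2 ^ k..<2 ^ Suc k :: int})"
    have t_cell: "t 1 (i, int k, j) = M / 2 ^ k" if "k \<in> {1..n}" "j \<in> J k" for k j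
    proof -
      let ?c = "complex_of_real (2 powr (of_int (- int k) / 2)) *
        (of_bool (j div 2 ^ nat (int k - 1) = 2 * 1) - of_bool (j div 2 ^ nat (int k - 1) = 2 * 1 + 1))"
      have "nat (int k - 1) = k - 1" by simp
      moreover have "2 \<le> j div 2 ^ (k - 1)" "j div 2 ^ (k - 1) < 4"
      proof -
        let ?P = "2 ^ (k - 1) :: int"
        have "2 * ?P = 2 ^ k"
          using that power_minus_mult[of k "2::int"] by (simp add: mult.commute)
        then have j: "2 * ?P \<le> j" "j < 4 * ?P"
          using that by (auto simp: J_def)
        have "2 * ?P div ?P \<le> j div ?P"
          using j(1) by (rule zdiv_mono1) simp
        then show "2 \<le> j div ?P" by simp
        show "j div ?P < 4"
        proof (rule ccontr)
          assume "\<not> j div ?P < 4"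
          then have "4 * ?P \<le> j div ?P * ?P"
            by (intro mult_right_mono) auto
          then show False
            using div_mult_mod_eq[of j ?P] pos_mod_sign[of ?P j, OF zero_less_power] j(2) by linarith
        qed
      qed
      then have "j div 2 ^ (k - 1) = 2 \<or> j div 2 ^ (k - 1) = 3"
        by auto
      ultimately have "cmod ?c = 2 powr (of_int (- int k) / 2)"
        unfolding norm_mult by (elim disjE) simp_all
      then have "(cmod ?c)\<^sup>2 = 2 powi (- int k)"
        by (simp only: powr_half_power2)
      moreover have "haar_atom (- int k) 1 x = ?c" if "x \<in> dyadic 0 j" for x
        using haar_atom_on_dyadic[OF that, of "- int k" 1] \<open>k \<in> {1..n}\<close> by simp
      ultimately show ?thesis
        using cell[of j "int k" 1 ?c i] by (simp add: M_def power_int_minus field_simps)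
    qed
    let ?S = "(\<lambda>(k, j). (i, int k, j)) ` Sigma {1..n} J"
    have "sum (t 1) ?S = (\<Sum>(k, j)\<in>Sigma {1..n} J. t 1 (i, int k, j))"
      by (subst sum.reindex) (auto simp: inj_on_def intro!: sum.cong)
    also have "\<dots> = (\<Sum>k=1..n. \<Sum>j\<in>J k. t 1 (i, int k, j))"
      by (rule sum.Sigma[symmetric]) (auto simp: J_def)
    also have "\<dots> = (\<Sum>k=1..n. \<Sum>j\<in>J k. M / 2 ^ k)"
      by (intro sum.cong refl t_cell) auto
    also have "\<dots> = real n * M"
      by (simp add: J_def)
    finally have "sum (t 1) ?S = real n * M" .
    moreover have "sum (t 1) ?S \<le> B"
      by (rule finite_sum_le_has_sum[OF sum]) (auto simp: J_def t_nonneg)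
    ultimately show False using n by simp
  qed
  \<comment> \<open>Off \<open>(0, 1)\<close> the three cases are finer levels, disjoint supports, and coarser levels at the
    one cell that contains the support of the test function.\<close>
  have zero: "t 1 (i, k, j) = 0" if "(k, j) \<noteq> (0, 1)" for i k j
  proof -
    consider "k > 0" | "k \<le> 0" "j \<noteq> 1 div 2 ^ nat (- k)" | "k < 0" "j = 1 div 2 ^ nat (- k)"
    proof -
      have "k > 0 \<or> k \<le> 0 \<and> j \<noteq> 1 div 2 ^ nat (- k) \<or> k < 0 \<and> j = 1 div 2 ^ nat (- k)"
        using \<open>(k, j) \<noteq> (0, 1)\<close> by (cases "k = 0") auto
      then show thesis using that by blast
    qed
    then show ?thesis
    proof cases
      case 1
      then show ?thesis
        using cell[of j k 1 _ i, OF haar_atom_on_dyadic[of _ 0 j "- k" 1]] mean by simp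
    next
      case 2
      have "haar_atom (- k) 1 x = 0" if "x \<in> dyadic 0 j" for x
      proof (rule haar_atom_outside)
        show "x \<notin> dyadic (- k) 1"
          using dyadic_coarser[of x "- k" 1 0] 2 that by (auto simp: dyadic_def)
      qed
      then show ?thesis
        using cell[of j k 1 0 i] by simp
    next
      case 3
      define m where "m = nat (- k) - 1"
      have k: "k = - int (Suc m)" using 3 by (simp add: m_def)
      have "(1::int) div 2 ^ Suc m = 0"
        by (intro div_pos_pos_trivial one_less_power) simp_all
      then have "j = 0" using 3 by (simp add: k nat_add_distrib)
      then show ?thesis
        using haar_coeff_frame_inner[of 1 "Suc m" \<psi> i, OF one_less_power] van[of m]
        by (simp add: t_def k)
    qed
  qed
  have same: "t q (i, 0, q) = (cmod (haar_coeff \<psi> 1 $ i))\<^sup>2" for q i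
    by (simp add: t_def haar_coeff_frame_inner_same)
  have "(t 1 has_sum (\<Sum>i\<in>UNIV. (cmod (haar_coeff \<psi> 1 $ i))\<^sup>2)) UNIV"
  proof (rule has_sum_finite_neutralI)
    let ?S = "(\<lambda>i. (i, 0, 1)) ` (UNIV :: 2 set) :: (2 \<times> int \<times> int) set"
    show "t 1 x = 0" if "x \<in> UNIV - ?S" for x
      using that by (cases x) (auto intro!: zero)
    show "(\<Sum>i\<in>UNIV. (cmod (haar_coeff \<psi> 1 $ i))\<^sup>2) = sum (t 1) ?S"
      by (subst sum.reindex) (auto simp: inj_on_def same)
  qed auto
  with sum[of 1] show B: "(norm (haar_coeff \<psi> 1))\<^sup>2 = B"
    unfolding norm_vec2_squared using has_sum_unique by blast
  fix m :: nat assume "m > 0"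
  \<comment> \<open>The term of level zero already exhausts the bound, so the one of level \<open>- m\<close> is zero.\<close>
  let ?S = "(\<lambda>i. (i, 0, 0)) ` (UNIV :: 2 set) :: (2 \<times> int \<times> int) set"
  let ?T = "(\<lambda>i. (i, - int m, 0)) ` (UNIV :: 2 set) :: (2 \<times> int \<times> int) set"
  have "sum (t 0) (?S \<union> ?T) = sum (t 0) ?S + sum (t 0) ?T"
    using \<open>m > 0\<close> by (intro sum.union_disjoint) auto
  also have "sum (t 0) ?S = (norm (haar_coeff \<psi> 1))\<^sup>2"
    unfolding norm_vec2_squared by (subst sum.reindex) (auto simp: inj_on_def same)
  also have "sum (t 0) ?T = (norm (haar_coeff \<psi> (2 ^ m)))\<^sup>2"
    unfolding norm_vec2_squared using haar_coeff_frame_inner[of 0 m \<psi>]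
    by (subst sum.reindex) (auto simp: inj_on_def t_def)
  finally have "B + (norm (haar_coeff \<psi> (2 ^ m)))\<^sup>2 = sum (t 0) (?S \<union> ?T)"
    using B by simp
  also have "\<dots> \<le> B"
    by (rule finite_sum_le_has_sum[OF sum]) (auto simp: t_nonneg)
  finally show "haar_coeff \<psi> (2 ^ m) = 0"
    by simp
qed

section \<open>The classification\<close>

lemma vec_dim_span_singleton: "x \<noteq> (0 :: complex^2) \<Longrightarrow> vec.dim (vec.span {x}) = 1"
  by (simp add: vec.dim_eq_card_independent)

text \<open>Uniqueness of expansions makes the Haar coefficients of index \<open>2\<^sup>k\<^sup>+\<^sup>1 + 1\<close> vanish, as the rigidity of the
  frame requires; it then leaves only the constant coefficient of \<open>a0\<close>.\<close>

lemma admissible_1dim_imp_type1: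
  assumes adm: "admissible_1dim a0 a1"
  shows "type1 a0 a1"
proof -
  obtain B0 \<psi> where a1: "AE \<omega> in circle. a1 \<omega> = 0" and B0: "B0 \<noteq> 0"
    and \<psi>: "\<And>i. \<psi> i \<in> L2_unit_interval" and frame: "tight_wavelet_frame \<psi> ((cmod B0)\<^sup>2)"
    and h0: "hardy_expansion (\<lambda>\<omega>. B0 *s a0 \<omega>) (\<lambda>k. haar_coeff \<psi> (2 ^ k))"
    and h1: "hardy_expansion (\<lambda>\<omega>. 0) (\<lambda>k. haar_coeff \<psi> (2 ^ (k + 1) + 1))"
    using adm unfolding admissible_1dim_def by blast
  let ?c = "haar_coeff \<psi> 1"
  have zero: "(\<lambda>k. 0) = geometric_coeffs 0 0 0"
    by (auto simp: geometric_coeffs_def fun_eq_iff split: nat.splits)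
  have "hardy_expansion (\<lambda>\<omega>. 0) (geometric_coeffs 0 0 0)"
    by (rule hardy_expansion_geometric) simp_all
  from hardy_expansion_unique[OF h1 this] have van: "haar_coeff \<psi> (2 ^ (k + 1) + 1) = 0" for k
    unfolding zero[symmetric] by meson
  note rigid = tight_frame_rigidity[OF \<psi> frame van]
  have "(\<lambda>k. haar_coeff \<psi> (2 ^ k)) = geometric_coeffs ?c 0 0"
  proof
    show "haar_coeff \<psi> (2 ^ k) = geometric_coeffs ?c 0 0 k" for k
      using rigid(2)[of k] by (cases k) (simp_all add: geometric_coeffs_def)
  qed
  with h0 have "AE \<omega> in circle. B0 *s a0 \<omega> = ?c + geometric_kernel 0 \<omega> *s 0"
    by (intro geometric_function_if_coeffs) simp_all
  then have a0: "AE \<omega> in circle. a0 \<omega> = (1 / B0) *s ?c"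
  proof eventually_elim
    case (elim \<omega>)
    then have "(1 / B0) *s (B0 *s a0 \<omega>) = (1 / B0) *s ?c" by simp
    with B0 show ?case by (simp add: vector_smult_assoc)
  qed
  have "norm ?c = cmod B0"
    using rigid(1) by (simp add: power2_eq_iff_nonneg)
  then have "norm ((1 / B0) *s ?c) = 1"
    using B0 by (simp add: norm_scale norm_divide)
  with a0 a1 show ?thesis
    unfolding type1_def by (intro exI[of _ "(1 / B0) *s ?c"]) (auto intro: AE_conjI)
qed

text \<open>The generators are the Haar wavelet times the entries of \<open>u\<close>, with frame bound one. Constant
  functions are geometric series with \<open>y = 0\<close>.\<close>

lemma type1_imp_admissible:
  assumes h: "a0 \<in> hardy_space" "a1 \<in> hardy_space" and "type1 a0 a1"
  shows "admissible a0 a1"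
proof -
  obtain u where u: "norm u = 1" and AE: "AE \<omega> in circle. a0 \<omega> = u \<and> a1 \<omega> = 0"
    using assms(3) by (auto simp: type1_def)
  have m: "a0 \<in> borel_measurable circle" "a1 \<in> borel_measurable circle"
    using h by (auto simp: hardy_space_def dest: hardy_expansion_measurable)
  let ?e = "axis 1 1 :: complex^2"
  have e: "?e $ 1 = 1" "?e $ 2 = 0"
    by (simp_all add: axis_def)
  have iso: "partial_isometry_with (vec.span {?e}) (of_columns u 0)"
    unfolding partial_isometry_with_def
  proof (intro conjI ballI allI impI)
    show "vec.subspace (vec.span {?e})"
      by (rule vec.subspace_span)
    show "norm (of_columns u 0 *v x) = norm x" if x: "x \<in> vec.span {?e}" for x
    proof -
      obtain k where "x = k *s ?e"
        using x by (auto simp: vec.span_singleton)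
      then show ?thesis
        by (simp add: of_columns_mult norm_scale u e norm_eq_1_if_cinner cinner_def sum_2)
    qed
    show "of_columns u 0 *v x = 0" if "\<forall>y\<in>vec.span {?e}. cinner x y = 0" for x
    proof -
      have "cinner x ?e = 0"
        using that by (simp add: vec.span_base)
      then have "x $ 1 = 0"
        by (simp add: cinner_def sum_2 e)
      then show ?thesis by (simp add: of_columns_mult)
    qed
  qed
  have isoAE: "AE \<omega> in circle. partial_isometry_with (vec.span {?e}) (of_columns (a0 \<omega>) (a1 \<omega>))"
    using AE by eventually_elim (simp add: iso)
  have "?e \<noteq> 0"
    using e(1) by (metis zero_index zero_neq_one)
  then have V: "vec.dim (vec.span {?e}) = 1"
    by (rule vec_dim_span_singleton)
  have form: "AE \<omega> in circle. a0 \<omega> = u + geometric_kernel 0 \<omega> *s 0 \<and> a1 \<omega> = 0 + geometric_kernel 0 \<omega> *s 0"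
    using AE by simp
  have inner: "M_plus_inner (\<lambda>\<omega>. of_columns (a0 \<omega>) (a1 \<omega>))"
    by (rule M_plus_inner_geometric[OF _ m form isoAE]) simp
  let ?\<psi> = "\<lambda>i x. u $ i * of_real (haar_wavelet x)"
  have coeff: "haar_coeff ?\<psi> (2 ^ p + q) = (if p = 0 then u else 0)" if "q < 2 ^ p" for p q
    using that by (rule haar_coeff_haar_wavelet)
  have "(\<lambda>k. haar_coeff ?\<psi> (2 ^ k)) = geometric_coeffs u 0 0"
    using coeff[of 0] by (auto simp: geometric_coeffs_def fun_eq_iff split: nat.splits)
  moreover have "hardy_expansion a0 (geometric_coeffs u 0 0)"
    by (rule hardy_expansion_geometric[OF _ m(1)]) (use AE in auto)
  ultimately have h0: "hardy_expansion (\<lambda>\<omega>. 1 *s a0 \<omega>) (\<lambda>k. haar_coeff ?\<psi> (2 ^ k))"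
    by simp
  have "(\<lambda>k. haar_coeff ?\<psi> (2 ^ (k + 1) + 1)) = geometric_coeffs 0 0 0"
  proof
    show "haar_coeff ?\<psi> (2 ^ (k + 1) + 1) = geometric_coeffs 0 0 0 k" for k
      using coeff[of 1 "k + 1", OF one_less_power] by (simp add: geometric_coeffs_def split: nat.splits)
  qed
  moreover have "hardy_expansion (\<lambda>\<omega>. 0) (geometric_coeffs 0 0 0)"
    by (rule hardy_expansion_geometric) simp_all
  ultimately have h1: "hardy_expansion (\<lambda>\<omega>. 0) (\<lambda>k. haar_coeff ?\<psi> (2 ^ (k + 1) + 1))"
    by simp
  have "?\<psi> i \<in> L2_unit_interval" for i
    unfolding L2_unit_interval_def haar_wavelet_eq_atom
  proof (intro CollectI conjI allI impI)
    show "square_integrable lborel (\<lambda>x. u $ i * complex_of_real (haar_wavelet x))"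
      using square_integrable_cmult[OF square_integrable_haar_atom[of 0 0], of "u $ i"]
      by (simp flip: haar_wavelet_eq_atom)
  qed (auto simp: haar_wavelet_def indicator_def)
  then have "admissible_1dim a0 a1"
    unfolding admissible_1dim_def
    using V isoAE AE h0 h1 tight_wavelet_frame_haar[OF u]
    by (intro conjI exI[of _ "vec.span {?e}"] exI[of _ "1 :: complex"] exI[of _ ?\<psi>]) auto
  with inner show ?thesis
    by (simp add: admissible_def)
qed

theorem proposition3p11:
  fixes a0 a1 :: "complex \<Rightarrow> complex^2"
  assumes "a0 \<in> hardy_space" and "a1 \<in> hardy_space"
  shows "admissible a0 a1 \<longleftrightarrow>
    type1 a0 a1 \<or> type2 a0 a1 \<or> type3 a0 a1 \<or> type4 a0 a1 \<or> type5 a0 a1"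
proof
  assume "admissible a0 a1"
  then consider "admissible_2dim a0 a1" | "admissible_1dim a0 a1"
    by (auto simp: admissible_def)
  then show "type1 a0 a1 \<or> type2 a0 a1 \<or> type3 a0 a1 \<or> type4 a0 a1 \<or> type5 a0 a1"
  proof cases
    case 1
    then show ?thesis
      using admissible_2dim_imp_realization[OF assms] realization_imp_types by metis
  next
    case 2
    then show ?thesis
      using admissible_1dim_imp_type1 by blast
  qed
next
  assume "type1 a0 a1 \<or> type2 a0 a1 \<or> type3 a0 a1 \<or> type4 a0 a1 \<or> type5 a0 a1"
  then consider "type1 a0 a1" | "type2 a0 a1 \<or> type3 a0 a1 \<or> type4 a0 a1 \<or> type5 a0 a1"
    by blast
  then show "admissible a0 a1"
  proof cases
    case 1
    with assms show ?thesis by (rule type1_imp_admissible)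
  next
    case 2
    then obtain w y b where "realization w y b" "realized_by w y b a0 a1"
      by (rule types_imp_realization)
    with assms show ?thesis by (rule realization_imp_admissible)
  qed
qed

end
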